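(* Let $k$ be an algebraically closed field of characteristic $2$, and let $f\in R_{(2\nu+1)\times m}^{O(2\nu+1)}$. Then $f$ is expressible as a polynomial in the $Q^{(i)}$ and $B^{(ij)}$ ($1\le i,j\le m$) if and only if the variables $z^{(1)},\dots,z^{(m)}$ occur in $f$ only with even exponents.
   Context: $k$ is an algebraically closed field of characteristic $2$. $O(2\nu+1)$ is the group of linear automorphisms of $k^{2\nu+1}$ (coordinates $x_1,\dots,x_\nu,y_1,\dots,y_\nu,z$) preserving the quadratic form $q=x_1y_1+\dots+x_\nu y_\nu+z^2$; its polar form is $\beta(v,w)=q(v+w)-q(v)-q(w)$. $R_{(2\nu+1)\times m}$ is the algebra of polynomials over $k$ in the coordinates $x_t^{(i)},y_t^{(i)},z^{(i)}$ ($1\le t\le\nu$, $1\le i\le m$) of $m$ indeterminate vectors $v^{(1)},\dots,v^{(m)}$ in $k^{2\nu+1}$, with $O(2\nu+1)$ acting diagonally; $R_{(2\nu+1)\times m}^{O(2\nu+1)}$ is the subalgebra of invariants. $Q^{(i)}=q(v^{(i)})=\sum_{t}x_t^{(i)}y_t^{(i)}+(z^{(i)})^2$ and $B^{(ij)}=\beta(v^{(i)},v^{(j)})=\sum_t\left(x_t^{(i)}y_t^{(j)}+y_t^{(i)}x_t^{(j)}\right)$. *)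

theory Defs
  imports
    "HOL-Computational_Algebra.Polynomial"
    "HOL-Library.Poly_Mapping"
    "Jordan_Normal_Form.Matrix"
begin

section \<open>Polynomials in several variables\<close>

text \<open>A monomial is a finitely supported exponent function, a polynomial a finitely supported
  coefficient function on monomials; the ring structure is the convolution product of
  \<^theory>\<open>HOL-Library.Poly_Mapping\<close>.\<close>

type_synonym ('x, 'a) mpol = "('x \<Rightarrow>\<^sub>0 nat) \<Rightarrow>\<^sub>0 'a"

definition Cst :: "'a::zero \<Rightarrow> ('x, 'a) mpol" where
  "Cst c = Poly_Mapping.single 0 c"

definition Var :: "'x \<Rightarrow> ('x, 'a::zero_neq_one) mpol" where
  "Var x = Poly_Mapping.single (Poly_Mapping.single x 1) 1"

definition polys_in :: "'x set \<Rightarrow> ('x, 'a::zero) mpol set" where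
  "polys_in V = {f. \<forall>\<mu> \<in> Poly_Mapping.keys f. Poly_Mapping.keys \<mu> \<subseteq> V}"

definition subst_pol :: "('x \<Rightarrow> ('y, 'a) mpol) \<Rightarrow> ('x, 'a::comm_ring_1) mpol \<Rightarrow> ('y, 'a) mpol" where
  "subst_pol \<sigma> f = (\<Sum>\<mu> \<in> Poly_Mapping.keys f.
     Cst (Poly_Mapping.lookup f \<mu>) * (\<Prod>x \<in> Poly_Mapping.keys \<mu>. \<sigma> x ^ Poly_Mapping.lookup \<mu> x))"


section \<open>The quadratic form and its orthogonal group\<close>

text \<open>The coordinates of a vector of dimension \<open>2 * \<nu> + 1\<close> are numbered from 0: for
  \<open>t < \<nu>\<close>, entry \<open>t\<close> is $x_{t+1}$ and entry \<open>\<nu> + t\<close> is $y_{t+1}$, while entry \<open>2 * \<nu>\<close> is $z$.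
  The scalars may be any commutative ring, since the form is evaluated both on vectors over the
  ground field and on vectors of indeterminates.\<close>

definition qform :: "nat \<Rightarrow> 'a::comm_ring_1 vec \<Rightarrow> 'a" where
  "qform \<nu> v = (\<Sum>t<\<nu>. v $ t * v $ (\<nu> + t)) + (v $ (2 * \<nu>))\<^sup>2"

definition polar :: "nat \<Rightarrow> 'a::comm_ring_1 vec \<Rightarrow> 'a vec \<Rightarrow> 'a" where
  "polar \<nu> v w = qform \<nu> (v + w) - qform \<nu> v - qform \<nu> w"

definition orth_group :: "nat \<Rightarrow> 'a::comm_ring_1 mat set" where
  "orth_group \<nu> = {g \<in> carrier_mat (2 * \<nu> + 1) (2 * \<nu> + 1). invertible_mat g \<and>
     (\<forall>v \<in> carrier_vec (2 * \<nu> + 1). qform \<nu> (g *\<^sub>v v) = qform \<nu> v)}"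


section \<open>Vector invariants\<close>

text \<open>The variable \<open>(a, i)\<close> is the coordinate with number \<open>a\<close> of the vector with number \<open>i\<close>;
  the \<open>m\<close> vectors are numbered \<open>0, \<dots>, m - 1\<close>.\<close>

definition coord_ring :: "nat \<Rightarrow> nat \<Rightarrow> (nat \<times> nat, 'a::zero) mpol set" where
  "coord_ring \<nu> m = polys_in ({..<2 * \<nu> + 1} \<times> {..<m})"

abbreviation z_var :: "nat \<Rightarrow> nat \<Rightarrow> nat \<times> nat" where
  "z_var \<nu> i \<equiv> (2 * \<nu>, i)"

definition gen_vec :: "nat \<Rightarrow> nat \<Rightarrow> (nat \<times> nat, 'a::comm_ring_1) mpol vec" where
  "gen_vec \<nu> i = vec (2 * \<nu> + 1) (\<lambda>a. Var (a, i))"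

text \<open>The result of replacing each \<open>v\<^sup>(\<^sup>i\<^sup>)\<close> by \<open>g v\<^sup>(\<^sup>i\<^sup>)\<close> in \<open>f\<close>. This is the action of the inverse of
  \<open>g\<close> in the convention $(g f)(v) = f(g^{-1} v)$, which has the same invariants.\<close>

definition act :: "nat \<Rightarrow> 'a::comm_ring_1 mat \<Rightarrow> (nat \<times> nat, 'a) mpol \<Rightarrow> (nat \<times> nat, 'a) mpol" where
  "act \<nu> g f = subst_pol (\<lambda>(a, i). (map_mat Cst g *\<^sub>v gen_vec \<nu> i) $ a) f"

definition orth_invariants :: "nat \<Rightarrow> nat \<Rightarrow> (nat \<times> nat, 'a::comm_ring_1) mpol set" where
  "orth_invariants \<nu> m = {f \<in> coord_ring \<nu> m. \<forall>g \<in> orth_group \<nu>. act \<nu> g f = f}"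

definition Qpol :: "nat \<Rightarrow> nat \<Rightarrow> (nat \<times> nat, 'a::comm_ring_1) mpol" where
  "Qpol \<nu> i = qform \<nu> (gen_vec \<nu> i)"

definition Bpol :: "nat \<Rightarrow> nat \<Rightarrow> nat \<Rightarrow> (nat \<times> nat, 'a::comm_ring_1) mpol" where
  "Bpol \<nu> i j = polar \<nu> (gen_vec \<nu> i) (gen_vec \<nu> j)"

text \<open>The last summand vanishes in characteristic 2.\<close>

lemma Bpol_expand:
  "Bpol \<nu> i j = (\<Sum>t<\<nu>. Var (t, i) * Var (\<nu> + t, j) + Var (\<nu> + t, i) * Var (t, j))
     + 2 * Var (2 * \<nu>, i) * Var (2 * \<nu>, j)"
  by (simp add: Bpol_def polar_def qform_def gen_vec_def algebra_simps power2_eq_square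
      sum.distrib)

datatype generator = QG nat | BG nat nat

definition expressible_in_QB :: "nat \<Rightarrow> nat \<Rightarrow> (nat \<times> nat, 'a::comm_ring_1) mpol \<Rightarrow> bool" where
  "expressible_in_QB \<nu> m f \<longleftrightarrow>
     (\<exists>p \<in> polys_in (QG ` {..<m} \<union> {BG i j | i j. i < m \<and> j < m}).
        f = subst_pol (\<lambda>h. case h of QG i \<Rightarrow> Qpol \<nu> i | BG i j \<Rightarrow> Bpol \<nu> i j) p)"

end

theory Submission
  imports Defs
begin

text \<open>Substituting $z^2 = Q + \sum_t x_t y_t$ turns the nontrivial direction into the first
  fundamental theorem for the symplectic group in characteristic 2, which is obtained here together
  with the \<open>Q\<close>'s by a subduction argument. Order the monomials lexicographically by the rows
  $z, x_1, y_1, x_2, y_2, \dots$ of exponents. The Pfaffian of the Gram matrix of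
  $v^{(i_1)}, \dots, v^{(i_{2r})}$ has leading monomial
  $x_1^{(i_1)} y_1^{(i_2)} \cdots x_r^{(i_{2r-1})} y_r^{(i_{2r})}$, and $Q^{(i)}$ has leading monomial
  $(z^{(i)})^2$. Conversely, the leading monomial of an invariant is a semistandard tableau, because
  for any two consecutive rows there is a one-parameter group of isometries that adds a multiple of
  the upper row to the lower one and otherwise only makes monomials smaller. Hence the leading
  monomial of an invariant with even \<open>z\<close>-exponents is that of a product of \<open>Q\<close>'s and
  Pfaffians, and subtracting the product makes the leading monomial smaller.\<close>

section \<open>Substitution as a ring homomorphism\<close>

text \<open>The restriction on the z's excludes something: elements of the group have determinant 1,
  so the determinant of 2\<nu>+1 of the vectors is an invariant, and it is linear in the z's.
  Derivatives lose information in characteristic 2, so invariance is used for whole one-parameter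
  groups: y_t += s x_t, which forces z += r x_t with r^2 = s and hence a square root in k, and
  x_(t+1) += s y_t together with x_t += s y_(t+1). If the lower row is replaced by multiples Y_l of
  the upper one, the group acts by Y_l -> Y_l + s for all l at once, and a coefficient becomes a
  translation-invariant polynomial in the Y_l. A larger monomial means a lexicographically smaller
  exponent of Y. With b_l variables of index l in the lower row and a_l in the upper one, that
  smallest exponent satisfies b_1 + ... + b_i <= a_1 + ... + a_(i-1) for all i, which says that
  columns strictly increase. The torus acting on x_t and y_t makes these two rows equally long, so
  the columns have even height, as the leading monomials of Pfaffians do.\<close>

definition mon :: "('x \<Rightarrow> ('y, 'a) mpol) \<Rightarrow> ('x \<Rightarrow>\<^sub>0 nat) \<Rightarrow> ('y, 'a::comm_ring_1) mpol" where
  "mon \<sigma> \<mu> = (\<Prod>x \<in> Poly_Mapping.keys \<mu>. \<sigma> x ^ Poly_Mapping.lookup \<mu> x)"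

lemma mon_superset:
  assumes "finite A" "Poly_Mapping.keys \<mu> \<subseteq> A"
  shows "mon \<sigma> \<mu> = (\<Prod>x \<in> A. \<sigma> x ^ Poly_Mapping.lookup \<mu> x)"
  unfolding mon_def
  by (rule prod.mono_neutral_left) (use assms in \<open>auto simp: in_keys_iff\<close>)

lemma mon_0 [simp]: "mon \<sigma> 0 = 1"
  by (simp add: mon_def)

lemma mon_add: "mon \<sigma> (\<mu> + \<mu>') = mon \<sigma> \<mu> * mon \<sigma> \<mu>'"
proof -
  let ?A = "Poly_Mapping.keys \<mu> \<union> Poly_Mapping.keys \<mu>'"
  have "Poly_Mapping.keys (\<mu> + \<mu>') \<subseteq> ?A"
    by (rule Poly_Mapping.keys_add)
  then show ?thesis
    by (simp add: mon_superset[of ?A] lookup_add power_add prod.distrib)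
qed

lemma mon_single [simp]: "mon \<sigma> (Poly_Mapping.single x n) = \<sigma> x ^ n"
  by (simp add: mon_def)

lemma subst_pol_mon:
  "subst_pol \<sigma> f = (\<Sum>\<mu> \<in> Poly_Mapping.keys f. Cst (Poly_Mapping.lookup f \<mu>) * mon \<sigma> \<mu>)"
  by (simp add: subst_pol_def mon_def)

lemma Cst_0 [simp]: "Cst 0 = 0"
  by (simp add: Cst_def)

lemma Cst_1 [simp]: "Cst 1 = 1"
  by (simp add: Cst_def)

lemma Cst_add: "Cst (a + b) = Cst a + Cst b"
  by (simp add: Cst_def single_add)

lemma Cst_mult: "Cst (a * b) = Cst a * Cst b"
  by (simp add: Cst_def mult_single)

lemma Cst_power: "Cst (a ^ n) = Cst a ^ n"
  by (induction n) (simp_all add: Cst_mult)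

lemma Cst_prod: "Cst (\<Prod>i\<in>I. a i) = (\<Prod>i\<in>I. Cst (a i))"
  by (induction I rule: infinite_finite_induct) (simp_all add: Cst_mult)

lemma subst_pol_superset:
  assumes "finite A" "Poly_Mapping.keys f \<subseteq> A"
  shows "subst_pol \<sigma> f = (\<Sum>\<mu> \<in> A. Cst (Poly_Mapping.lookup f \<mu>) * mon \<sigma> \<mu>)"
  unfolding subst_pol_mon
  by (rule sum.mono_neutral_left) (use assms in \<open>auto simp: in_keys_iff\<close>)

lemma subst_pol_0 [simp]: "subst_pol \<sigma> 0 = 0"
  by (simp add: subst_pol_def)

lemma subst_pol_add: "subst_pol \<sigma> (f + g) = subst_pol \<sigma> f + subst_pol \<sigma> g"
proof -
  let ?A = "Poly_Mapping.keys f \<union> Poly_Mapping.keys g"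
  have "Poly_Mapping.keys (f + g) \<subseteq> ?A"
    by (rule Poly_Mapping.keys_add)
  then show ?thesis
    by (simp add: subst_pol_superset[of ?A] lookup_add Cst_add sum.distrib algebra_simps)
qed

lemma subst_pol_uminus: "subst_pol \<sigma> (- f) = - subst_pol \<sigma> f"
  using subst_pol_add[of \<sigma> "- f" f] by (simp add: eq_neg_iff_add_eq_0)

lemma subst_pol_diff: "subst_pol \<sigma> (f - g) = subst_pol \<sigma> f - subst_pol \<sigma> g"
  using subst_pol_add[of \<sigma> f "- g"] by (simp add: subst_pol_uminus)

lemma subst_pol_sum: "subst_pol \<sigma> (\<Sum>i\<in>I. f i) = (\<Sum>i\<in>I. subst_pol \<sigma> (f i))"
  by (induction I rule: infinite_finite_induct) (simp_all add: subst_pol_add)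

lemma subst_pol_single: "subst_pol \<sigma> (Poly_Mapping.single \<mu> c) = Cst c * mon \<sigma> \<mu>"
  by (simp add: subst_pol_mon)

lemma subst_pol_Cst [simp]: "subst_pol \<sigma> (Cst c) = Cst c"
  by (subst Cst_def) (simp add: subst_pol_single)

lemma subst_pol_Var [simp]: "subst_pol \<sigma> (Var x) = \<sigma> x"
  by (simp add: Var_def subst_pol_single)

lemma pol_expansion: "f = (\<Sum>\<mu> \<in> Poly_Mapping.keys f. Poly_Mapping.single \<mu> (Poly_Mapping.lookup f \<mu>))"
  by (rule poly_mapping_eqI) (auto simp: lookup_sum lookup_single when_def in_keys_iff)

lemma subst_pol_mult: "subst_pol \<sigma> (f * g) = subst_pol \<sigma> f * subst_pol \<sigma> g"
proof -
  let ?m = "\<lambda>f \<mu>. Poly_Mapping.single \<mu> (Poly_Mapping.lookup f \<mu>)"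
  have "f * g = (\<Sum>\<mu> \<in> Poly_Mapping.keys f. ?m f \<mu>) * (\<Sum>\<mu> \<in> Poly_Mapping.keys g. ?m g \<mu>)"
    using pol_expansion[of f] pol_expansion[of g] by simp
  also have "\<dots> = (\<Sum>\<mu> \<in> Poly_Mapping.keys f. \<Sum>\<mu>' \<in> Poly_Mapping.keys g. ?m f \<mu> * ?m g \<mu>')"
    by (rule sum_product)
  also have "subst_pol \<sigma> \<dots> = (\<Sum>\<mu> \<in> Poly_Mapping.keys f. \<Sum>\<mu>' \<in> Poly_Mapping.keys g.
      Cst (Poly_Mapping.lookup f \<mu>) * mon \<sigma> \<mu> * (Cst (Poly_Mapping.lookup g \<mu>') * mon \<sigma> \<mu>'))"
    by (simp only: mult_single subst_pol_sum subst_pol_single mon_add Cst_mult mult_ac)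
  also have "\<dots> = subst_pol \<sigma> f * subst_pol \<sigma> g"
    by (simp only: subst_pol_mon sum_product)
  finally show ?thesis .
qed

lemma subst_pol_1 [simp]: "subst_pol \<sigma> 1 = 1"
  using subst_pol_Cst[of \<sigma> 1] by simp

lemma subst_pol_power: "subst_pol \<sigma> (f ^ n) = subst_pol \<sigma> f ^ n"
  by (induction n) (simp_all add: subst_pol_mult)

lemma subst_pol_prod: "subst_pol \<sigma> (\<Prod>i\<in>I. f i) = (\<Prod>i\<in>I. subst_pol \<sigma> (f i))"
  by (induction I rule: infinite_finite_induct) (simp_all add: subst_pol_mult)

lemma subst_pol_mon_comp: "subst_pol \<tau> (mon \<sigma> \<mu>) = mon (\<lambda>x. subst_pol \<tau> (\<sigma> x)) \<mu>"
  by (simp add: mon_def subst_pol_prod subst_pol_power)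

lemma subst_pol_comp: "subst_pol \<tau> (subst_pol \<sigma> f) = subst_pol (\<lambda>x. subst_pol \<tau> (\<sigma> x)) f"
  by (simp add: subst_pol_mon[of \<sigma>] subst_pol_mon[of "\<lambda>x. subst_pol \<tau> (\<sigma> x)"] subst_pol_sum
      subst_pol_mult subst_pol_mon_comp)

lemma mon_cong:
  assumes "\<And>x. x \<in> Poly_Mapping.keys \<mu> \<Longrightarrow> \<sigma> x = \<tau> x"
  shows "mon \<sigma> \<mu> = mon \<tau> \<mu>"
  unfolding mon_def using assms by (auto intro: prod.cong)

lemma subst_pol_cong:
  assumes "f \<in> polys_in V" "\<And>x. x \<in> V \<Longrightarrow> \<sigma> x = \<tau> x"
  shows "subst_pol \<sigma> f = subst_pol \<tau> f"
  unfolding subst_pol_mon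
  by (intro sum.cong refl arg_cong2[where f = "(*)"] mon_cong)
    (use assms in \<open>auto simp: polys_in_def\<close>)

lemma lookup_Cst_mult: "Poly_Mapping.lookup (Cst c * f) \<mu> = c * Poly_Mapping.lookup f \<mu>"
  by (simp add: Cst_def flip: mult_map_scale_conv_mult)
     (simp add: Poly_Mapping.map.rep_eq when_def)

text \<open>The same closure argument is needed for polynomials in given variables, for polynomials
  with monomials in a given monoid, for the fixed points of a substitution, and for the polynomials
  in the generators.\<close>

locale subalgebra =
  fixes S :: "('x, 'a::comm_ring_1) mpol set"
  assumes Cst: "Cst c \<in> S"
    and add: "f \<in> S \<Longrightarrow> g \<in> S \<Longrightarrow> f + g \<in> S"
    and mult: "f \<in> S \<Longrightarrow> g \<in> S \<Longrightarrow> f * g \<in> S"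
begin

lemma zero: "0 \<in> S"
  using Cst[of 0] by simp

lemma one: "1 \<in> S"
  using Cst[of 1] by simp

lemma uminus: "f \<in> S \<Longrightarrow> - f \<in> S"
  using mult[OF Cst[of "- 1"], of f] by (simp add: Cst_def single_uminus)

lemma diff: "f \<in> S \<Longrightarrow> g \<in> S \<Longrightarrow> f - g \<in> S"
  using add[OF _ uminus, of f g] by simp

lemma sum: "(\<And>i. i \<in> I \<Longrightarrow> f i \<in> S) \<Longrightarrow> (\<Sum>i\<in>I. f i) \<in> S"
  by (induction I rule: infinite_finite_induct) (auto intro: zero add)

lemma power: "f \<in> S \<Longrightarrow> f ^ n \<in> S"
  by (induction n) (auto intro: one mult)

lemma prod: "(\<And>i. i \<in> I \<Longrightarrow> f i \<in> S) \<Longrightarrow> (\<Prod>i\<in>I. f i) \<in> S"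
  by (induction I rule: infinite_finite_induct) (auto intro: one mult)

lemma subst_pol:
  assumes "p \<in> polys_in V" "\<And>x. x \<in> V \<Longrightarrow> \<sigma> x \<in> S"
  shows "subst_pol \<sigma> p \<in> S"
  unfolding subst_pol_def using assms
  by (intro sum mult Cst prod power) (auto simp: polys_in_def)

end

lemma keys_mult_obtain:
  assumes "\<mu> \<in> Poly_Mapping.keys (f * g)"
  obtains \<alpha> \<beta> where "\<alpha> \<in> Poly_Mapping.keys f" "\<beta> \<in> Poly_Mapping.keys g" "\<mu> = \<alpha> + \<beta>"
  using assms Poly_Mapping.keys_mult[of f g] by auto

lemma keys_Cst: "Poly_Mapping.keys (Cst c) \<subseteq> {0}"
  by (simp add: Cst_def)

text \<open>The set \<open>A\<close> is a submonoid of the monomials, and its monoid algebra is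
  closed under products. It is applied to the monomials in given variables and to those with even
  z-exponents.\<close>

lemma subalgebra_keys:
  assumes "0 \<in> A" "\<And>\<mu> \<mu>'. \<mu> \<in> A \<Longrightarrow> \<mu>' \<in> A \<Longrightarrow> \<mu> + \<mu>' \<in> A"
  shows "subalgebra {f :: ('x, 'a::comm_ring_1) mpol. Poly_Mapping.keys f \<subseteq> A}"
proof
  fix f g :: "('x, 'a) mpol"
  assume fg: "f \<in> {f. Poly_Mapping.keys f \<subseteq> A}" "g \<in> {f. Poly_Mapping.keys f \<subseteq> A}"
  then show "f + g \<in> {f. Poly_Mapping.keys f \<subseteq> A}"
    using Poly_Mapping.keys_add[of f g] by auto
  show "f * g \<in> {f. Poly_Mapping.keys f \<subseteq> A}"
    using fg assms(2) by (auto elim!: keys_mult_obtain)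
qed (use assms keys_Cst in blast)

lemma keys_add_nat: "Poly_Mapping.keys (\<mu> + \<mu>' :: 'x \<Rightarrow>\<^sub>0 nat) = Poly_Mapping.keys \<mu> \<union> Poly_Mapping.keys \<mu>'"
  by (auto simp: in_keys_iff lookup_add)

lemma subalgebra_polys_in: "subalgebra (polys_in V)"
proof -
  have "subalgebra {f. Poly_Mapping.keys f \<subseteq> {\<mu>. Poly_Mapping.keys \<mu> \<subseteq> V}}"
    by (rule subalgebra_keys) (simp_all add: keys_add_nat)
  then show ?thesis
    by (simp add: polys_in_def subset_eq)
qed

lemma subalgebra_fixed: "subalgebra {f. subst_pol \<sigma> f = f}"
  by standard (simp_all add: subst_pol_add subst_pol_mult)

section \<open>Translation-invariant polynomials\<close>

text \<open>The value at \<open>ys\<close> of the polynomial with coefficients \<open>C bs\<close>, where \<open>bs\<close> is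
  bounded entrywise by \<open>cs\<close>.\<close>
fun eval_box :: "nat list \<Rightarrow> (nat list \<Rightarrow> 'a) \<Rightarrow> 'a list \<Rightarrow> 'a::comm_ring_1" where
  "eval_box (c # cs) C (y # ys) = (\<Sum>j\<le>c. y ^ j * eval_box cs (\<lambda>bs. C (j # bs)) ys)"
| "eval_box [] C [] = C []"
| "eval_box _ C _ = 0"

fun lexle :: "nat list \<Rightarrow> nat list \<Rightarrow> bool" where
  "lexle (a # as) (b # bs) \<longleftrightarrow> a < b \<or> a = b \<and> lexle as bs"
| "lexle _ _ \<longleftrightarrow> True"

text \<open>The parameter \<open>e\<close> bounds the degree in \<open>s\<close> after the translation by \<open>s\<close>; splitting off
  the lowest power \<open>b\<close> of the first variable, of degree at most \<open>c\<close>, changes the bound to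
  \<open>e - b + (c - b)\<close>.\<close>
fun dominated :: "nat \<Rightarrow> nat list \<Rightarrow> nat list \<Rightarrow> bool" where
  "dominated e (b # bs) (c # cs) \<longleftrightarrow> b \<le> e \<and> dominated (e - b + (c - b)) bs cs"
| "dominated _ _ _ \<longleftrightarrow> True"

lemma eval_box_0 [simp]: "eval_box cs (\<lambda>_. 0) ys = 0"
  by (induction cs "\<lambda>_ :: nat list. 0 :: 'a" ys rule: eval_box.induct) simp_all

lemma eval_box_cong:
  assumes "length ys = length cs" "\<And>bs. list_all2 (\<le>) bs cs \<Longrightarrow> C bs = D bs"
  shows "eval_box cs C ys = eval_box cs D ys"
  using assms
proof (induction ys cs arbitrary: C D rule: list_induct2)
  case Nil
  then show ?case by simp
next
  case (Cons y ys c cs)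
  have "eval_box cs (\<lambda>bs. C (j # bs)) ys = eval_box cs (\<lambda>bs. D (j # bs)) ys" if "j \<le> c" for j
    by (rule Cons.IH) (use Cons.prems that in auto)
  then show ?case by simp
qed

lemma eval_box_poly:
  fixes C :: "nat list \<Rightarrow> 'a::comm_ring_1"
  shows "\<exists>p. \<forall>s. eval_box cs C (map (\<lambda>y. y + s) ys) = poly p s"
proof (induction cs C ys rule: eval_box.induct)
  case (1 c cs C y ys)
  then have "\<forall>j. \<exists>p. j \<le> c \<longrightarrow> (\<forall>s. eval_box cs (\<lambda>bs. C (j # bs)) (map (\<lambda>y. y + s) ys) = poly p s)"
    by blast
  then obtain p where "\<And>j s. j \<le> c \<Longrightarrow> eval_box cs (\<lambda>bs. C (j # bs)) (map (\<lambda>y. y + s) ys) = poly (p j) s"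
    by metis
  then have "\<forall>s. eval_box (c # cs) C (map (\<lambda>y. y + s) (y # ys)) = poly (\<Sum>j\<le>c. [:y, 1:] ^ j * p j) s"
    by (simp add: poly_sum poly_power)
  then show ?case by blast
next
  case (2 C)
  show ?case by (rule exI[of _ "[:C []:]"]) simp
qed (auto intro: exI[of _ 0])

text \<open>The later variables are chosen first, so that the coefficient of the power
  \<open>b\<close> of the first variable survives; the first variable then only has to avoid
  finitely many roots.\<close>

lemma eval_box_nonzero:
  fixes C :: "nat list \<Rightarrow> 'a::field"
  assumes inf: "infinite (UNIV :: 'a set)" and "list_all2 (\<le>) bs cs" "C bs \<noteq> 0"
  shows "\<exists>ys. length ys = length cs \<and> eval_box cs C ys \<noteq> 0"
  using assms(2,3)
proof (induction bs cs arbitrary: C rule: list_all2_induct)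
  case Nil
  then show ?case by (intro exI[of _ "[]"]) simp
next
  case (Cons b bs c cs)
  obtain ys where ys: "length ys = length cs" "eval_box cs (\<lambda>bs. C (b # bs)) ys \<noteq> 0"
    using Cons.prems Cons.IH[of "\<lambda>bs. C (b # bs)"] by auto
  define p where "p = (\<Sum>j\<le>c. monom (eval_box cs (\<lambda>bs. C (j # bs)) ys) j)"
  have "coeff p b \<noteq> 0"
    using Cons ys by (simp add: p_def coeff_sum)
  then have "p \<noteq> 0" by auto
  then have "{y. poly p y = 0} \<noteq> UNIV"
    using poly_roots_finite inf by metis
  then obtain y where "poly p y \<noteq> 0" by auto
  then have "eval_box (c # cs) C (y # ys) \<noteq> 0"
    by (simp add: p_def poly_sum poly_monom mult.commute)
  then show ?case using ys by (intro exI[of _ "y # ys"]) simp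
qed

lemma poly_eq_0_if_infinite_UNIV:
  fixes p :: "'a::idom poly"
  assumes "infinite (UNIV :: 'a set)" "\<And>y. poly p y = 0"
  shows "p = 0"
proof (rule ccontr)
  assume "p \<noteq> 0"
  from poly_roots_finite[OF this] assms show False by simp
qed

text \<open>The outer variable is y and the coefficients are polynomials in s. For N > d the
  coefficient of s^N is a polynomial in y that vanishes at every point of an infinite field, so it
  is zero.\<close>

lemma degree_coeff_le_if_degree_poly_const_le:
  fixes G :: "'a::field poly poly"
  assumes inf: "infinite (UNIV :: 'a set)" and deg: "\<And>y. degree (poly G [:y:]) \<le> d"
  shows "degree (coeff G l) \<le> d"
proof (rule degree_le, intro allI impI)
  fix N assume "d < N"
  define q where "q = map_poly (\<lambda>p. coeff p N) G"
  have coeff_mult_const: "coeff (p * [:a:]) N = coeff p N * a" for p :: "'a poly" and a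
    by (simp add: mult.commute[of p])
  have "poly q y = coeff (poly G [:y:]) N" for y
  proof -
    have "degree q \<le> degree G"
      by (rule degree_le) (simp add: q_def coeff_map_poly coeff_eq_0)
    then have "poly q y = (\<Sum>i\<le>degree G. coeff q i * y ^ i)"
      unfolding poly_altdef by (intro sum.mono_neutral_left) (auto simp: coeff_eq_0)
    also have "\<dots> = coeff (poly G [:y:]) N"
      by (simp add: poly_altdef[of G] coeff_sum q_def coeff_map_poly poly_const_pow coeff_mult_const
          mult.commute[of "y ^ _"])
    finally show ?thesis .
  qed
  moreover have "coeff (poly G [:y:]) N = 0" for y
    using deg[of y] \<open>d < N\<close> by (simp add: coeff_eq_0)
  ultimately have "q = 0"
    using inf by (intro poly_eq_0_if_infinite_UNIV) auto
  then have "coeff q l = 0" by simp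
  then show "coeff (coeff G l) N = 0"
    by (simp add: q_def coeff_map_poly)
qed

lemma degree_poly_uminus_X_le:
  fixes G :: "'a::field poly poly"
  assumes inf: "infinite (UNIV :: 'a set)" and deg: "\<And>y. degree (poly G [:y:]) \<le> d"
  shows "degree (poly G (- [:0, 1:])) \<le> d + degree G"
  unfolding poly_altdef[of G]
proof (rule degree_sum_le)
  fix i assume "i \<in> {..degree G}"
  have "degree (coeff G i * (- [:0, 1:]) ^ i) \<le> degree (coeff G i) + degree ((- [:0, 1:] :: 'a poly) ^ i)"
    by (rule degree_mult_le)
  also have "\<dots> \<le> d + degree G"
    using degree_coeff_le_if_degree_poly_const_le[OF inf deg, of i] degree_power_le[of "- [:0, 1:] :: 'a poly" i] \<open>i \<in> _\<close>
    by simp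
  finally show "degree (coeff G i * (- [:0, 1:]) ^ i) \<le> d + degree G" .
qed simp

text \<open>The bivariate polynomial $\sum_j (y + s)^j H_j(s)$ is divisible by $(y + s)^b$, and setting
  $y = - s$ in the quotient leaves $H_b$.\<close>
lemma translated_sum_degree:
  fixes H :: "nat \<Rightarrow> 'a::field poly"
  assumes inf: "infinite (UNIV :: 'a set)"
    and low: "\<And>j. j < b \<Longrightarrow> H j = 0" and "b \<le> c"
    and deg: "\<And>y. degree (\<Sum>j\<le>c. [:y, 1:] ^ j * H j) \<le> e"
  shows "degree (H b) \<le> e - b + (c - b)" and "H b \<noteq> 0 \<Longrightarrow> b \<le> e"
proof -
  \<comment> \<open>The quotient by (y + s)^b, with y as the outer variable, so that
    \<open>[:[:0, 1:], 1:]\<close> is s + y.\<close>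
  define G :: "'a poly poly" where "G = (\<Sum>i\<le>c - b. [:[:0, 1:], 1:] ^ i * [:H (b + i):])"
  have G_const: "poly G [:y:] = (\<Sum>i\<le>c - b. [:y, 1:] ^ i * H (b + i))" for y
    by (simp add: G_def poly_sum poly_power mult.commute)
  have G_diag: "poly G (- [:0, 1:]) = H b"
  proof -
    have "poly G (- [:0, 1:]) = (\<Sum>i\<le>c - b. 0 ^ i * H (b + i))"
      by (simp add: G_def poly_sum poly_power mult.commute)
    also have "\<dots> = (\<Sum>i\<in>{0}. 0 ^ i * H (b + i))"
      by (rule sum.mono_neutral_right) auto
    finally show ?thesis by simp
  qed
  have factor: "(\<Sum>j\<le>c. [:y, 1:] ^ j * H j) = [:y, 1:] ^ b * poly G [:y:]" for y
  proof -
    have "(\<Sum>j\<le>c. [:y, 1:] ^ j * H j) = (\<Sum>j\<in>{b..c}. [:y, 1:] ^ j * H j)"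
      by (rule sum.mono_neutral_right) (auto simp: low)
    also have "\<dots> = (\<Sum>i\<le>c - b. [:y, 1:] ^ (b + i) * H (b + i))"
      by (rule sum.reindex_bij_witness[of _ "\<lambda>i. b + i" "\<lambda>j. j - b"]) (use \<open>b \<le> c\<close> in auto)
    finally show ?thesis
      by (simp add: G_const sum_distrib_left power_add mult.assoc)
  qed
  \<comment> \<open>The factor y + s is monic of degree 1 in s, so dividing by its power lowers the
    degree in s by exactly \<open>b\<close>.\<close>
  have deg_factor: "degree ([:y, 1:] ^ b * poly G [:y:]) = b + degree (poly G [:y:])"
    if "poly G [:y:] \<noteq> 0" for y
    using that by (simp add: degree_mult_eq degree_power_eq)
  have deg_G: "degree (poly G [:y:]) \<le> e - b" for y
    using deg[of y] deg_factor[of y] unfolding factor by (cases "poly G [:y:] = 0") auto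
  have "degree ([:[:0, 1:], 1:] ^ i * [:H (b + i):]) \<le> c - b" if "i \<le> c - b" for i
    using degree_mult_le[of "[:[:0, 1:], 1:] ^ i" "[:H (b + i):]"]
      degree_power_le[of "[:[:0, 1:], 1:] :: 'a poly poly" i] that by simp
  then have "degree G \<le> c - b"
    unfolding G_def by (intro degree_sum_le) auto
  then show "degree (H b) \<le> e - b + (c - b)"
    using degree_poly_uminus_X_le[OF inf deg_G] G_diag by simp
  show "b \<le> e" if "H b \<noteq> 0"
  proof -
    have "G \<noteq> 0" using that G_diag by auto
    \<comment> \<open>If \<open>G\<close> vanished at all constants y, then setting y = -s pointwise
      would make \<open>H b\<close> vanish everywhere.\<close>
    have "\<exists>y. poly G [:y:] \<noteq> 0"
    proof (rule ccontr)
      assume "\<not> ?thesis"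
      then have *: "degree (poly G [:y:]) \<le> 0" "poly G [:y:] = 0" for y by auto
      have "poly (H b) y = 0" for y
      proof -
        have "poly (poly G [:- y:]) y = poly (poly G (- [:0, 1:])) y"
          by (simp add: poly_altdef[of G] poly_sum poly_power)
        then show ?thesis using * G_diag by simp
      qed
      then have "H b = 0" by (rule poly_eq_0_if_infinite_UNIV[OF inf])
      with that show False by simp
    qed
    then obtain y where "poly G [:y:] \<noteq> 0" by blast
    then show ?thesis using deg_factor[of y] deg[of y] unfolding factor by simp
  qed
qed

text \<open>The first entry \<open>b\<close> of the lexicographically smallest exponent is the
  lowest power of the first variable that occurs. Write \<open>H j\<close> for the coefficient of
  its j-th power along a translate of the other variables: \<open>translated_sum_degree\<close>
  bounds \<open>b\<close> and supplies the degree bound for \<open>H b\<close>. The tail of the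
  exponent is the smallest one of that coefficient, so the induction continues with it.\<close>

lemma lex_min_exponent_dominated:
  fixes C :: "nat list \<Rightarrow> 'a::field"
  assumes inf: "infinite (UNIV :: 'a set)"
    and "list_all2 (\<le>) bs cs" "C bs \<noteq> 0"
    and "\<And>bs'. list_all2 (\<le>) bs' cs \<Longrightarrow> C bs' \<noteq> 0 \<Longrightarrow> lexle bs bs'"
    and "\<And>ys. length ys = length cs \<Longrightarrow>
      \<exists>p. degree p \<le> e \<and> (\<forall>s. eval_box cs C (map (\<lambda>y. y + s) ys) = poly p s)"
  shows "dominated e bs cs"
  using assms(2-)
proof (induction bs cs arbitrary: C e rule: list_all2_induct)
  case Nil
  then show ?case by simp
next
  case (Cons b bs c cs)
  let ?C = "\<lambda>j bs. C (j # bs)"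
  have low: "eval_box cs (?C j) ys = 0" if "length ys = length cs" "j < b" for j ys
  proof -
    have "eval_box cs (?C j) ys = eval_box cs (\<lambda>_. 0) ys"
    proof (rule eval_box_cong[OF that(1)])
      fix bs' assume "list_all2 (\<le>) bs' cs"
      then show "C (j # bs') = 0"
        using Cons.prems(2)[of "j # bs'"] that(2) Cons.hyps by fastforce
    qed
    then show ?thesis by simp
  qed
  have key: "degree (H b) \<le> e - b + (c - b) \<and> (H b \<noteq> 0 \<longrightarrow> b \<le> e)"
    if "length ys = length cs"
      and H: "\<And>j s. eval_box cs (?C j) (map (\<lambda>y. y + s) ys) = poly (H j) s" for ys H
  proof -
    have "H j = 0" if "j < b" for j
    proof (rule poly_eq_0_if_infinite_UNIV[OF inf])
      fix s
      show "poly (H j) s = 0"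
        using low[of "map (\<lambda>y. y + s) ys" j] that \<open>length ys = _\<close> by (simp flip: H)
    qed
    moreover have "degree (\<Sum>j\<le>c. [:y, 1:] ^ j * H j) \<le> e" for y
    proof -
      obtain p where p: "degree p \<le> e" "\<And>s. eval_box (c # cs) C (map (\<lambda>y. y + s) (y # ys)) = poly p s"
        using Cons.prems(3)[of "y # ys"] \<open>length ys = _\<close> by auto
      have "poly ((\<Sum>j\<le>c. [:y, 1:] ^ j * H j) - p) s = 0" for s
        using p(2)[of s] by (simp add: poly_sum poly_power H)
      from poly_eq_0_if_infinite_UNIV[OF inf this] show ?thesis using p(1) by simp
    qed
    ultimately show ?thesis
      using translated_sum_degree[OF inf, of b H c e] Cons.hyps by blast
  qed
  have ex_H: "\<exists>H. \<forall>j s. eval_box cs (?C j) (map (\<lambda>y. y + s) ys) = poly (H j) s" for ys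
    by (intro choice allI eval_box_poly)
  \<comment> \<open>The bound on the degree of \<open>H b\<close> is needed at all points, but
    \<open>b \<le> e\<close> only requires one point at which \<open>H b\<close> is not
    zero.\<close>
  obtain ys where ys: "length ys = length cs" "eval_box cs (?C b) ys \<noteq> 0"
    using eval_box_nonzero[OF inf Cons.hyps(2), of "?C b"] Cons.prems by auto
  obtain H where H: "\<And>j s. eval_box cs (?C j) (map (\<lambda>y. y + s) ys) = poly (H j) s"
    using ex_H by blast
  have "H b \<noteq> 0" using H[of b 0] ys(2) by auto
  with key[OF ys(1) H] have "b \<le> e" by blast
  moreover have "dominated (e - b + (c - b)) bs cs"
  proof (rule Cons.IH)
    show "?C b bs \<noteq> 0" using Cons.prems by simp
    show "lexle bs bs'" if "list_all2 (\<le>) bs' cs" "?C b bs' \<noteq> 0" for bs'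
      using Cons.prems(2)[of "b # bs'"] Cons.hyps that by simp
    show "\<exists>p. degree p \<le> e - b + (c - b) \<and> (\<forall>s. eval_box cs (?C b) (map (\<lambda>y. y + s) ys) = poly p s)"
      if "length ys = length cs" for ys
      using ex_H[of ys] key[OF that] by blast
  qed
  ultimately show ?case by simp
qed

section \<open>Pfaffians in characteristic 2\<close>

lemma sum_offdiag_swap:
  assumes "finite J"
  shows "(\<Sum>i\<in>J. \<Sum>j\<in>J - {i}. f i j) = (\<Sum>j\<in>J. \<Sum>i\<in>J - {j}. f i j)"
proof -
  have "J - {i} = {j. j \<in> J \<and> j \<noteq> i}" "J - {i} = {j. j \<in> J \<and> i \<noteq> j}" for i
    by auto
  then show ?thesis
    using sum.swap_restrict[OF assms assms, of f "\<lambda>i j. i \<noteq> j"] by simp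
qed

text \<open>The contributions of (i, j) and (j, i) cancel in characteristic 2; all cancellations in
  the Pfaffian identity are of this kind.\<close>

lemma sum_offdiag_symmetric:
  fixes f :: "'i \<Rightarrow> 'i \<Rightarrow> 'a::comm_ring_1"
  assumes two: "\<And>x :: 'a. x + x = 0" and "finite J" "\<And>i j. f i j = f j i"
  shows "(\<Sum>i\<in>J. \<Sum>j\<in>J - {i}. f i j) = 0"
  using assms(2)
proof (induction J rule: finite_induct)
  case (insert a J)
  have "(\<Sum>j \<in> insert a J - {i}. f i j) = f i a + (\<Sum>j \<in> J - {i}. f i j)" if "i \<in> J" for i
  proof -
    have "insert a J - {i} = insert a (J - {i})" using that insert by auto
    then show ?thesis using insert by simp
  qed
  moreover have "insert a J - {a} = J" using insert by auto
  ultimately have "(\<Sum>i \<in> insert a J. \<Sum>j \<in> insert a J - {i}. f i j) =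
      (\<Sum>j\<in>J. f a j) + ((\<Sum>i\<in>J. f i a) + (\<Sum>i\<in>J. \<Sum>j \<in> J - {i}. f i j))"
    using insert by (simp add: sum.distrib)
  also have "\<dots> = (\<Sum>j\<in>J. f a j) + (\<Sum>j\<in>J. f a j)"
    using insert assms(3)[of _ a] by simp
  finally show ?case using two by simp
qed simp

fun bil :: "(('i \<Rightarrow> 'a) \<times> ('i \<Rightarrow> 'a)) list \<Rightarrow> 'i \<Rightarrow> 'i \<Rightarrow> 'a::comm_ring_1" where
  "bil [] i j = 0"
| "bil ((x, y) # ps) i j = x i * y j + y i * x j + bil ps i j"

text \<open>In characteristic 2 this is the Pfaffian of the Gram matrix of \<open>bil ps\<close> on \<open>I\<close>.\<close>
fun pf :: "(('i \<Rightarrow> 'a) \<times> ('i \<Rightarrow> 'a)) list \<Rightarrow> 'i set \<Rightarrow> 'a::comm_ring_1" where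
  "pf [] I = (if I = {} then 1 else 0)"
| "pf ((x, y) # ps) I = pf ps I + (\<Sum>i\<in>I. \<Sum>j\<in>I - {i}. x i * y j * pf ps (I - {i, j}))"

lemma pf_empty [simp]: "pf ps {} = 1"
  by (induction ps) auto

text \<open>The recursion of \<open>pf\<close> adds one hyperbolic pair at a time, which displays
  the leading monomial; the row expansion shows instead that only the entries
  \<open>bil ps i j\<close> matter. When a pair is added, the terms quadratic in it contain x_a y_l
  x_i y_j or y_a x_l x_i y_j. The first is symmetric in l and j, the second in l and i, so both sums
  vanish.\<close>

lemma pf_expand_row:
  fixes ps :: "(('i \<Rightarrow> 'a) \<times> ('i \<Rightarrow> 'a::comm_ring_1)) list"
  assumes two: "\<And>x :: 'a. x + x = 0"
  shows "finite I \<Longrightarrow> a \<in> I \<Longrightarrow> pf ps I = (\<Sum>j\<in>I - {a}. bil ps a j * pf ps (I - {a, j}))"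
proof (induction ps arbitrary: I a)
  case Nil
  then show ?case by auto
next
  case (Cons p ps)
  obtain x y where p: "p = (x, y)" by fastforce
  define J where "J = I - {a}"
  have J: "finite J" "a \<notin> J" "I = insert a J"
    using Cons.prems by (auto simp: J_def)
  let ?P = "pf ps" and ?A = "bil ps a"
  \<comment> \<open>Here \<open>a\<close> is matched with \<open>l\<close> with coefficient
    \<open>c l\<close>, while the new pair takes \<open>i\<close> and \<open>j\<close>.\<close>
  let ?T = "\<lambda>c. \<Sum>l\<in>J. \<Sum>i\<in>J - {l}. \<Sum>j\<in>J - {l} - {i}. c l * x i * y j * ?P (J - {l} - {i} - {j})"
  have I_minus: "I - {a} = J" "I - {a, j} = J - {j}" for j
    by (auto simp: J_def)
  have J_minus: "J - {l} - {i, j} = J - {l} - {i} - {j}" for l i j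
    by auto
  have Diff_commute: "A - {i} - {j} = A - {j} - {i}" for A :: "'i set" and i j
    by auto
  have PI: "?P I = (\<Sum>j\<in>J. ?A j * ?P (J - {j}))"
    using Cons.IH[of I a] Cons.prems by (simp add: I_minus)
  \<comment> \<open>Summands in which the new pair avoids \<open>a\<close> are expanded along
    \<open>a\<close> by the induction hypothesis.\<close>
  have P2: "?P (I - {i, j}) = (\<Sum>l\<in>J - {i} - {j}. ?A l * ?P (J - {i} - {j} - {l}))"
    if "i \<in> J" "j \<in> J" for i j
  proof -
    have "?P (I - {i, j}) = (\<Sum>l\<in>I - {i, j} - {a}. ?A l * ?P (I - {i, j} - {a, l}))"
      using that J by (intro Cons.IH) auto
    moreover have "I - {i, j} - {a} = J - {i} - {j}" "I - {i, j} - {a, l} = J - {i} - {j} - {l}" for l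
      by (auto simp: J_def)
    ultimately show ?thesis by simp
  qed
  have comm3: "J - {i} - {j} - {l} = J - {l} - {i} - {j}" "J - {i} - {j} = J - {j} - {i}" for i j l
    by auto
  have row: "(\<Sum>j\<in>I - {i}. x i * y j * ?P (I - {i, j})) =
      x i * y a * ?P (J - {i}) + (\<Sum>j\<in>J - {i}. \<Sum>l\<in>J - {i} - {j}. ?A l * x i * y j * ?P (J - {l} - {i} - {j}))"
    if "i \<in> J" for i
  proof -
    have "I - {i} = insert a (J - {i})" "I - {i, a} = J - {i}" using J that by auto
    then have "(\<Sum>j\<in>I - {i}. x i * y j * ?P (I - {i, j})) =
        x i * y a * ?P (J - {i}) + (\<Sum>j\<in>J - {i}. x i * y j * ?P (I - {i, j}))"
      using J by simp
    also have "(\<Sum>j\<in>J - {i}. x i * y j * ?P (I - {i, j})) =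
        (\<Sum>j\<in>J - {i}. \<Sum>l\<in>J - {i} - {j}. ?A l * x i * y j * ?P (J - {l} - {i} - {j}))"
      using that by (intro sum.cong refl) (simp add: P2 sum_distrib_left comm3(1) mult_ac)
    finally show ?thesis .
  qed
  have "(\<Sum>i\<in>J. \<Sum>j\<in>J - {i}. \<Sum>l\<in>J - {i} - {j}. ?A l * x i * y j * ?P (J - {l} - {i} - {j})) =
      (\<Sum>i\<in>J. \<Sum>l\<in>J - {i}. \<Sum>j\<in>J - {i} - {l}. ?A l * x i * y j * ?P (J - {l} - {i} - {j}))"
    using J(1) by (intro sum.cong refl sum_offdiag_swap) auto
  also have "\<dots> = ?T ?A"
    by (subst sum_offdiag_swap[OF J(1)]) (simp add: comm3(2))
  finally have T: "(\<Sum>i\<in>J. \<Sum>j\<in>J - {i}. \<Sum>l\<in>J - {i} - {j}. ?A l * x i * y j * ?P (J - {l} - {i} - {j})) = ?T ?A" .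
  have row_a: "(\<Sum>j\<in>I - {a}. x a * y j * ?P (I - {a, j})) = (\<Sum>j\<in>J. x a * y j * ?P (J - {j}))"
    by (simp add: I_minus)
  have "(\<Sum>i\<in>I. \<Sum>j\<in>I - {i}. x i * y j * ?P (I - {i, j})) =
      (\<Sum>j\<in>I - {a}. x a * y j * ?P (I - {a, j})) + (\<Sum>i\<in>J. \<Sum>j\<in>I - {i}. x i * y j * ?P (I - {i, j}))"
    using J by simp
  also have "\<dots> = (\<Sum>j\<in>J. x a * y j * ?P (J - {j})) + ((\<Sum>i\<in>J. x i * y a * ?P (J - {i})) + ?T ?A)"
    by (simp add: row_a row sum.distrib T)
  finally have lhs: "pf (p # ps) I = (\<Sum>j\<in>J. bil (p # ps) a j * ?P (J - {j})) + ?T ?A"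
    by (simp add: p PI sum.distrib algebra_simps)
  have Tx: "?T (\<lambda>l. x a * y l) = 0"
  proof -
    have "?T (\<lambda>l. x a * y l) =
        (\<Sum>i\<in>J. \<Sum>l\<in>J - {i}. \<Sum>j\<in>J - {i} - {l}. x a * y l * x i * y j * ?P (J - {i} - {l} - {j}))"
      by (subst sum_offdiag_swap[OF J(1)]) (simp add: comm3(2))
    also have "\<dots> = (\<Sum>i\<in>J. 0)"
      using J(1) by (intro sum.cong refl sum_offdiag_symmetric[OF two])
        (auto simp: mult_ac Diff_commute)
    finally show ?thesis by simp
  qed
  have Ty: "?T (\<lambda>l. y a * x l) = 0"
    using J(1) by (intro sum_offdiag_symmetric[OF two] sum.cong)
      (auto simp: mult_ac Diff_commute)
  have "(\<Sum>j\<in>I - {a}. bil (p # ps) a j * pf (p # ps) (I - {a, j})) =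
      (\<Sum>j\<in>J. bil (p # ps) a j * pf (p # ps) (J - {j}))"
    by (simp add: I_minus)
  also have "\<dots> = (\<Sum>j\<in>J. bil (p # ps) a j * ?P (J - {j})) + ?T (bil (p # ps) a)"
    by (simp add: p distrib_left sum.distrib sum_distrib_left mult.assoc J_minus)
  also have "?T (bil (p # ps) a) = ?T (\<lambda>l. x a * y l) + ?T (\<lambda>l. y a * x l) + ?T ?A"
    by (simp add: p distrib_right sum.distrib)
  finally show ?case by (simp add: lhs Tx Ty)
qed

text \<open>The row expansion reduces to sets with two elements fewer. With \<open>S\<close> the
  expressible polynomials, it makes the Pfaffian a polynomial in the B's, although its recursion
  uses single coordinates.\<close>

lemma (in subalgebra) pf:
  assumes two: "\<And>x :: ('x, 'a) mpol. x + x = 0" and "finite I"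
    and "\<And>i j. i \<in> I \<Longrightarrow> j \<in> I \<Longrightarrow> bil ps i j \<in> S"
  shows "pf ps I \<in> S"
  using assms(2,3)
proof (induction I rule: finite_psubset_induct)
  case (psubset I)
  show ?case
  proof (cases "I = {}")
    case True
    then show ?thesis by (simp add: one)
  next
    case False
    then obtain a where a: "a \<in> I" by blast
    have "(\<Sum>j\<in>I - {a}. bil ps a j * pf ps (I - {a, j})) \<in> S"
      using psubset a by (intro sum mult psubset.IH) auto
    then show ?thesis using pf_expand_row[OF two psubset(1) a] by simp
  qed
qed

section \<open>Leading monomials\<close>

text \<open>The values lie in an arbitrary ordered ring because two kinds are needed: integer
  polynomials encode the monomial order, integers the total degree.\<close>

definition weight :: "('x \<Rightarrow> 'w::linordered_idom) \<Rightarrow> ('x \<Rightarrow>\<^sub>0 nat) \<Rightarrow> 'w" where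
  "weight W \<mu> = (\<Sum>v \<in> Poly_Mapping.keys \<mu>. of_nat (Poly_Mapping.lookup \<mu> v) * W v)"

lemma weight_superset:
  assumes "finite A" "Poly_Mapping.keys \<mu> \<subseteq> A"
  shows "weight W \<mu> = (\<Sum>v \<in> A. of_nat (Poly_Mapping.lookup \<mu> v) * W v)"
  unfolding weight_def
  by (rule sum.mono_neutral_left) (use assms in \<open>auto simp: in_keys_iff\<close>)

lemma weight_0 [simp]: "weight W 0 = 0"
  by (simp add: weight_def)

lemma weight_add: "weight W (\<mu> + \<mu>') = weight W \<mu> + weight W \<mu>'"
proof -
  let ?A = "Poly_Mapping.keys \<mu> \<union> Poly_Mapping.keys \<mu>'"
  have "Poly_Mapping.keys (\<mu> + \<mu>') \<subseteq> ?A"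
    by (rule Poly_Mapping.keys_add)
  then show ?thesis
    by (simp add: weight_superset[of ?A] lookup_add sum.distrib algebra_simps)
qed

lemma weight_single [simp]: "weight W (Poly_Mapping.single v n) = of_nat n * W v"
  by (simp add: weight_def)

text \<open>Both polynomials have the same component of weight \<open>d\<close> and nothing heavier.
  As this is compatible with products, two substitutions can be compared variable by
  variable.\<close>

definition approx :: "('x \<Rightarrow> 'w::linordered_idom) \<Rightarrow> 'w \<Rightarrow> ('x, 'a::comm_ring_1) mpol \<Rightarrow> ('x, 'a) mpol \<Rightarrow> bool" where
  "approx W d p q \<longleftrightarrow> (\<forall>\<mu> \<in> Poly_Mapping.keys q. weight W \<mu> \<le> d) \<and>
     (\<forall>\<mu> \<in> Poly_Mapping.keys (p - q). weight W \<mu> < d)"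

lemma approx_1: "approx W 0 1 1"
  by (simp add: approx_def)

lemma approx_mult:
  assumes "approx W d p q" "approx W d' p' q'"
  shows "approx W (d + d') (p * p') (q * q')"
proof -
  have "weight W \<mu> \<le> d + d'" if "\<mu> \<in> Poly_Mapping.keys (q * q')" for \<mu>
    using that assms by (elim keys_mult_obtain) (auto simp: approx_def weight_add intro: add_mono)
  moreover have "weight W \<mu> < d + d'" if \<mu>: "\<mu> \<in> Poly_Mapping.keys (p * p' - q * q')" for \<mu>
  proof -
    have p': "weight W \<mu> \<le> d'" if "\<mu> \<in> Poly_Mapping.keys p'" for \<mu>
    proof -
      have "p' = (p' - q') + q'" by simp
      then have "\<mu> \<in> Poly_Mapping.keys (p' - q') \<union> Poly_Mapping.keys q'"
        using that Poly_Mapping.keys_add[of "p' - q'" q'] by auto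
      then show ?thesis using assms(2) by (auto simp: approx_def less_imp_le)
    qed
    have "p * p' - q * q' = (p - q) * p' + q * (p' - q')"
      by (simp add: algebra_simps)
    then have "\<mu> \<in> Poly_Mapping.keys ((p - q) * p') \<union> Poly_Mapping.keys (q * (p' - q'))"
      using \<mu> Poly_Mapping.keys_add[of "(p - q) * p'" "q * (p' - q')"] by auto
    then show ?thesis
      unfolding Un_iff
    proof (elim disjE keys_mult_obtain)
      fix \<alpha> \<beta> assume "\<alpha> \<in> Poly_Mapping.keys (p - q)" "\<beta> \<in> Poly_Mapping.keys p'" "\<mu> = \<alpha> + \<beta>"
      then show ?thesis
        using assms(1) p'[of \<beta>] by (auto simp: approx_def weight_add intro: add_less_le_mono)
    next
      fix \<alpha> \<beta> assume "\<alpha> \<in> Poly_Mapping.keys q" "\<beta> \<in> Poly_Mapping.keys (p' - q')" "\<mu> = \<alpha> + \<beta>"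
      then show ?thesis
        using assms by (auto simp: approx_def weight_add intro: add_le_less_mono)
    qed
  qed
  ultimately show ?thesis by (simp add: approx_def)
qed

lemma approx_power: "approx W d p q \<Longrightarrow> approx W (of_nat n * d) (p ^ n) (q ^ n)"
  by (induction n) (auto simp: approx_1 algebra_simps intro: approx_mult)

lemma approx_prod:
  "(\<And>i. i \<in> I \<Longrightarrow> approx W (d i) (p i) (q i)) \<Longrightarrow> approx W (\<Sum>i\<in>I. d i) (\<Prod>i\<in>I. p i) (\<Prod>i\<in>I. q i)"
  by (induction I rule: infinite_finite_induct) (auto intro: approx_mult simp: approx_1)

lemma approx_mon:
  assumes "\<And>v. v \<in> Poly_Mapping.keys \<mu> \<Longrightarrow> approx W (W v) (\<sigma> v) (\<tau> v)"
  shows "approx W (weight W \<mu>) (mon \<sigma> \<mu>) (mon \<tau> \<mu>)"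
  unfolding weight_def mon_def by (intro approx_prod approx_power assms)

section \<open>The lexicographic order on monomials in the coordinates\<close>

locale vec_coords =
  fixes \<nu> m :: nat
begin

definition V :: "(nat \<times> nat) set" where
  "V = {..<2 * \<nu> + 1} \<times> {..<m}"

text \<open>The coordinates are ordered $z, x_1, y_1, x_2, y_2, \dots$.\<close>
definition pos :: "nat \<Rightarrow> nat" where
  "pos a = (if a = 2 * \<nu> then 0 else if a < \<nu> then 2 * a + 1 else 2 * (a - \<nu>) + 2)"

definition higher :: "nat \<times> nat \<Rightarrow> nat \<times> nat \<Rightarrow> bool" where
  "higher u v \<longleftrightarrow> pos (fst u) < pos (fst v) \<or> fst u = fst v \<and> snd u < snd v"

text \<open>The rank is largest for the variable that is compared first: a row is a block of
  \<open>m\<close> ranks, inside which the vectors with smaller numbers come first.\<close>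

definition rk :: "nat \<times> nat \<Rightarrow> nat" where
  "rk v = (2 * \<nu> - pos (fst v)) * m + (m - 1 - snd v)"

lemma finite_V [simp]: "finite V"
  by (simp add: V_def)

lemma coord_ring_V: "coord_ring \<nu> m = polys_in V"
  by (simp add: coord_ring_def V_def)

lemma pos_inj: "a < 2 * \<nu> + 1 \<Longrightarrow> b < 2 * \<nu> + 1 \<Longrightarrow> pos a = pos b \<longleftrightarrow> a = b"
  by (auto simp: pos_def split: if_splits) presburger+

lemma pos_le: "a < 2 * \<nu> + 1 \<Longrightarrow> pos a \<le> 2 * \<nu>"
  by (auto simp: pos_def)

lemma higher_total: "u \<in> V \<Longrightarrow> v \<in> V \<Longrightarrow> u \<noteq> v \<Longrightarrow> higher u v \<or> higher v u"
  using pos_inj[of "fst u" "fst v"] by (cases u; cases v) (auto simp: higher_def V_def)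

lemma rk_higher:
  assumes "u \<in> V" "v \<in> V" "higher u v"
  shows "rk v < rk u"
proof (cases "fst u = fst v")
  case True
  then show ?thesis using assms by (cases u; cases v) (auto simp: rk_def higher_def V_def)
next
  case False
  then have "pos (fst u) < pos (fst v)" "pos (fst v) \<le> 2 * \<nu>"
    using assms pos_le[of "fst v"] by (auto simp: higher_def V_def)
  then have "Suc (2 * \<nu> - pos (fst v)) \<le> 2 * \<nu> - pos (fst u)" by simp
  from mult_le_mono1[OF this, of m]
  have "(2 * \<nu> - pos (fst v)) * m + m \<le> (2 * \<nu> - pos (fst u)) * m" by simp
  moreover have "m - 1 - snd v < m" using assms by (auto simp: V_def)
  ultimately show ?thesis by (simp add: rk_def)
qed

lemma rk_inj: "u \<in> V \<Longrightarrow> v \<in> V \<Longrightarrow> rk u = rk v \<longleftrightarrow> u = v"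
  using higher_total rk_higher by (metis less_irrefl)

lemma rk_less_iff: "u \<in> V \<Longrightarrow> v \<in> V \<Longrightarrow> rk v < rk u \<longleftrightarrow> higher u v"
  using higher_total rk_higher by (metis less_asym' less_irrefl)

text \<open>Comparing the values of these weights, which are integer polynomials ordered by the sign of
  the leading coefficient, is the lexicographic comparison of the exponents of the variables
  in \<open>P\<close>.\<close>
definition W :: "(nat \<times> nat \<Rightarrow> bool) \<Rightarrow> nat \<times> nat \<Rightarrow> int poly" where
  "W P v = (if P v then monom 1 (rk v) else 0)"

abbreviation "key \<equiv> weight (W (\<lambda>_. True))"

lemma coeff_weight_W:
  assumes "Poly_Mapping.keys \<mu> \<subseteq> V"
  shows "coeff (weight (W P) \<mu>) n = (\<Sum>v \<in> {v \<in> V. P v \<and> rk v = n}. int (Poly_Mapping.lookup \<mu> v))"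
proof -
  have "coeff (weight (W P) \<mu>) n = (\<Sum>v\<in>V. if P v \<and> rk v = n then int (Poly_Mapping.lookup \<mu> v) else 0)"
    unfolding weight_superset[OF finite_V assms] coeff_sum
    by (intro sum.cong) (auto simp: W_def of_nat_poly)
  also have "\<dots> = (\<Sum>v \<in> {v \<in> V. P v \<and> rk v = n}. int (Poly_Mapping.lookup \<mu> v))"
    by (rule sum.inter_filter[symmetric]) simp
  finally show ?thesis .
qed

lemma coeff_weight_W_rk:
  assumes "Poly_Mapping.keys \<mu> \<subseteq> V" "v \<in> V" "P v"
  shows "coeff (weight (W P) \<mu>) (rk v) = int (Poly_Mapping.lookup \<mu> v)"
proof -
  have "{u \<in> V. P u \<and> rk u = rk v} = {v}"
    using assms(2,3) rk_inj[of _ v] by blast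
  then show ?thesis by (simp add: coeff_weight_W[OF assms(1)])
qed

text \<open>The ranks are distinct, so the leading coefficient of the difference of two weights
  belongs to the first variable at which the exponents differ.\<close>

lemma weight_W_less_iff:
  assumes "Poly_Mapping.keys \<mu> \<subseteq> V" "Poly_Mapping.keys \<mu>' \<subseteq> V"
  shows "weight (W P) \<mu> < weight (W P) \<mu>' \<longleftrightarrow>
    (\<exists>v\<in>V. P v \<and> Poly_Mapping.lookup \<mu> v < Poly_Mapping.lookup \<mu>' v \<and>
      (\<forall>u\<in>V. P u \<longrightarrow> higher u v \<longrightarrow> Poly_Mapping.lookup \<mu> u = Poly_Mapping.lookup \<mu>' u))"
    (is "?L \<longleftrightarrow> ?R")
proof -
  define d where "d = weight (W P) \<mu>' - weight (W P) \<mu>"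
  have coeff_d: "coeff d (rk v) = int (Poly_Mapping.lookup \<mu>' v) - int (Poly_Mapping.lookup \<mu> v)"
    if "v \<in> V" "P v" for v
    using that assms by (simp add: d_def coeff_weight_W_rk)
  have ex: "\<exists>v\<in>V. P v \<and> n = rk v" if "coeff d n \<noteq> 0" for n
  proof (rule ccontr)
    assume "\<not> ?thesis"
    then have "{v \<in> V. P v \<and> rk v = n} = {}" by auto
    with that show False
      by (auto simp: d_def coeff_weight_W[OF assms(1)] coeff_weight_W[OF assms(2)] simp del: Collect_empty_eq)
  qed
  show ?thesis
  proof
    assume ?L
    then have pos: "0 < coeff d (degree d)"
      by (simp add: less_poly_def pos_poly_def d_def)
    then obtain v where v: "v \<in> V" "P v" "degree d = rk v"
      using ex[of "degree d"] by (metis less_irrefl)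
    have "Poly_Mapping.lookup \<mu> u = Poly_Mapping.lookup \<mu>' u" if "u \<in> V" "P u" "higher u v" for u
      using coeff_d[of u] coeff_eq_0[of d "rk u"] rk_higher[of u v] that v by simp
    then show ?R using v pos coeff_d[of v] by auto
  next
    assume ?R
    then obtain v where v: "v \<in> V" "P v" "Poly_Mapping.lookup \<mu> v < Poly_Mapping.lookup \<mu>' v"
      and u: "\<And>u. u \<in> V \<Longrightarrow> P u \<Longrightarrow> higher u v \<Longrightarrow> Poly_Mapping.lookup \<mu> u = Poly_Mapping.lookup \<mu>' u"
      by blast
    have pos: "0 < coeff d (rk v)" using coeff_d[of v] v by simp
    have "degree d \<le> rk v"
    proof (rule degree_le, intro allI impI, rule ccontr)
      fix n assume "rk v < n" "coeff d n \<noteq> 0"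
      with ex obtain w where "w \<in> V" "P w" "n = rk w" by blast
      then show False
        using \<open>rk v < n\<close> \<open>coeff d n \<noteq> 0\<close> u[of w] coeff_d[of w] rk_less_iff[of w v] v by simp
    qed
    moreover have "rk v \<le> degree d" using pos by (intro le_degree) simp
    ultimately have "degree d = rk v" by simp
    then show ?L using pos by (simp add: less_poly_def pos_poly_def d_def)
  qed
qed

lemma key_less:
  assumes "Poly_Mapping.keys \<mu> \<subseteq> V" "Poly_Mapping.keys \<mu>' \<subseteq> V"
    and "v \<in> V" "Poly_Mapping.lookup \<mu> v < Poly_Mapping.lookup \<mu>' v"
    and "\<And>u. u \<in> V \<Longrightarrow> higher u v \<Longrightarrow> Poly_Mapping.lookup \<mu> u = Poly_Mapping.lookup \<mu>' u"
  shows "key \<mu> < key \<mu>'"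
  using assms by (auto simp: weight_W_less_iff)

text \<open>The variables in \<open>P\<close> form an initial segment of the comparison, so the
  first difference among them is the first difference altogether.\<close>

lemma truncated_key_less:
  assumes "Poly_Mapping.keys \<mu> \<subseteq> V" "Poly_Mapping.keys \<mu>' \<subseteq> V"
    and "\<And>u v. P v \<Longrightarrow> higher u v \<Longrightarrow> P u"
    and "weight (W P) \<mu> < weight (W P) \<mu>'"
  shows "key \<mu> < key \<mu>'"
  using assms(4) unfolding weight_W_less_iff[OF assms(1,2)] using assms(3) by blast

lemma key_inj:
  assumes "Poly_Mapping.keys \<mu> \<subseteq> V" "Poly_Mapping.keys \<mu>' \<subseteq> V" "key \<mu> = key \<mu>'"
  shows "\<mu> = \<mu>'"
proof (rule poly_mapping_eqI)
  fix v
  show "Poly_Mapping.lookup \<mu> v = Poly_Mapping.lookup \<mu>' v"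
  proof (cases "v \<in> V")
    case True
    with assms show ?thesis
      using coeff_weight_W_rk[of \<mu> v "\<lambda>_. True"] coeff_weight_W_rk[of \<mu>' v "\<lambda>_. True"] by simp
  next
    case False
    with assms have "v \<notin> Poly_Mapping.keys \<mu>" "v \<notin> Poly_Mapping.keys \<mu>'" by auto
    then show ?thesis by (simp add: in_keys_iff)
  qed
qed

text \<open>Requiring the coefficient 1 lets leading monomials multiply over any commutative ring
  and lets a scalar multiple cancel any leading term.\<close>

definition lead :: "(nat \<times> nat, 'a::comm_ring_1) mpol \<Rightarrow> (nat \<times> nat \<Rightarrow>\<^sub>0 nat) \<Rightarrow> bool" where
  "lead f M \<longleftrightarrow> f \<in> polys_in V \<and> Poly_Mapping.lookup f M = 1 \<and> (\<forall>\<mu> \<in> Poly_Mapping.keys f. key \<mu> \<le> key M)"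

lemma lead_keys: "lead f M \<Longrightarrow> Poly_Mapping.keys M \<subseteq> V"
  by (auto simp: lead_def polys_in_def in_keys_iff)

lemma lead_1: "lead 1 0"
  by (simp add: lead_def polys_in_def lookup_one)

lemma lookup_mult_keys:
  "Poly_Mapping.lookup (f * g) \<mu> =
    (\<Sum>(\<alpha>, \<beta>) \<in> Poly_Mapping.keys f \<times> Poly_Mapping.keys g.
       if \<alpha> + \<beta> = \<mu> then Poly_Mapping.lookup f \<alpha> * Poly_Mapping.lookup g \<beta> else 0)"
proof -
  let ?m = "\<lambda>f \<mu>. Poly_Mapping.single \<mu> (Poly_Mapping.lookup f \<mu>)"
  have "f * g = (\<Sum>\<mu> \<in> Poly_Mapping.keys f. ?m f \<mu>) * (\<Sum>\<mu> \<in> Poly_Mapping.keys g. ?m g \<mu>)"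
    using pol_expansion[of f] pol_expansion[of g] by simp
  also have "\<dots> = (\<Sum>(\<alpha>, \<beta>) \<in> Poly_Mapping.keys f \<times> Poly_Mapping.keys g.
      Poly_Mapping.single (\<alpha> + \<beta>) (Poly_Mapping.lookup f \<alpha> * Poly_Mapping.lookup g \<beta>))"
    by (simp only: sum_product mult_single sum.cartesian_product)
  finally show ?thesis
    by (simp add: lookup_sum lookup_single case_prod_unfold when_def)
qed

lemma lead_mult:
  assumes "lead f M" "lead g N"
  shows "lead (f * g) (M + N)"
proof -
  have V: "Poly_Mapping.keys \<mu> \<subseteq> V" if "\<mu> \<in> Poly_Mapping.keys f \<union> Poly_Mapping.keys g" for \<mu>
    using that assms by (auto simp: lead_def polys_in_def)
  have "f * g \<in> polys_in V"
    using assms subalgebra.mult[OF subalgebra_polys_in] by (auto simp: lead_def)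
  moreover have "Poly_Mapping.lookup (f * g) (M + N) = 1"
  proof -
    \<comment> \<open>The keys of the two factors are each at most the maximal one, so equality of
      the sums forces equality in both.\<close>
    have only: "\<alpha> = M \<and> \<beta> = N" if "\<alpha> \<in> Poly_Mapping.keys f" "\<beta> \<in> Poly_Mapping.keys g" "\<alpha> + \<beta> = M + N" for \<alpha> \<beta>
    proof -
      have "key \<alpha> \<le> key M" "key \<beta> \<le> key N" using assms that by (auto simp: lead_def)
      moreover have "key \<alpha> + key \<beta> = key M + key N" using that(3) by (simp flip: weight_add)
      ultimately have "key \<alpha> = key M" "key \<beta> = key N" by auto
      then show ?thesis
        using key_inj V that lead_keys[OF assms(1)] lead_keys[OF assms(2)] by auto
    qed
    have MN: "(M, N) \<in> Poly_Mapping.keys f \<times> Poly_Mapping.keys g"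
      using assms by (auto simp: lead_def in_keys_iff)
    have "Poly_Mapping.lookup (f * g) (M + N) = (\<Sum>(\<alpha>, \<beta>) \<in> {(M, N)}.
       if \<alpha> + \<beta> = M + N then Poly_Mapping.lookup f \<alpha> * Poly_Mapping.lookup g \<beta> else 0)"
      unfolding lookup_mult_keys
    proof (rule sum.mono_neutral_right)
      show "\<forall>x \<in> Poly_Mapping.keys f \<times> Poly_Mapping.keys g - {(M, N)}. (case x of (\<alpha>, \<beta>) \<Rightarrow>
          if \<alpha> + \<beta> = M + N then Poly_Mapping.lookup f \<alpha> * Poly_Mapping.lookup g \<beta> else 0) = 0"
      proof
        fix x assume x: "x \<in> Poly_Mapping.keys f \<times> Poly_Mapping.keys g - {(M, N)}"
        have "fst x + snd x \<noteq> M + N"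
          using x only[of "fst x" "snd x"] by (metis DiffE SigmaE fst_conv snd_conv singletonI)
        then show "(case x of (\<alpha>, \<beta>) \<Rightarrow>
          if \<alpha> + \<beta> = M + N then Poly_Mapping.lookup f \<alpha> * Poly_Mapping.lookup g \<beta> else 0) = 0"
          by (simp add: case_prod_unfold)
      qed
    qed (use MN in auto)
    then show ?thesis using assms by (simp add: lead_def)
  qed
  moreover have "key \<mu> \<le> key (M + N)" if "\<mu> \<in> Poly_Mapping.keys (f * g)" for \<mu>
    using that assms by (elim keys_mult_obtain) (auto simp: lead_def weight_add intro: add_mono)
  ultimately show ?thesis by (simp add: lead_def)
qed

end

section \<open>The tableau inequality for a pair of rows\<close>

lemma Var_power: "Var v ^ n = Poly_Mapping.single (Poly_Mapping.single v n) 1"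
  by (induction n) (simp_all add: Var_def mult_single flip: single_add)

lemma prod_single_one:
  "(\<Prod>i\<in>I. Poly_Mapping.single (k i) (1 :: 'a::comm_ring_1)) = Poly_Mapping.single (\<Sum>i\<in>I. k i) 1"
  by (induction I rule: infinite_finite_induct) (simp_all add: mult_single)

lemma mon_Cst_mult_Var:
  "mon (\<lambda>v. Cst (c v) * Var (g v)) \<mu> =
    Cst (\<Prod>v \<in> Poly_Mapping.keys \<mu>. c v ^ Poly_Mapping.lookup \<mu> v) *
    Poly_Mapping.single (\<Sum>v \<in> Poly_Mapping.keys \<mu>. Poly_Mapping.single (g v) (Poly_Mapping.lookup \<mu> v)) 1"
  by (simp add: mon_def power_mult_distrib prod.distrib Var_power prod_single_one Cst_prod Cst_power)

lemma lookup_sum_single: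
  "Poly_Mapping.lookup (\<Sum>v \<in> Poly_Mapping.keys \<mu>. Poly_Mapping.single (g v) (Poly_Mapping.lookup \<mu> v)) w =
    (\<Sum>v \<in> {v \<in> Poly_Mapping.keys \<mu>. g v = w}. Poly_Mapping.lookup \<mu> v)"
  by (simp add: lookup_sum lookup_single when_def flip: sum.inter_filter)

lemma keys_Cst_mult: "Poly_Mapping.keys (Cst c * f) \<subseteq> Poly_Mapping.keys f"
  by (auto simp: in_keys_iff lookup_Cst_mult)

lemma keys_Var: "Poly_Mapping.keys (Var v :: ('x, 'a::zero_neq_one) mpol) = {Poly_Mapping.single v 1}"
  by (simp add: Var_def)

lemma eval_box_add: "eval_box cs (\<lambda>bs. C bs + D bs) ys = eval_box cs C ys + eval_box cs D ys"
  by (induction cs C ys arbitrary: D rule: eval_box.induct) (simp_all add: distrib_left sum.distrib)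

lemma eval_box_sum: "eval_box cs (\<lambda>bs. \<Sum>i\<in>I. C i bs) ys = (\<Sum>i\<in>I. eval_box cs (C i) ys)"
  by (induction I rule: infinite_finite_induct) (simp_all add: eval_box_add)

lemma eval_box_monomial:
  assumes "list_all2 (\<le>) as cs" "length ys = length cs"
  shows "eval_box cs (\<lambda>bs. if as = bs then c else 0) ys = c * (\<Prod>l<length cs. ys ! l ^ as ! l)"
  using assms
proof (induction as cs arbitrary: ys rule: list_all2_induct)
  case Nil
  then show ?case by simp
next
  case (Cons a as d cs)
  then obtain y ys' where ys: "ys = y # ys'" "length ys' = length cs"
    by (cases ys) auto
  have "y ^ j * eval_box cs (\<lambda>bs. if a # as = j # bs then c else 0) ys' =
      (if a = j then y ^ a * eval_box cs (\<lambda>bs. if as = bs then c else 0) ys' else 0)" for j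
    by (cases "a = j") simp_all
  then have "eval_box (d # cs) (\<lambda>bs. if a # as = bs then c else 0) ys =
      y ^ a * eval_box cs (\<lambda>bs. if as = bs then c else 0) ys'"
    using Cons.hyps by (simp add: ys(1))
  then show ?case
    using Cons.IH[OF ys(2)] by (simp add: ys prod.lessThan_Suc_shift mult_ac del: prod.lessThan_Suc)
qed

lemma not_lexleE:
  assumes "length as = length bs" "\<not> lexle as bs"
  shows "\<exists>p<length bs. bs ! p < as ! p \<and> (\<forall>q<p. as ! q = bs ! q)"
  using assms
proof (induction as bs rule: list_induct2)
  case (Cons a as b bs)
  show ?case
  proof (cases "b < a")
    case True
    then show ?thesis by (intro exI[of _ 0]) simp
  next
    case False
    then have "a = b" using Cons.prems by auto
    then obtain p where "p < length bs" "bs ! p < as ! p" "\<forall>q<p. as ! q = bs ! q"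
      using Cons by auto
    then show ?thesis using \<open>a = b\<close>
      by (intro exI[of _ "Suc p"]) (auto simp: less_Suc_eq_0_disj)
  qed
qed simp

text \<open>Since the box has size a + b, the bound changes by a - b at each entry; unrolling the
  recursion turns \<open>dominated\<close> into inequalities between partial sums.\<close>

lemma dominated_sums:
  assumes "dominated e (map b xs) (map (\<lambda>x. a x + b x) xs)" "i < length xs"
  shows "(\<Sum>l\<le>i. b (xs ! l)) \<le> e + (\<Sum>l<i. a (xs ! l))"
  using assms
proof (induction xs arbitrary: e i)
  case (Cons x xs)
  show ?case
  proof (cases i)
    case 0
    then show ?thesis using Cons.prems by simp
  next
    case (Suc j)
    have "(\<Sum>l\<le>j. b (xs ! l)) \<le> e - b x + (a x + b x - b x) + (\<Sum>l<j. a (xs ! l))"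
      using Cons.prems Suc by (intro Cons.IH) auto
    then show ?thesis using Cons.prems unfolding Suc
      by (auto simp add: sum.atMost_Suc_shift sum.lessThan_Suc_shift simp del: sum.atMost_Suc sum.lessThan_Suc)
  qed
qed simp

context vec_coords begin

text \<open>Setting the variables of row \<open>\<rho>'\<close> to multiples \<open>ys\<close> of those of row \<open>\<rho>\<close> turns the invariance
  into invariance under translation of \<open>ys\<close>. The change of row \<open>\<theta>\<close> is harmless: a monomial that
  loses variables of row \<open>\<theta>\<close> and still contributes to the coefficient under consideration would be larger
  than the leading monomial.\<close>
lemma row_dominated:
  fixes f :: "(nat \<times> nat, 'k::field) mpol"
  assumes inf: "infinite (UNIV :: 'k set)" and f: "f \<in> polys_in V"
    and M: "M \<in> Poly_Mapping.keys f" and max: "\<And>N. N \<in> Poly_Mapping.keys f \<Longrightarrow> key N \<le> key M"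
    and rows: "\<rho> < 2 * \<nu> + 1" "\<rho>' < 2 * \<nu> + 1" "\<theta> < 2 * \<nu> + 1" "\<eta> < 2 * \<nu> + 1"
    and pos: "pos \<theta> < pos \<rho>" "pos \<rho> < pos \<rho>'" "pos \<theta> < pos \<eta>" "\<eta> \<noteq> \<rho>'"
    and inv: "\<And>s. \<exists>r. subst_pol (\<lambda>(a, l). Var (a, l) +
      (if a = \<rho>' then Cst s * Var (\<rho>, l) else if a = \<theta> then Cst r * Var (\<eta>, l) else 0)) f = f"
    and i: "i < m"
  shows "(\<Sum>l\<le>i. Poly_Mapping.lookup M (\<rho>', l)) \<le> (\<Sum>l<i. Poly_Mapping.lookup M (\<rho>, l))"
proof -
  \<comment> \<open>Row \<rho>' is merged into row \<rho> with scalars \<open>ys\<close>: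
    \<open>\<psi>\<close> is the substitution and \<open>mv\<close> its effect on monomials.\<close>
  define g where "g = (\<lambda>v :: nat \<times> nat. if fst v = \<rho>' then (\<rho>, snd v) else v)"
  define \<psi> :: "'k list \<Rightarrow> nat \<times> nat \<Rightarrow> (nat \<times> nat, 'k) mpol" where
    "\<psi> = (\<lambda>ys v. Cst (if fst v = \<rho>' then ys ! snd v else 1) * Var (g v))"
  define mv where "mv = (\<lambda>\<mu> :: nat \<times> nat \<Rightarrow>\<^sub>0 nat. \<Sum>v \<in> Poly_Mapping.keys \<mu>.
    Poly_Mapping.single (g v) (Poly_Mapping.lookup \<mu> v))"
  define bs where "bs = (\<lambda>\<mu> :: nat \<times> nat \<Rightarrow>\<^sub>0 nat. map (\<lambda>l. Poly_Mapping.lookup \<mu> (\<rho>', l)) [0..<m])"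
  define cs where "cs = map (\<lambda>l. Poly_Mapping.lookup M (\<rho>, l) + Poly_Mapping.lookup M (\<rho>', l)) [0..<m]"
  \<comment> \<open>Only monomials in \<open>T\<close> contribute to the coefficient of
    \<open>mv M\<close>, and \<open>C\<close> makes this coefficient a polynomial in
    \<open>ys\<close>, indexed by the exponents in row \<rho>'. Merging preserves the sums of the
    exponents in the two rows, so \<open>cs\<close> bounds all these exponents.\<close>
  define T where "T = {N \<in> Poly_Mapping.keys f. mv N = mv M}"
  define C where "C = (\<lambda>as. \<Sum>N\<in>T. if bs N = as then Poly_Mapping.lookup f N else 0)"
  have keys_V: "Poly_Mapping.keys N \<subseteq> V" if "N \<in> Poly_Mapping.keys f" for N
    using f that by (auto simp: polys_in_def)
  have "\<rho> \<noteq> \<rho>'" "\<theta> \<noteq> \<rho>'" "\<theta> \<noteq> \<rho>" "\<theta> \<noteq> \<eta>" using pos by auto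
  have lookup_mv: "Poly_Mapping.lookup (mv \<mu>) (a, l) =
      (if a = \<rho> then Poly_Mapping.lookup \<mu> (\<rho>, l) + Poly_Mapping.lookup \<mu> (\<rho>', l)
       else if a = \<rho>' then 0 else Poly_Mapping.lookup \<mu> (a, l))" for \<mu> a l
  proof -
    have "(\<Sum>v \<in> {v \<in> Poly_Mapping.keys \<mu>. g v = (a, l)}. Poly_Mapping.lookup \<mu> v) =
        (\<Sum>v \<in> {v. g v = (a, l)}. Poly_Mapping.lookup \<mu> v)"
    proof (rule sum.mono_neutral_left)
      have "{v. g v = (a, l)} \<subseteq> {(\<rho>', l), (a, l)}"
        by (auto simp: g_def split: if_splits)
      then show "finite {v. g v = (a, l)}" by (rule finite_subset) simp
    qed (auto simp: in_keys_iff)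
    moreover have "{v. g v = (a, l)} = (if a = \<rho> then {(\<rho>, l), (\<rho>', l)} else if a = \<rho>' then {} else {(a, l)})"
      using \<open>\<rho> \<noteq> \<rho>'\<close> by (auto simp: g_def split: if_splits)
    ultimately show ?thesis
      using \<open>\<rho> \<noteq> \<rho>'\<close> by (simp add: mv_def lookup_sum_single)
  qed
  have mon_\<psi>: "mon (\<psi> ys) \<mu> = Cst (\<Prod>l<m. ys ! l ^ Poly_Mapping.lookup \<mu> (\<rho>', l)) * Poly_Mapping.single (mv \<mu>) 1"
    if "Poly_Mapping.keys \<mu> \<subseteq> V" for ys \<mu>
  proof -
    let ?c = "\<lambda>v. if fst v = \<rho>' then ys ! snd v else (1 :: 'k)"
    have "(\<Prod>v \<in> Poly_Mapping.keys \<mu>. ?c v ^ Poly_Mapping.lookup \<mu> v) = (\<Prod>v\<in>V. ?c v ^ Poly_Mapping.lookup \<mu> v)"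
      by (rule prod.mono_neutral_left) (use that in \<open>auto simp: in_keys_iff\<close>)
    also have "\<dots> = (\<Prod>v \<in> {\<rho>'} \<times> {..<m}. ?c v ^ Poly_Mapping.lookup \<mu> v)"
      by (rule prod.mono_neutral_right) (use rows in \<open>auto simp: V_def\<close>)
    also have "\<dots> = (\<Prod>l<m. ys ! l ^ Poly_Mapping.lookup \<mu> (\<rho>', l))"
      by (rule prod.reindex_bij_witness[of _ "Pair \<rho>'" snd]) auto
    finally show ?thesis by (simp add: \<psi>_def mon_Cst_mult_Var mv_def)
  qed
  have box: "list_all2 (\<le>) (bs N) cs" if "N \<in> T" for N
  proof -
    have "Poly_Mapping.lookup N (\<rho>', l) \<le> Poly_Mapping.lookup M (\<rho>, l) + Poly_Mapping.lookup M (\<rho>', l)" for l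
      using that lookup_mv[of N \<rho> l] lookup_mv[of M \<rho> l] by (simp add: T_def)
    then show ?thesis by (simp add: bs_def cs_def list_all2_conv_all_nth)
  qed
  have eval: "Poly_Mapping.lookup (subst_pol (\<psi> ys) f) (mv M) = eval_box cs C ys" if "length ys = m" for ys
  proof -
    have "Poly_Mapping.lookup (subst_pol (\<psi> ys) f) (mv M) =
        (\<Sum>N \<in> Poly_Mapping.keys f. if mv N = mv M then
          Poly_Mapping.lookup f N * (\<Prod>l<m. ys ! l ^ Poly_Mapping.lookup N (\<rho>', l)) else 0)"
      unfolding subst_pol_mon lookup_sum
      by (intro sum.cong refl) (simp add: mon_\<psi> keys_V lookup_Cst_mult lookup_single when_def)
    also have "\<dots> = (\<Sum>N\<in>T. Poly_Mapping.lookup f N * (\<Prod>l<m. ys ! l ^ Poly_Mapping.lookup N (\<rho>', l)))"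
      unfolding T_def by (rule sum.inter_filter[symmetric]) simp
    also have "\<dots> = (\<Sum>N\<in>T. eval_box cs (\<lambda>as. if bs N = as then Poly_Mapping.lookup f N else 0) ys)"
    proof (rule sum.cong[OF refl])
      fix N assume "N \<in> T"
      have "length cs = m" by (simp add: cs_def)
      moreover have "(\<Prod>l<m. ys ! l ^ bs N ! l) = (\<Prod>l<m. ys ! l ^ Poly_Mapping.lookup N (\<rho>', l))"
        by (rule prod.cong) (simp_all add: bs_def)
      ultimately show "Poly_Mapping.lookup f N * (\<Prod>l<m. ys ! l ^ Poly_Mapping.lookup N (\<rho>', l)) =
          eval_box cs (\<lambda>as. if bs N = as then Poly_Mapping.lookup f N else 0) ys"
        using eval_box_monomial[OF box[OF \<open>N \<in> T\<close>], of ys] that by simp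
    qed
    finally show ?thesis by (simp add: C_def eval_box_sum)
  qed
  have translate: "Poly_Mapping.lookup (subst_pol (\<psi> ys) f) (mv M) =
      Poly_Mapping.lookup (subst_pol (\<psi> (map (\<lambda>y. y + s) ys)) f) (mv M)" if "length ys = m" for ys s
  proof -
    obtain r where r: "subst_pol (\<lambda>(a, l). Var (a, l) +
      (if a = \<rho>' then Cst s * Var (\<rho>, l) else if a = \<theta> then Cst r * Var (\<eta>, l) else 0)) f = f"
      using inv by blast
    define \<tau> where "\<tau> = (\<lambda>v. subst_pol (\<psi> ys) (case v of (a, l) \<Rightarrow> Var (a, l) +
      (if a = \<rho>' then Cst s * Var (\<rho>, l) else if a = \<theta> then Cst r * Var (\<eta>, l) else 0)))"
    have \<tau>: "subst_pol (\<psi> ys) f = subst_pol \<tau> f"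
      by (subst r[symmetric]) (simp only: subst_pol_comp \<tau>_def)
    let ?\<psi>' = "\<psi> (map (\<lambda>y. y + s) ys)"
    \<comment> \<open>The weight is cut off below row \<theta>. The merging of \<rho>' into \<rho>
      happens below the cut, whereas replacing a variable of row \<theta> by one of row \<eta>
      lowers the weight.\<close>
    define P where "P = (\<lambda>v :: nat \<times> nat. pos (fst v) \<le> pos \<theta>)"
    have approx_v: "approx (W P) (W P v) (\<tau> v) (?\<psi>' v)" if "v \<in> V" for v
    proof -
      obtain a l where v: "v = (a, l)" by fastforce
      have l: "l < length ys" using that \<open>length ys = m\<close> by (auto simp: V_def v)
      consider "a = \<rho>'" | "a = \<theta>" | "a \<noteq> \<rho>'" "a \<noteq> \<theta>" by blast
      then show ?thesis
      proof cases
        case 1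
        then have "\<tau> v = ?\<psi>' v"
          using l \<open>\<rho> \<noteq> \<rho>'\<close> by (simp add: \<tau>_def \<psi>_def v g_def subst_pol_add subst_pol_mult Cst_add distrib_right)
        moreover have "weight (W P) \<mu> \<le> W P v" if "\<mu> \<in> Poly_Mapping.keys (?\<psi>' v)" for \<mu>
        proof -
          have "\<mu> = Poly_Mapping.single (\<rho>, l) 1"
            using that 1 keys_Cst_mult[of _ "Var (\<rho>, l)"] by (auto simp: \<psi>_def v g_def keys_Var)
          then show ?thesis using 1 pos by (simp add: W_def P_def v)
        qed
        ultimately show ?thesis by (simp add: approx_def)
      next
        case 2
        have "\<tau> v - ?\<psi>' v = Cst r * Var (\<eta>, l)"
          using 2 \<open>\<theta> \<noteq> \<rho>'\<close> pos by (simp add: \<tau>_def \<psi>_def v g_def subst_pol_add subst_pol_mult)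
        moreover have "weight (W P) \<mu> < W P v" if "\<mu> \<in> Poly_Mapping.keys (Cst r * Var (\<eta>, l))" for \<mu>
        proof -
          have "\<mu> = Poly_Mapping.single (\<eta>, l) 1"
            using that keys_Cst_mult[of _ "Var (\<eta>, l)"] by (auto simp: keys_Var)
          then show ?thesis using 2 pos
            by (simp add: W_def P_def v less_poly_def pos_poly_def degree_monom_eq)
        qed
        moreover have "?\<psi>' v = Var v"
          using 2 \<open>\<theta> \<noteq> \<rho>'\<close> by (simp add: \<psi>_def g_def v)
        ultimately show ?thesis by (simp add: approx_def keys_Var)
      next
        case 3
        then have "\<tau> v = Var v" "?\<psi>' v = Var v"
          by (simp_all add: \<tau>_def \<psi>_def g_def v)
        then show ?thesis by (simp add: approx_def keys_Var)
      qed
    qed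
    have "Poly_Mapping.lookup (mon \<tau> N) (mv M) = Poly_Mapping.lookup (mon ?\<psi>' N) (mv M)"
      if N: "N \<in> Poly_Mapping.keys f" for N
    proof (rule ccontr)
      assume "\<not> ?thesis"
      then have "mv M \<in> Poly_Mapping.keys (mon \<tau> N - mon ?\<psi>' N)"
        by (simp add: in_keys_iff lookup_minus)
      moreover have "approx (W P) (weight (W P) N) (mon \<tau> N) (mon ?\<psi>' N)"
        using approx_v keys_V[OF N] by (intro approx_mon) auto
      ultimately have less: "weight (W P) (mv M) < weight (W P) N"
        by (auto simp: approx_def)
      have "Poly_Mapping.keys (mv M) \<subseteq> V"
      proof
        fix v assume v: "v \<in> Poly_Mapping.keys (mv M)"
        obtain a l where al: "v = (a, l)" by fastforce
        have "(if a = \<rho> then (\<rho>, l) \<in> Poly_Mapping.keys M \<or> (\<rho>', l) \<in> Poly_Mapping.keys M else v \<in> Poly_Mapping.keys M)"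
          using v unfolding al by (auto simp: in_keys_iff lookup_mv split: if_splits)
        then show "v \<in> V" using keys_V[OF M] rows by (auto simp: V_def al split: if_splits)
      qed
      \<comment> \<open>Merging leaves the truncated weight unchanged, so a contribution of the
        extra terms would come from a monomial \<open>N\<close> larger than
        \<open>M\<close>.\<close>
      then have "weight (W P) (mv M) = weight (W P) M"
        unfolding weight_superset[OF finite_V keys_V[OF M]] weight_superset[OF finite_V \<open>_ \<subseteq> V\<close>]
        using pos by (intro sum.cong refl) (auto simp: W_def P_def lookup_mv)
      with less have "key M < key N"
        by (intro truncated_key_less[of M N P] keys_V M N) (auto simp: P_def higher_def)
      with max[OF N] show False by simp
    qed
    then have "Poly_Mapping.lookup (subst_pol \<tau> f) (mv M) = Poly_Mapping.lookup (subst_pol ?\<psi>' f) (mv M)"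
      by (simp add: subst_pol_mon lookup_sum lookup_Cst_mult)
    with \<tau> show ?thesis by simp
  qed
  have N_eq_M: "N = M" if "N \<in> T" "bs N = bs M" for N
  proof (rule poly_mapping_eqI)
    fix v :: "nat \<times> nat"
    obtain a l where v: "v = (a, l)" by fastforce
    have mv: "Poly_Mapping.lookup (mv N) w = Poly_Mapping.lookup (mv M) w" for w
      using that by (simp add: T_def)
    show "Poly_Mapping.lookup N v = Poly_Mapping.lookup M v"
    proof (cases "v \<in> V")
      case True
      then have "Poly_Mapping.lookup N (\<rho>', l) = Poly_Mapping.lookup M (\<rho>', l)"
        using that(2) by (auto simp: bs_def V_def v)
      then show ?thesis
        using mv[of "(a, l)"] unfolding lookup_mv v by (auto split: if_splits)
    next
      case False
      then have "v \<notin> Poly_Mapping.keys N" "v \<notin> Poly_Mapping.keys M"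
        using keys_V M that by (auto simp: T_def)
      then show ?thesis by (simp add: in_keys_iff)
    qed
  qed
  have "finite T" by (simp add: T_def)
  have "M \<in> T" using M by (simp add: T_def)
  \<comment> \<open>By \<open>N_eq_M\<close> a member of \<open>T\<close> is determined by its
    exponents in row \<rho>', so nothing can cancel the coefficient of \<open>M\<close>.\<close>
  have "C (bs M) = (\<Sum>N\<in>T. if N = M then Poly_Mapping.lookup f N else 0)"
    unfolding C_def by (intro sum.cong refl) (use N_eq_M in auto)
  then have "C (bs M) \<noteq> 0"
    using \<open>finite T\<close> \<open>M \<in> T\<close> M by (simp add: in_keys_iff)
  moreover have "lexle (bs M) as" if "C as \<noteq> 0" for as
  proof (rule ccontr)
    assume not_lexle: "\<not> lexle (bs M) as"
    have "\<exists>N\<in>T. bs N = as"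
    proof (rule ccontr)
      assume "\<not> ?thesis"
      then have "C as = 0"
        unfolding C_def by (intro sum.neutral) auto
      with \<open>C as \<noteq> 0\<close> show False by simp
    qed
    then obtain N where N: "N \<in> T" "bs N = as" by blast
    obtain p where p: "p < m" "bs N ! p < bs M ! p" "\<forall>q<p. bs M ! q = bs N ! q"
      using not_lexleE[OF _ not_lexle] N by (auto simp: bs_def)
    have mv: "Poly_Mapping.lookup (mv N) w = Poly_Mapping.lookup (mv M) w" for w
      using N by (simp add: T_def)
    \<comment> \<open>The sums of the exponents in rows \<rho> and \<rho>' agree for
      \<open>M\<close> and \<open>N\<close>; a smaller exponent in the lower row means a larger one
      in the upper row, which is compared earlier.\<close>
    have "key M < key N"
    proof (rule key_less[of M N "(\<rho>, p)"])
      show "Poly_Mapping.keys M \<subseteq> V" "Poly_Mapping.keys N \<subseteq> V"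
        using keys_V M N by (auto simp: T_def)
      show "(\<rho>, p) \<in> V" using rows p by (simp add: V_def)
      show "Poly_Mapping.lookup M (\<rho>, p) < Poly_Mapping.lookup N (\<rho>, p)"
        using mv[of "(\<rho>, p)"] p by (simp add: lookup_mv bs_def)
      fix u assume "u \<in> V" and higher: "higher u (\<rho>, p)"
      obtain a l where u: "u = (a, l)" by fastforce
      show "Poly_Mapping.lookup M u = Poly_Mapping.lookup N u"
      proof (cases "a = \<rho>")
        case True
        then have "l < p" using higher by (simp add: higher_def u)
        then have "Poly_Mapping.lookup N (\<rho>', l) = Poly_Mapping.lookup M (\<rho>', l)"
          using p by (simp add: bs_def)
        then show ?thesis using mv[of "(\<rho>, l)"] True by (simp add: lookup_mv u)
      next
        case False
        then have "a \<noteq> \<rho>'" using higher pos by (auto simp: higher_def u)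
        then show ?thesis using mv[of "(a, l)"] False by (simp add: lookup_mv u)
      qed
    qed
    then show False using max[of N] N by (simp add: T_def)
  qed
  \<comment> \<open>Translation invariance makes the value constant in \<open>s\<close>, so the
    degree bound starts at 0.\<close>
  moreover have "\<exists>p. degree p \<le> 0 \<and> (\<forall>s. eval_box cs C (map (\<lambda>y. y + s) ys) = poly p s)"
    if "length ys = length cs" for ys
    using eval[of ys] eval[of "map (\<lambda>y. y + s) ys" for s] translate[of ys] that
    by (intro exI[of _ "[:eval_box cs C ys:]"]) (simp add: cs_def)
  ultimately have "dominated 0 (bs M) cs"
    using box[OF \<open>M \<in> T\<close>] by (intro lex_min_exponent_dominated[OF inf]) auto
  then have "(\<Sum>l\<le>i. Poly_Mapping.lookup M (\<rho>', [0..<m] ! l)) \<le> 0 + (\<Sum>l<i. Poly_Mapping.lookup M (\<rho>, [0..<m] ! l))"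
    unfolding bs_def cs_def using i by (intro dominated_sums) auto
  moreover have "(\<Sum>l\<le>i. Poly_Mapping.lookup M (\<rho>', [0..<m] ! l)) = (\<Sum>l\<le>i. Poly_Mapping.lookup M (\<rho>', l))"
    "(\<Sum>l<i. Poly_Mapping.lookup M (\<rho>, [0..<m] ! l)) = (\<Sum>l<i. Poly_Mapping.lookup M (\<rho>, l))"
    using i by (auto intro!: sum.cong)
  ultimately show ?thesis by simp
qed

end

section \<open>The isometries and the generating invariants\<close>

lemma char_two_double:
  assumes "CHAR('a::comm_ring_1) = 2"
  shows "x + x = (0 :: 'a)"
proof -
  have "of_nat CHAR('a) = (0 :: 'a)" by (rule of_nat_CHAR)
  with assms have "(2 :: 'a) = 0" by simp
  then show ?thesis by (metis mult_2 mult_zero_left)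
qed

lemma mpol_double:
  assumes "\<And>c :: 'a::comm_ring_1. c + c = 0"
  shows "p + p = (0 :: ('x, 'a) mpol)"
  by (rule poly_mapping_eqI) (simp only: lookup_add assms lookup_zero)

context vec_coords begin

text \<open>Two additions of rows are made at once because, in the cases used below, the second one
  compensates the change of the form caused by the first.\<close>

definition pair_transvection :: "nat \<Rightarrow> nat \<Rightarrow> 'a \<Rightarrow> nat \<Rightarrow> nat \<Rightarrow> 'a \<Rightarrow> 'a::comm_ring_1 mat" where
  "pair_transvection p q s p' q' r = mat (2 * \<nu> + 1) (2 * \<nu> + 1) (\<lambda>(a, b). (if b = a then 1 else 0) +
     (if b = q then if a = p then s else 0 else 0) + (if b = q' then if a = p' then r else 0 else 0))"

definition torus_mat :: "nat \<Rightarrow> 'a \<Rightarrow> 'a \<Rightarrow> 'a::comm_ring_1 mat" where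
  "torus_mat t c d = mat (2 * \<nu> + 1) (2 * \<nu> + 1) (\<lambda>(a, b). if b = a then if a = t then c
     else if a = \<nu> + t then d else 1 else 0)"

lemma pair_transvection_vec:
  assumes "v \<in> carrier_vec (2 * \<nu> + 1)" "a < 2 * \<nu> + 1" "q < 2 * \<nu> + 1" "q' < 2 * \<nu> + 1"
  shows "(pair_transvection p q s p' q' r *\<^sub>v v) $ a =
    v $ a + (if a = p then s * v $ q else 0) + (if a = p' then r * v $ q' else 0)"
proof -
  have "(pair_transvection p q s p' q' r *\<^sub>v v) $ a = (\<Sum>b = 0..<2 * \<nu> + 1. ((if b = a then 1 else 0) +
     (if b = q then if a = p then s else 0 else 0) + (if b = q' then if a = p' then r else 0 else 0)) * v $ b)"
    using assms by (simp add: pair_transvection_def scalar_prod_def)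
  also have "\<dots> = (\<Sum>b = 0..<2 * \<nu> + 1. (if b = a then v $ b else 0) +
     (if b = q then (if a = p then s else 0) * v $ b else 0) + (if b = q' then (if a = p' then r else 0) * v $ b else 0))"
    by (intro sum.cong refl) (simp add: distrib_right)
  also have "\<dots> = v $ a + (if a = p then s * v $ q else 0) + (if a = p' then r * v $ q' else 0)"
    using assms by (simp add: sum.distrib)
  finally show ?thesis .
qed

lemma torus_mat_vec:
  assumes "v \<in> carrier_vec (2 * \<nu> + 1)" "a < 2 * \<nu> + 1"
  shows "(torus_mat t c d *\<^sub>v v) $ a = (if a = t then c else if a = \<nu> + t then d else 1) * v $ a"
proof -
  have "(torus_mat t c d *\<^sub>v v) $ a = (\<Sum>b = 0..<2 * \<nu> + 1. (if b = a then if a = t then c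
     else if a = \<nu> + t then d else 1 else 0) * v $ b)"
    using assms by (simp add: torus_mat_def scalar_prod_def)
  also have "\<dots> = (\<Sum>b = 0..<2 * \<nu> + 1. if b = a then (if a = t then c
     else if a = \<nu> + t then d else 1) * v $ b else 0)"
    by (intro sum.cong refl) simp
  also have "\<dots> = (if a = t then c else if a = \<nu> + t then d else 1) * v $ a"
    by (subst sum.delta) (use assms in simp_all)
  finally show ?thesis .
qed

lemma pair_transvection_carrier [simp]:
    "pair_transvection p q s p' q' r \<in> carrier_mat (Suc (2 * \<nu>)) (Suc (2 * \<nu>))"
  and torus_mat_carrier [simp]: "torus_mat t c d \<in> carrier_mat (Suc (2 * \<nu>)) (Suc (2 * \<nu>))"
  by (simp_all add: pair_transvection_def torus_mat_def)

lemma map_pair_transvection: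
  "map_mat Cst (pair_transvection p q s p' q' r) = pair_transvection p q (Cst s) p' q' (Cst r)"
  by (rule eq_matI) (auto simp: pair_transvection_def Cst_add)

lemma map_torus_mat: "map_mat Cst (torus_mat t c d) = torus_mat t (Cst c) (Cst d)"
  by (rule eq_matI) (auto simp: torus_mat_def)

lemma mat_mult_index:
  assumes "A \<in> carrier_mat n n" "B \<in> carrier_mat n n" "i < n" "j < n"
  shows "(A * B) $$ (i, j) = (A *\<^sub>v col B j) $ i"
  using assms by simp

text \<open>The rows that are added are not themselves changed, so applying the map twice adds
  everything twice: in characteristic 2 it is an involution.\<close>

lemma invertible_pair_transvection:
  fixes s r :: "'a::comm_ring_1"
  assumes two: "\<And>x :: 'a. x + x = 0"
    and "p < 2 * \<nu> + 1" "q < 2 * \<nu> + 1" "p' < 2 * \<nu> + 1" "q' < 2 * \<nu> + 1"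
    and "q \<noteq> p" "q \<noteq> p'" "q' \<noteq> p" "q' \<noteq> p'"
  shows "invertible_mat (pair_transvection p q s p' q' r)"
proof -
  let ?A = "pair_transvection p q s p' q' r"
  have "?A * ?A = 1\<^sub>m (2 * \<nu> + 1)"
  proof (rule eq_matI)
    fix i j assume ij: "i < dim_row (1\<^sub>m (2 * \<nu> + 1) :: 'a mat)" "j < dim_col (1\<^sub>m (2 * \<nu> + 1) :: 'a mat)"
    let ?e = "if j = q then if i = p then s else 0 else 0"
    let ?e' = "if j = q' then if i = p' then r else 0 else 0"
    have "col ?A j \<in> carrier_vec (2 * \<nu> + 1)"
      using ij by (simp add: carrier_vecI pair_transvection_def)
    moreover have col: "col ?A j $ a = (if j = a then 1 else 0) + (if j = q then if a = p then s else 0 else 0)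
        + (if j = q' then if a = p' then r else 0 else 0)" if "a < 2 * \<nu> + 1" for a
      using that ij by (simp add: pair_transvection_def)
    ultimately have "(?A * ?A) $$ (i, j) = col ?A j $ i + (if i = p then s * col ?A j $ q else 0)
        + (if i = p' then r * col ?A j $ q' else 0)"
      using ij assms(2-) pair_transvection_vec[of "col ?A j" i q q' p s p' r]
      by (subst mat_mult_index[of _ "2 * \<nu> + 1"]) simp_all
    also have "\<dots> = (if j = i then 1 else 0) + (?e + ?e) + (?e' + ?e')"
    proof -
      have "i < 2 * \<nu> + 1" using ij by simp
      moreover have "col ?A j $ q = (if j = q then 1 else 0)" "col ?A j $ q' = (if j = q' then 1 else 0)"
        using assms(2-) by (simp_all add: col)
      ultimately show ?thesis
        by (auto simp: col algebra_simps)
    qed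
    also have "\<dots> = (1\<^sub>m (2 * \<nu> + 1)) $$ (i, j)"
      unfolding two using ij by auto
    finally show "(?A * ?A) $$ (i, j) = (1\<^sub>m (2 * \<nu> + 1)) $$ (i, j)" .
  qed (simp_all add: pair_transvection_def)
  then show ?thesis
    unfolding invertible_mat_def inverts_mat_def
    by (auto simp: pair_transvection_def square_mat.simps)
qed

lemma torus_mat_mult:
  assumes "c * d = 1" "t < \<nu>"
  shows "torus_mat t c d * torus_mat t d c = 1\<^sub>m (2 * \<nu> + 1)"
proof (rule eq_matI)
  fix i j assume ij: "i < dim_row (1\<^sub>m (2 * \<nu> + 1) :: 'a mat)" "j < dim_col (1\<^sub>m (2 * \<nu> + 1) :: 'a mat)"
  have "col (torus_mat t d c) j \<in> carrier_vec (2 * \<nu> + 1)"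
    using ij by (simp add: carrier_vecI torus_mat_def)
  moreover have col: "col (torus_mat t d c) j $ a = (if j = a then if a = t then d
     else if a = \<nu> + t then c else 1 else 0)" if "a < 2 * \<nu> + 1" for a
    using that ij by (simp add: torus_mat_def)
  ultimately have "(torus_mat t c d * torus_mat t d c) $$ (i, j) =
      (if i = t then c else if i = \<nu> + t then d else 1) * col (torus_mat t d c) j $ i"
    using ij torus_mat_vec[of "col (torus_mat t d c) j" i t c d]
    by (subst mat_mult_index[of _ "2 * \<nu> + 1"]) simp_all
  also have "\<dots> = (1\<^sub>m (2 * \<nu> + 1)) $$ (i, j)"
    using ij assms col[of i] by (auto simp: mult.commute[of d c])
  finally show "(torus_mat t c d * torus_mat t d c) $$ (i, j) = (1\<^sub>m (2 * \<nu> + 1)) $$ (i, j)" .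
qed (simp_all add: torus_mat_def)

lemma invertible_torus_mat:
  assumes "c * d = 1" "t < \<nu>"
  shows "invertible_mat (torus_mat t c d)"
  using torus_mat_mult[OF assms] torus_mat_mult[of d c t] assms
  unfolding invertible_mat_def inverts_mat_def
  by (auto simp: torus_mat_def square_mat.simps mult.commute)

lemma qform_torus_mat:
  assumes "c * d = 1" "t < \<nu>" "v \<in> carrier_vec (2 * \<nu> + 1)"
  shows "qform \<nu> (torus_mat t c d *\<^sub>v v) = qform \<nu> v"
proof -
  have "(torus_mat t c d *\<^sub>v v) $ u * (torus_mat t c d *\<^sub>v v) $ (\<nu> + u) = v $ u * v $ (\<nu> + u)" if "u < \<nu>" for u
  proof (cases "u = t")
    case True
    have "c * v $ t * (d * v $ (\<nu> + t)) = (c * d) * (v $ t * v $ (\<nu> + t))"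
      by (simp add: mult_ac)
    then show ?thesis using that assms True by (simp add: torus_mat_vec)
  qed (use that assms in \<open>simp add: torus_mat_vec\<close>)
  then show ?thesis
    using assms by (simp add: qform_def torus_mat_vec)
qed

text \<open>The change y_t += r^2 x_t adds r^2 x_t^2 to the form, the change z += r x_t adds the
  same square, and the cross term of z^2 is doubled; everything added cancels.\<close>

lemma qform_short_transvection:
  fixes r :: "'a::comm_ring_1"
  assumes two: "\<And>x :: 'a. x + x = 0" and t: "t < \<nu>" and v: "v \<in> carrier_vec (2 * \<nu> + 1)"
  shows "qform \<nu> (pair_transvection (\<nu> + t) t (r\<^sup>2) (2 * \<nu>) t r *\<^sub>v v) = qform \<nu> v"
proof -
  let ?g = "pair_transvection (\<nu> + t) t (r\<^sup>2) (2 * \<nu>) t r"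
  have "(?g *\<^sub>v v) $ u * (?g *\<^sub>v v) $ (\<nu> + u) = v $ u * v $ (\<nu> + u) + (if u = t then r\<^sup>2 * (v $ t)\<^sup>2 else 0)"
    if "u < \<nu>" for u
    using that t v by (simp add: pair_transvection_vec distrib_left power2_eq_square mult_ac)
  then have "(\<Sum>u<\<nu>. (?g *\<^sub>v v) $ u * (?g *\<^sub>v v) $ (\<nu> + u)) = (\<Sum>u<\<nu>. v $ u * v $ (\<nu> + u)) + r\<^sup>2 * (v $ t)\<^sup>2"
    using t by (simp add: sum.distrib)
  moreover have "((?g *\<^sub>v v) $ (2 * \<nu>))\<^sup>2 = (v $ (2 * \<nu>))\<^sup>2 + r\<^sup>2 * (v $ t)\<^sup>2"
  proof -
    have "((?g *\<^sub>v v) $ (2 * \<nu>))\<^sup>2 = (v $ (2 * \<nu>))\<^sup>2 + r\<^sup>2 * (v $ t)\<^sup>2 +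
        (v $ (2 * \<nu>) * (r * v $ t) + v $ (2 * \<nu>) * (r * v $ t))"
      using t v by (simp add: pair_transvection_vec power2_eq_square algebra_simps)
    then show ?thesis using two by simp
  qed
  ultimately show ?thesis
    using two[of "r\<^sup>2 * (v $ t)\<^sup>2"] by (simp add: qform_def algebra_simps)
qed

text \<open>Both x_t y_t and x_(t+1) y_(t+1) gain the term s y_t y_(t+1).\<close>

lemma qform_long_transvection:
  fixes s :: "'a::comm_ring_1"
  assumes two: "\<And>x :: 'a. x + x = 0" and t: "Suc t < \<nu>" and v: "v \<in> carrier_vec (2 * \<nu> + 1)"
  shows "qform \<nu> (pair_transvection (Suc t) (\<nu> + t) s t (\<nu> + Suc t) s *\<^sub>v v) = qform \<nu> v"
proof -
  let ?g = "pair_transvection (Suc t) (\<nu> + t) s t (\<nu> + Suc t) s"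
  let ?e = "s * v $ (\<nu> + t) * v $ (\<nu> + Suc t)"
  have "(?g *\<^sub>v v) $ u * (?g *\<^sub>v v) $ (\<nu> + u) =
      v $ u * v $ (\<nu> + u) + (if u = Suc t then ?e else 0) + (if u = t then ?e else 0)" if "u < \<nu>" for u
    using that t v by (simp add: pair_transvection_vec algebra_simps)
  then have "(\<Sum>u<\<nu>. (?g *\<^sub>v v) $ u * (?g *\<^sub>v v) $ (\<nu> + u)) = (\<Sum>u<\<nu>. v $ u * v $ (\<nu> + u)) + (?e + ?e)"
    using t by (simp add: sum.distrib)
  moreover have "(?g *\<^sub>v v) $ (2 * \<nu>) = v $ (2 * \<nu>)"
    using t v by (simp add: pair_transvection_vec)
  ultimately show ?thesis
    using two[of ?e] by (simp add: qform_def)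
qed

text \<open>Preserving the form on vectors of polynomials as well makes the invariance of \<open>Qpol\<close>
  and \<open>Bpol\<close> immediate.\<close>
definition formal_orth :: "'a::comm_ring_1 mat set" where
  "formal_orth = {g \<in> orth_group \<nu>. \<forall>v :: (nat \<times> nat, 'a) mpol vec. v \<in> carrier_vec (2 * \<nu> + 1) \<longrightarrow>
     qform \<nu> (map_mat Cst g *\<^sub>v v) = qform \<nu> v}"

lemma formal_orthI:
  fixes g :: "'a::comm_ring_1 mat"
  assumes "g \<in> carrier_mat (2 * \<nu> + 1) (2 * \<nu> + 1)" "invertible_mat g"
    and "\<And>v. v \<in> carrier_vec (2 * \<nu> + 1) \<Longrightarrow> qform \<nu> (g *\<^sub>v v) = qform \<nu> v"
    and "\<And>v :: (nat \<times> nat, 'a) mpol vec. v \<in> carrier_vec (2 * \<nu> + 1) \<Longrightarrow>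
      qform \<nu> (map_mat Cst g *\<^sub>v v) = qform \<nu> v"
  shows "g \<in> formal_orth"
  using assms by (auto simp: formal_orth_def orth_group_def)

lemma torus_mat_formal_orth:
  assumes "c * d = 1" "t < \<nu>"
  shows "torus_mat t c d \<in> formal_orth"
proof (rule formal_orthI)
  have "Cst c * Cst d = (1 :: (nat \<times> nat, 'a) mpol)"
    using assms(1) by (simp flip: Cst_mult)
  then show "qform \<nu> (map_mat Cst (torus_mat t c d) *\<^sub>v v) = qform \<nu> v"
    if "v \<in> carrier_vec (2 * \<nu> + 1)" for v :: "(nat \<times> nat, 'a) mpol vec"
    unfolding map_torus_mat using assms(2) that by (rule qform_torus_mat)
qed (use assms in \<open>simp_all add: invertible_torus_mat qform_torus_mat\<close>)

lemma short_transvection_formal_orth: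
  fixes r :: "'a::comm_ring_1"
  assumes two: "\<And>x :: 'a. x + x = 0" and t: "t < \<nu>"
  shows "pair_transvection (\<nu> + t) t (r\<^sup>2) (2 * \<nu>) t r \<in> formal_orth"
proof (rule formal_orthI)
  show "invertible_mat (pair_transvection (\<nu> + t) t (r\<^sup>2) (2 * \<nu>) t r)"
    by (rule invertible_pair_transvection[OF two]) (use t in auto)
  show "qform \<nu> (pair_transvection (\<nu> + t) t (r\<^sup>2) (2 * \<nu>) t r *\<^sub>v v) = qform \<nu> v"
    if "v \<in> carrier_vec (2 * \<nu> + 1)" for v
    by (rule qform_short_transvection[OF two t that])
  show "qform \<nu> (map_mat Cst (pair_transvection (\<nu> + t) t (r\<^sup>2) (2 * \<nu>) t r) *\<^sub>v v) = qform \<nu> v"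
    if "v \<in> carrier_vec (2 * \<nu> + 1)" for v :: "(nat \<times> nat, 'a) mpol vec"
    unfolding map_pair_transvection Cst_power
    by (rule qform_short_transvection[OF mpol_double[OF two] t that])
qed simp

lemma long_transvection_formal_orth:
  fixes s :: "'a::comm_ring_1"
  assumes two: "\<And>x :: 'a. x + x = 0" and t: "Suc t < \<nu>"
  shows "pair_transvection (Suc t) (\<nu> + t) s t (\<nu> + Suc t) s \<in> formal_orth"
proof (rule formal_orthI)
  show "invertible_mat (pair_transvection (Suc t) (\<nu> + t) s t (\<nu> + Suc t) s)"
    by (rule invertible_pair_transvection[OF two]) (use t in auto)
  show "qform \<nu> (pair_transvection (Suc t) (\<nu> + t) s t (\<nu> + Suc t) s *\<^sub>v v) = qform \<nu> v"
    if "v \<in> carrier_vec (2 * \<nu> + 1)" for v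
    by (rule qform_long_transvection[OF two t that])
  show "qform \<nu> (map_mat Cst (pair_transvection (Suc t) (\<nu> + t) s t (\<nu> + Suc t) s) *\<^sub>v v) = qform \<nu> v"
    if "v \<in> carrier_vec (2 * \<nu> + 1)" for v :: "(nat \<times> nat, 'a) mpol vec"
    unfolding map_pair_transvection
    by (rule qform_long_transvection[OF mpol_double[OF two] t that])
qed simp

lemma gen_vec_carrier [simp]: "gen_vec \<nu> i \<in> carrier_vec (Suc (2 * \<nu>))"
  by (simp add: gen_vec_def)

lemma subst_pol_qform:
  assumes "v \<in> carrier_vec (2 * \<nu> + 1)"
  shows "subst_pol \<sigma> (qform \<nu> v) = qform \<nu> (map_vec (subst_pol \<sigma>) v)"
  using assms by (simp add: qform_def subst_pol_add subst_pol_sum subst_pol_mult subst_pol_power)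

lemma act_QB:
  fixes g :: "'a::comm_ring_1 mat"
  assumes "g \<in> formal_orth"
  shows "act \<nu> g (Qpol \<nu> i) = Qpol \<nu> i" "act \<nu> g (Bpol \<nu> i j) = Bpol \<nu> i j"
proof -
  let ?h = "map_mat Cst g :: (nat \<times> nat, 'a) mpol mat"
  have h: "?h \<in> carrier_mat (2 * \<nu> + 1) (2 * \<nu> + 1)"
    using assms by (auto simp: formal_orth_def orth_group_def)
  have q: "qform \<nu> (?h *\<^sub>v v) = qform \<nu> v" if "v \<in> carrier_vec (2 * \<nu> + 1)" for v
    using assms that by (auto simp: formal_orth_def)
  let ?\<sigma> = "\<lambda>(a, i). (?h *\<^sub>v gen_vec \<nu> i) $ a"
  have gen: "map_vec (subst_pol ?\<sigma>) (gen_vec \<nu> i) = ?h *\<^sub>v gen_vec \<nu> i" for i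
    using h by (intro eq_vecI) (auto simp: gen_vec_def)
  show "act \<nu> g (Qpol \<nu> i) = Qpol \<nu> i"
    by (simp add: act_def Qpol_def subst_pol_qform gen q)
  have "map_vec (subst_pol ?\<sigma>) (gen_vec \<nu> i + gen_vec \<nu> j) =
      map_vec (subst_pol ?\<sigma>) (gen_vec \<nu> i) + map_vec (subst_pol ?\<sigma>) (gen_vec \<nu> j)"
    by (intro eq_vecI) (auto simp: gen_vec_def subst_pol_add)
  then have "map_vec (subst_pol ?\<sigma>) (gen_vec \<nu> i + gen_vec \<nu> j) = ?h *\<^sub>v (gen_vec \<nu> i + gen_vec \<nu> j)"
    by (simp add: gen mult_add_distrib_mat_vec[OF h])
  then show "act \<nu> g (Bpol \<nu> i j) = Bpol \<nu> i j"
    by (simp add: act_def Bpol_def polar_def subst_pol_diff subst_pol_qform gen q)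
qed

section \<open>The algebra generated by the Q's and B's\<close>

definition QB :: "generator \<Rightarrow> (nat \<times> nat, 'a::comm_ring_1) mpol" where
  "QB h = (case h of QG i \<Rightarrow> Qpol \<nu> i | BG i j \<Rightarrow> Bpol \<nu> i j)"

definition QB_vars :: "generator set" where
  "QB_vars = QG ` {..<m} \<union> {BG i j | i j. i < m \<and> j < m}"

lemma expressible_iff: "expressible_in_QB \<nu> m f \<longleftrightarrow> (\<exists>p \<in> polys_in QB_vars. f = subst_pol QB p)"
  by (simp add: expressible_in_QB_def QB_vars_def QB_def[abs_def])

lemma subalgebra_expressible:
  "subalgebra {f :: (nat \<times> nat, 'a::comm_ring_1) mpol. expressible_in_QB \<nu> m f}"
proof
  show "Cst c \<in> {f. expressible_in_QB \<nu> m f}" for c :: 'a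
    using subalgebra.Cst[OF subalgebra_polys_in, of c QB_vars]
    by (auto simp: expressible_iff intro!: bexI[of _ "Cst c"])
next
  fix f g :: "(nat \<times> nat, 'a) mpol"
  assume "f \<in> {f. expressible_in_QB \<nu> m f}" "g \<in> {f. expressible_in_QB \<nu> m f}"
  then obtain p q where "p \<in> polys_in QB_vars" "f = subst_pol QB p" "q \<in> polys_in QB_vars" "g = subst_pol QB q"
    by (auto simp: expressible_iff)
  then show "f + g \<in> {f. expressible_in_QB \<nu> m f}" "f * g \<in> {f. expressible_in_QB \<nu> m f}"
    using subalgebra.add[OF subalgebra_polys_in, of p QB_vars q] subalgebra.mult[OF subalgebra_polys_in, of p QB_vars q]
    by (auto simp: expressible_iff simp flip: subst_pol_add subst_pol_mult)
qed

lemma Var_in_polys_in: "x \<in> X \<Longrightarrow> Var x \<in> polys_in X"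
  by (simp add: Var_def polys_in_def)

lemma expressible_generator:
  assumes "h \<in> QB_vars"
  shows "expressible_in_QB \<nu> m (QB h)"
  unfolding expressible_iff using assms Var_in_polys_in by (intro bexI[of _ "Var h"]) auto

lemma expressible_subalgebra_induct:
  assumes "subalgebra S" "expressible_in_QB \<nu> m f"
    and "\<And>i. i < m \<Longrightarrow> Qpol \<nu> i \<in> S" "\<And>i j. i < m \<Longrightarrow> j < m \<Longrightarrow> Bpol \<nu> i j \<in> S"
  shows "f \<in> S"
proof -
  obtain p where p: "p \<in> polys_in QB_vars" "f = subst_pol QB p"
    using assms(2) by (auto simp: expressible_iff)
  have "QB h \<in> S" if "h \<in> QB_vars" for h
    using that assms(3,4) by (auto simp: QB_vars_def QB_def)
  from subalgebra.subst_pol[OF assms(1) p(1) this] show ?thesis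
    by (simp add: p(2))
qed

lemma act_expressible:
  assumes "g \<in> formal_orth" "expressible_in_QB \<nu> m f"
  shows "act \<nu> g f = f"
proof -
  have "subalgebra {f. act \<nu> g f = f}"
    unfolding act_def by (rule subalgebra_fixed)
  from expressible_subalgebra_induct[OF this assms(2)] act_QB[OF assms(1)] show ?thesis by auto
qed

lemma Qpol_expand: "Qpol \<nu> i = (\<Sum>t<\<nu>. Var (t, i) * Var (\<nu> + t, i)) + (Var (2 * \<nu>, i))\<^sup>2"
  by (simp add: Qpol_def qform_def gen_vec_def)

lemma Bpol_char_two:
  fixes i j :: nat
  assumes "\<And>x :: 'a::comm_ring_1. x + x = 0"
  shows "(Bpol \<nu> i j :: (nat \<times> nat, 'a) mpol) =
    (\<Sum>t<\<nu>. Var (t, i) * Var (\<nu> + t, j) + Var (\<nu> + t, i) * Var (t, j))"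
proof -
  let ?zz = "Var (2 * \<nu>, i) * Var (2 * \<nu>, j) :: (nat \<times> nat, 'a) mpol"
  have "2 * Var (2 * \<nu>, i) * Var (2 * \<nu>, j) = ?zz + ?zz"
    by (subst mult.assoc, rule mult_2)
  also have "\<dots> = 0"
    by (rule mpol_double) (rule assms)
  finally show ?thesis
    by (simp only: Bpol_expand add_0_right)
qed

lemma Var_coord: "a < 2 * \<nu> + 1 \<Longrightarrow> i < m \<Longrightarrow> Var (a, i) \<in> polys_in V"
  by (intro Var_in_polys_in) (simp add: V_def)

lemma expressible_coord:
  assumes "\<And>x :: 'a::comm_ring_1. x + x = 0"
    and "expressible_in_QB \<nu> m (f :: (nat \<times> nat, 'a) mpol)"
  shows "f \<in> polys_in V"
  using subalgebra_polys_in assms(2)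
proof (rule expressible_subalgebra_induct)
  interpret subalgebra "polys_in V :: (nat \<times> nat, 'a) mpol set" by (rule subalgebra_polys_in)
  show "Qpol \<nu> i \<in> (polys_in V :: (nat \<times> nat, 'a) mpol set)" if "i < m" for i
    unfolding Qpol_expand using that by (intro add sum mult power Var_coord) auto
  show "Bpol \<nu> i j \<in> (polys_in V :: (nat \<times> nat, 'a) mpol set)" if "i < m" "j < m" for i j
    unfolding Bpol_char_two[OF assms(1)] using that by (intro add sum mult power Var_coord) auto
qed

text \<open>In characteristic 2 the polar form does not involve z, and \<open>Qpol\<close> contains
  z only as a square.\<close>

lemma expressible_even:
  assumes two: "\<And>x :: 'a::comm_ring_1. x + x = 0"
    and "expressible_in_QB \<nu> m (f :: (nat \<times> nat, 'a) mpol)"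
  shows "\<forall>\<mu> \<in> Poly_Mapping.keys f. \<forall>i. even (Poly_Mapping.lookup \<mu> (z_var \<nu> i))"
proof -
  let ?A = "{\<mu>. \<forall>i. even (Poly_Mapping.lookup \<mu> (z_var \<nu> i))}"
  let ?S = "{f :: (nat \<times> nat, 'a) mpol. Poly_Mapping.keys f \<subseteq> ?A}"
  interpret subalgebra ?S
    by (rule subalgebra_keys) (simp_all add: lookup_add)
  have xy: "Var (a, i) \<in> ?S" if "a \<noteq> 2 * \<nu>" for a i
    using that by (auto simp: Var_def lookup_single when_def)
  have z: "(Var (2 * \<nu>, i))\<^sup>2 \<in> ?S" for i
    by (auto simp: Var_def power2_eq_square mult_single lookup_single when_def simp flip: single_add)
  have "f \<in> ?S"
    using subalgebra_axioms assms(2)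
  proof (rule expressible_subalgebra_induct)
    show "Qpol \<nu> i \<in> ?S" for i
      unfolding Qpol_expand by (intro add sum mult xy z) auto
    show "Bpol \<nu> i j \<in> ?S" for i j
      unfolding Bpol_char_two[OF two] by (intro add sum mult xy) auto
  qed
  then show ?thesis by auto
qed

section \<open>The leading monomial of an invariant\<close>

text \<open>The coordinates other than z in the order of comparison, counted from 0; z occupies
  position 0 of \<open>pos\<close>, hence the shift in \<open>pos_row\<close>.\<close>

definition row :: "nat \<Rightarrow> nat" where
  "row p = (if even p then p div 2 else \<nu> + p div 2)"

lemma row_less: "p < 2 * \<nu> \<Longrightarrow> row p < 2 * \<nu>"
  by (auto simp: row_def)

lemma pos_row: "p < 2 * \<nu> \<Longrightarrow> pos (row p) = Suc p"
  by (auto simp: row_def pos_def elim!: evenE oddE)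

lemma row_inj: "p < 2 * \<nu> \<Longrightarrow> q < 2 * \<nu> \<Longrightarrow> row p = row q \<longleftrightarrow> p = q"
  using pos_row by (metis Suc_inject)

lemma ex_row: "a < 2 * \<nu> \<Longrightarrow> \<exists>p<2 * \<nu>. a = row p"
proof (cases "a < \<nu>")
  case True
  then show ?thesis by (intro exI[of _ "2 * a"]) (simp add: row_def)
next
  case False
  moreover assume "a < 2 * \<nu>"
  ultimately show ?thesis by (intro exI[of _ "2 * (a - \<nu>) + 1"]) (auto simp: row_def)
qed

text \<open>The tableau row \<open>p\<close> contains the entry \<open>l\<close> as often as the
  exponent of the variable \<open>(row p, l)\<close> says. The inequality is equivalent to the k-th
  smallest entry of a row exceeding the k-th smallest entry of the row above, for every k up to the
  length of the lower row.\<close>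

definition semistandard :: "(nat \<times> nat \<Rightarrow>\<^sub>0 nat) \<Rightarrow> bool" where
  "semistandard M \<longleftrightarrow> (\<forall>p i. Suc p < 2 * \<nu> \<longrightarrow> i < m \<longrightarrow>
     (\<Sum>l\<le>i. Poly_Mapping.lookup M (row (Suc p), l)) \<le> (\<Sum>l<i. Poly_Mapping.lookup M (row p, l)))"

text \<open>The rows of x_t and y_t have equal length. For a semistandard tableau this means that
  all columns have even height.\<close>

definition balanced :: "(nat \<times> nat \<Rightarrow>\<^sub>0 nat) \<Rightarrow> bool" where
  "balanced M \<longleftrightarrow> (\<forall>t<\<nu>. (\<Sum>l<m. Poly_Mapping.lookup M (t, l)) = (\<Sum>l<m. Poly_Mapping.lookup M (\<nu> + t, l)))"

lemma act_pair_transvection: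
  assumes "f \<in> polys_in V" "q < 2 * \<nu> + 1" "q' < 2 * \<nu> + 1" "p \<noteq> p'"
  shows "act \<nu> (pair_transvection p q s p' q' r) f = subst_pol (\<lambda>(a, l). Var (a, l) +
      (if a = p then Cst s * Var (q, l) else if a = p' then Cst r * Var (q', l) else 0)) f"
  unfolding act_def map_pair_transvection using assms(1)
proof (rule subst_pol_cong)
  fix v assume "v \<in> V"
  then obtain a l where v: "v = (a, l)" "a < 2 * \<nu> + 1" by (auto simp: V_def)
  have gen: "gen_vec \<nu> l $ b = Var (b, l)" if "b < 2 * \<nu> + 1" for b
    using that by (simp add: gen_vec_def)
  have "(pair_transvection p q (Cst s) p' q' (Cst r) *\<^sub>v gen_vec \<nu> l) $ a =
      Var (a, l) + (if a = p then Cst s * Var (q, l) else 0) + (if a = p' then Cst r * Var (q', l) else 0)"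
    using pair_transvection_vec[of "gen_vec \<nu> l" a q q' p "Cst s" p' "Cst r"] v(2) assms(2,3)
    unfolding gen[OF v(2)] gen[OF assms(2)] gen[OF assms(3)] by simp
  then show "(case v of (a, i) \<Rightarrow> (pair_transvection p q (Cst s) p' q' (Cst r) *\<^sub>v gen_vec \<nu> i) $ a) =
    (case v of (a, l) \<Rightarrow> Var (a, l) +
      (if a = p then Cst s * Var (q, l) else if a = p' then Cst r * Var (q', l) else 0))"
    using assms(4) by (simp add: v(1))
qed

lemma act_torus_mat:
  assumes "f \<in> polys_in V"
  shows "act \<nu> (torus_mat t c d) f =
    subst_pol (\<lambda>v. Cst (if fst v = t then c else if fst v = \<nu> + t then d else 1) * Var v) f"
  unfolding act_def map_torus_mat using assms
proof (rule subst_pol_cong)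
  fix v assume "v \<in> V"
  then obtain a l where v: "v = (a, l)" "a < 2 * \<nu> + 1" by (auto simp: V_def)
  then have gen: "gen_vec \<nu> l $ a = Var (a, l)"
    by (simp add: gen_vec_def)
  have "(torus_mat t (Cst c) (Cst d) *\<^sub>v gen_vec \<nu> l) $ a =
      (if a = t then Cst c else if a = \<nu> + t then Cst d else 1) * Var (a, l)"
    using torus_mat_vec[of "gen_vec \<nu> l" a t "Cst c" "Cst d"] v(2) unfolding gen by simp
  then show "(case v of (a, i) \<Rightarrow> (torus_mat t (Cst c) (Cst d) *\<^sub>v gen_vec \<nu> i) $ a) =
    Cst (if fst v = t then c else if fst v = \<nu> + t then d else 1) * Var v"
    by (simp add: v(1))
qed

text \<open>Scaling x_t by c and y_t by 1/c multiplies a monomial by the power of c whose exponent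
  is the difference of the two degrees; every monomial of an invariant must have difference
  0.\<close>

lemma invariant_balanced:
  fixes f :: "(nat \<times> nat, 'k::field) mpol"
  assumes inf: "infinite (UNIV :: 'k set)" and f: "f \<in> polys_in V"
    and inv: "\<And>g. g \<in> formal_orth \<Longrightarrow> act \<nu> g f = f" and M: "M \<in> Poly_Mapping.keys f"
  shows "balanced M"
  unfolding balanced_def
proof (intro allI impI)
  fix t assume t: "t < \<nu>"
  let ?X = "\<Sum>l<m. Poly_Mapping.lookup M (t, l)" and ?Y = "\<Sum>l<m. Poly_Mapping.lookup M (\<nu> + t, l)"
  have keys_V: "Poly_Mapping.keys M \<subseteq> V"
    using f M by (auto simp: polys_in_def)
  have "c ^ ?X = c ^ ?Y" if "c \<noteq> 0" for c :: 'k
  proof -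
    let ?d = "\<lambda>v :: nat \<times> nat. if fst v = t then c else if fst v = \<nu> + t then inverse c else 1"
    have act: "act \<nu> (torus_mat t c (inverse c)) f = f"
      using that t by (intro inv torus_mat_formal_orth) auto
    \<comment> \<open>An exponent function is itself a finitely supported map, so
      \<open>pol_expansion\<close> applies to it.\<close>
    have id: "(\<Sum>v \<in> Poly_Mapping.keys N. Poly_Mapping.single v (Poly_Mapping.lookup N v)) = N"
      for N :: "nat \<times> nat \<Rightarrow>\<^sub>0 nat"
      using pol_expansion[of N] by simp
    have "Poly_Mapping.lookup (act \<nu> (torus_mat t c (inverse c)) f) M =
        (\<Sum>N \<in> Poly_Mapping.keys f. if N = M then Poly_Mapping.lookup f N *
          (\<Prod>v \<in> Poly_Mapping.keys N. ?d v ^ Poly_Mapping.lookup N v) else 0)"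
      unfolding act_torus_mat[OF f] subst_pol_mon mon_Cst_mult_Var id lookup_sum
      by (intro sum.cong refl) (simp add: lookup_Cst_mult lookup_single when_def)
    also have "\<dots> = Poly_Mapping.lookup f M * (\<Prod>v \<in> Poly_Mapping.keys M. ?d v ^ Poly_Mapping.lookup M v)"
      using M by simp
    finally have "(\<Prod>v \<in> Poly_Mapping.keys M. ?d v ^ Poly_Mapping.lookup M v) = 1"
      using M unfolding act by (simp add: in_keys_iff)
    also have "(\<Prod>v \<in> Poly_Mapping.keys M. ?d v ^ Poly_Mapping.lookup M v) = (\<Prod>v\<in>V. ?d v ^ Poly_Mapping.lookup M v)"
      by (rule prod.mono_neutral_left) (use keys_V in \<open>auto simp: in_keys_iff\<close>)
    also have "\<dots> = (\<Prod>v \<in> {t} \<times> {..<m} \<union> {\<nu> + t} \<times> {..<m}. ?d v ^ Poly_Mapping.lookup M v)"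
      by (rule prod.mono_neutral_right) (use t in \<open>auto simp: V_def\<close>)
    also have "\<dots> = (\<Prod>v \<in> {t} \<times> {..<m}. ?d v ^ Poly_Mapping.lookup M v) * (\<Prod>v \<in> {\<nu> + t} \<times> {..<m}. ?d v ^ Poly_Mapping.lookup M v)"
      by (rule prod.union_disjoint) (use t in auto)
    also have "(\<Prod>v \<in> {t} \<times> {..<m}. ?d v ^ Poly_Mapping.lookup M v) = (\<Prod>l<m. c ^ Poly_Mapping.lookup M (t, l))"
      by (rule prod.reindex_bij_witness[of _ "Pair t" snd]) auto
    also have "(\<Prod>v \<in> {\<nu> + t} \<times> {..<m}. ?d v ^ Poly_Mapping.lookup M v) = (\<Prod>l<m. inverse c ^ Poly_Mapping.lookup M (\<nu> + t, l))"
      by (rule prod.reindex_bij_witness[of _ "Pair (\<nu> + t)" snd]) (use t in auto)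
    finally have "c ^ ?X * inverse c ^ ?Y = 1"
      by (simp add: power_sum)
    then show ?thesis using that by (simp add: power_inverse field_simps)
  qed
  \<comment> \<open>The extra factor X makes the polynomial vanish at c = 0 too.\<close>
  then have "poly ([:0, 1:] * (monom 1 ?X - monom 1 ?Y)) c = 0" for c :: 'k
    by (cases "c = 0") (simp_all add: poly_monom)
  from poly_eq_0_if_infinite_UNIV[OF inf this] have "monom (1 :: 'k) ?X = monom 1 ?Y"
    by simp
  then show "?X = ?Y" by (metis degree_monom_eq one_neq_zero)
qed

text \<open>For even \<open>p\<close> the rows are x_t above y_t and the short transvections apply,
  with the z-row as the row \<theta>; for odd \<open>p\<close> they are y_t above x_(t+1), with the
  long transvections and the row of x_t as \<theta>. In both cases row \<theta> only receives a
  lower row.\<close>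

lemma invariant_semistandard:
  fixes f :: "(nat \<times> nat, 'k::alg_closed_field) mpol"
  assumes inf: "infinite (UNIV :: 'k set)" and two: "\<And>x :: 'k. x + x = 0" and f: "f \<in> polys_in V"
    and inv: "\<And>g. g \<in> formal_orth \<Longrightarrow> act \<nu> g f = f"
    and M: "M \<in> Poly_Mapping.keys f" "\<And>N. N \<in> Poly_Mapping.keys f \<Longrightarrow> key N \<le> key M"
  shows "semistandard M"
  unfolding semistandard_def
proof (intro allI impI)
  fix p i assume p: "Suc p < 2 * \<nu>" and i: "i < m"
  define t where "t = p div 2"
  show "(\<Sum>l\<le>i. Poly_Mapping.lookup M (row (Suc p), l)) \<le> (\<Sum>l<i. Poly_Mapping.lookup M (row p, l))"
  proof (cases "even p")
    case True
    then have p_eq: "p = 2 * t" by (simp add: t_def)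
    then have t: "t < \<nu>" using p by simp
    have rows: "row p = t" "row (Suc p) = \<nu> + t" by (simp_all add: row_def p_eq)
    show ?thesis unfolding rows
    proof (rule row_dominated[OF inf f M, where \<theta> = "2 * \<nu>" and \<eta> = t])
      fix s :: 'k
      \<comment> \<open>The row y_t moves by r^2 while z moves by r, so an arbitrary parameter
        \<open>s\<close> needs a square root.\<close>
      obtain r where r: "r\<^sup>2 = s" using nth_root_exists[of 2 s] by auto
      have "act \<nu> (pair_transvection (\<nu> + t) t s (2 * \<nu>) t r) f = f"
        unfolding r[symmetric] by (intro inv short_transvection_formal_orth two t)
      then show "\<exists>r. subst_pol (\<lambda>(a, l). Var (a, l) + (if a = \<nu> + t then Cst s * Var (t, l)
          else if a = 2 * \<nu> then Cst r * Var (t, l) else 0)) f = f"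
        using t by (subst (asm) act_pair_transvection[OF f]) auto
    qed (use t i in \<open>auto simp: pos_def\<close>)
  next
    case False
    then have p_eq: "p = 2 * t + 1" by (simp add: t_def)
    then have t: "Suc t < \<nu>" using p by simp
    have rows: "row p = \<nu> + t" "row (Suc p) = Suc t" by (simp_all add: row_def p_eq)
    show ?thesis unfolding rows
    proof (rule row_dominated[OF inf f M, where \<theta> = t and \<eta> = "\<nu> + Suc t"])
      fix s :: 'k
      have "act \<nu> (pair_transvection (Suc t) (\<nu> + t) s t (\<nu> + Suc t) s) f = f"
        by (intro inv long_transvection_formal_orth two t)
      then show "\<exists>r. subst_pol (\<lambda>(a, l). Var (a, l) + (if a = Suc t then Cst s * Var (\<nu> + t, l)
          else if a = t then Cst r * Var (\<nu> + Suc t, l) else 0)) f = f"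
        using t by (subst (asm) act_pair_transvection[OF f]) auto
    qed (use t i in \<open>auto simp: pos_def\<close>)
  qed
qed

section \<open>Pfaffians of the generic Gram matrix\<close>

lemma lead_Var: "v \<in> V \<Longrightarrow> lead (Var v ^ n) (Poly_Mapping.single v n)"
  by (auto simp: lead_def Var_power polys_in_def)

lemma lead_add:
  assumes "lead f M" "g \<in> polys_in V" "\<And>\<mu>. \<mu> \<in> Poly_Mapping.keys g \<Longrightarrow> key \<mu> < key M"
  shows "lead (f + g) M"
proof -
  have "M \<notin> Poly_Mapping.keys g" using assms(3) by blast
  then have "Poly_Mapping.lookup (f + g) M = 1"
    using assms(1) by (simp add: lead_def lookup_add in_keys_iff)
  moreover have "f + g \<in> polys_in V"
    using assms(1,2) by (intro subalgebra.add[OF subalgebra_polys_in]) (simp_all add: lead_def)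
  moreover have "key \<mu> \<le> key M" if "\<mu> \<in> Poly_Mapping.keys (f + g)" for \<mu>
    using that Poly_Mapping.keys_add[of f g] assms(1) assms(3)[of \<mu>] by (auto simp: lead_def)
  ultimately show ?thesis
    by (simp add: lead_def)
qed

definition pairs :: "nat \<Rightarrow> ((nat \<Rightarrow> (nat \<times> nat, 'a::comm_ring_1) mpol) \<times> (nat \<Rightarrow> (nat \<times> nat, 'a) mpol)) list" where
  "pairs t = map (\<lambda>t. (\<lambda>i. Var (t, i), \<lambda>i. Var (\<nu> + t, i))) [t..<\<nu>]"

lemma pairs_Cons: "t < \<nu> \<Longrightarrow> pairs t = (\<lambda>i. Var (t, i), \<lambda>i. Var (\<nu> + t, i)) # pairs (Suc t)"
  by (simp add: pairs_def upt_conv_Cons)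

lemma bil_pairs:
  assumes two: "\<And>x :: 'a::comm_ring_1. x + x = 0"
  shows "bil (pairs 0) i j = (Bpol \<nu> i j :: (nat \<times> nat, 'a) mpol)"
proof -
  have "bil (map (\<lambda>t. (\<lambda>i. Var (t, i), \<lambda>i. Var (\<nu> + t, i))) ts) i j =
      (\<Sum>t\<leftarrow>ts. Var (t, i) * Var (\<nu> + t, j) + Var (\<nu> + t, i) * Var (t, j) :: (nat \<times> nat, 'a) mpol)" for ts
    by (induction ts) simp_all
  then show ?thesis
    by (simp add: pairs_def Bpol_char_two[OF two] sum_list_distinct_conv_sum_set atLeast0LessThan)
qed

lemma expressible_pf:
  assumes two: "\<And>x :: 'a::comm_ring_1. x + x = 0" and "I \<subseteq> {..<m}"
  shows "expressible_in_QB \<nu> m (pf (pairs 0) I :: (nat \<times> nat, 'a) mpol)"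
proof -
  interpret subalgebra "{f :: (nat \<times> nat, 'a) mpol. expressible_in_QB \<nu> m f}"
    by (rule subalgebra_expressible)
  have "Bpol \<nu> i j \<in> {f :: (nat \<times> nat, 'a) mpol. expressible_in_QB \<nu> m f}" if "i < m" "j < m" for i j
    using expressible_generator[of "BG i j"] that by (auto simp: QB_def QB_vars_def)
  then have "pf (pairs 0) I \<in> {f :: (nat \<times> nat, 'a) mpol. expressible_in_QB \<nu> m f}"
    using assms(2) finite_subset[OF assms(2)] by (intro pf mpol_double[OF two]) (auto simp: bil_pairs[OF two])
  then show ?thesis by simp
qed

text \<open>The first variable row used by \<open>pairs t\<close> has position 2t + 1, so all rows
  above it are absent from the Pfaffian.\<close>

lemma pf_pairs_low:
  assumes "I \<subseteq> {..<m}"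
  shows "(pf (pairs t) I :: (nat \<times> nat, 'a::comm_ring_1) mpol) \<in> polys_in {v \<in> V. 2 * t < pos (fst v)}"
proof -
  interpret subalgebra "polys_in {v \<in> V. 2 * t < pos (fst v)} :: (nat \<times> nat, 'a) mpol set"
    by (rule subalgebra_polys_in)
  have main: "pf ps I \<in> polys_in {v \<in> V. 2 * t < pos (fst v)}"
    if "\<And>x y i. (x, y) \<in> set ps \<Longrightarrow> i < m \<Longrightarrow> x i \<in> polys_in {v \<in> V. 2 * t < pos (fst v)} \<and> y i \<in> polys_in {v \<in> V. 2 * t < pos (fst v)}"
    for ps :: "((nat \<Rightarrow> (nat \<times> nat, 'a) mpol) \<times> _) list"
    using that assms
  proof (induction ps I rule: pf.induct)
    case (1 I)
    then show ?case by (simp add: one zero)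
  next
    case (2 x y ps I)
    have "x i \<in> polys_in {v \<in> V. 2 * t < pos (fst v)}" "y i \<in> polys_in {v \<in> V. 2 * t < pos (fst v)}" if "i \<in> I" for i
      using 2(3)[of x y i] 2(4) that by auto
    moreover have "pf ps I \<in> polys_in {v \<in> V. 2 * t < pos (fst v)}"
      using 2(3,4) by (intro 2(1)) auto
    moreover have "pf ps (I - {i, j}) \<in> polys_in {v \<in> V. 2 * t < pos (fst v)}" if "i \<in> I" "j \<in> I - {i}" for i j
      using 2(3,4) that by (intro 2(2)) auto
    ultimately show ?case
      unfolding pf.simps by (intro add sum mult) auto
  qed
  show ?thesis
  proof (rule main)
    fix x y :: "nat \<Rightarrow> (nat \<times> nat, 'a) mpol" and i
    assume "(x, y) \<in> set (pairs t)" "i < m"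
    then obtain u where "t \<le> u" "u < \<nu>" "x = (\<lambda>i. Var (u, i))" "y = (\<lambda>i. Var (\<nu> + u, i))"
      by (auto simp: pairs_def)
    then show "x i \<in> polys_in {v \<in> V. 2 * t < pos (fst v)} \<and> y i \<in> polys_in {v \<in> V. 2 * t < pos (fst v)}"
      using \<open>i < m\<close> by (auto intro!: Var_in_polys_in simp: V_def pos_def)
  qed
qed

abbreviation "deg \<equiv> weight (\<lambda>_. 1 :: int)"

lemma deg_mult_le:
  assumes "\<And>\<mu>. \<mu> \<in> Poly_Mapping.keys f \<Longrightarrow> deg \<mu> \<le> d" "\<And>\<mu>. \<mu> \<in> Poly_Mapping.keys g \<Longrightarrow> deg \<mu> \<le> e"
    and "\<mu> \<in> Poly_Mapping.keys (f * g)"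
  shows "deg \<mu> \<le> d + e"
  using assms(3) by (elim keys_mult_obtain) (auto simp: weight_add intro: add_mono assms)

lemma deg_sum_le:
  assumes "\<And>i \<mu>. i \<in> I \<Longrightarrow> \<mu> \<in> Poly_Mapping.keys (f i) \<Longrightarrow> deg \<mu> \<le> d" "\<mu> \<in> Poly_Mapping.keys (\<Sum>i\<in>I. f i)"
  shows "deg \<mu> \<le> d"
  using assms Poly_Mapping.keys_sum[of f I] by blast

text \<open>Each summand of the recursion trades two indices for two variables of degree 1.\<close>

lemma deg_pf_pairs:
  assumes "finite I" "\<mu> \<in> Poly_Mapping.keys (pf (pairs t) I :: (nat \<times> nat, 'a::comm_ring_1) mpol)"
  shows "deg \<mu> \<le> int (card I)"
proof -
  have main: "deg \<mu> \<le> int (card I)" if "finite I" "\<mu> \<in> Poly_Mapping.keys (pf ps I)"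
      "\<And>x y i \<mu>. (x, y) \<in> set ps \<Longrightarrow> \<mu> \<in> Poly_Mapping.keys (x i) \<or> \<mu> \<in> Poly_Mapping.keys (y i) \<Longrightarrow> deg \<mu> \<le> 1"
    for ps :: "((nat \<Rightarrow> (nat \<times> nat, 'a) mpol) \<times> _) list" and I \<mu>
    using that
  proof (induction ps I arbitrary: \<mu> rule: pf.induct)
    case (1 I)
    then show ?case by (auto split: if_splits)
  next
    case (2 x y ps I)
    have IH1: "deg \<mu> \<le> int (card I)" if "\<mu> \<in> Poly_Mapping.keys (pf ps I)" for \<mu>
      using that 2(3,5) by (intro 2(1)) auto
    let ?f = "\<lambda>i j. x i * y j * pf ps (I - {i, j})"
    have entry: "deg \<mu> \<le> int (card I)"
      if ij: "i \<in> I" "j \<in> I - {i}" and \<mu>: "\<mu> \<in> Poly_Mapping.keys (x i * y j * pf ps (I - {i, j}))" for i j \<mu>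
    proof -
      have IH2: "deg \<mu> \<le> int (card (I - {i, j}))" if "\<mu> \<in> Poly_Mapping.keys (pf ps (I - {i, j}))" for \<mu>
        using that 2(3,5) ij by (intro 2(2)) auto
      have xy: "deg \<mu> \<le> 1 + 1" if "\<mu> \<in> Poly_Mapping.keys (x i * y j)" for \<mu>
        by (rule deg_mult_le[OF _ _ that]) (use 2(5)[of x y] in auto)
      have "card I = Suc (Suc (card (I - {i, j})))"
      proof -
        have "I - {i, j} = I - {i} - {j}" by auto
        then show ?thesis
          using ij 2(3) card_Suc_Diff1[of I i] card_Suc_Diff1[of "I - {i}" j] by simp
      qed
      then show ?thesis using deg_mult_le[OF xy IH2 \<mu>] by simp
    qed
    have inner: "deg \<mu> \<le> int (card I)" if i: "i \<in> I" and \<mu>: "\<mu> \<in> Poly_Mapping.keys (\<Sum>j\<in>I - {i}. ?f i j)" for i \<mu>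
      by (rule deg_sum_le[OF _ \<mu>]) (rule entry[OF i])
    have outer: "deg \<mu> \<le> int (card I)" if \<mu>: "\<mu> \<in> Poly_Mapping.keys (\<Sum>i\<in>I. \<Sum>j\<in>I - {i}. ?f i j)" for \<mu>
      by (rule deg_sum_le[OF _ \<mu>]) (rule inner)
    have "\<mu> \<in> Poly_Mapping.keys (pf ps I) \<or> \<mu> \<in> Poly_Mapping.keys (\<Sum>i\<in>I. \<Sum>j\<in>I - {i}. ?f i j)"
      using 2(4) Poly_Mapping.keys_add[of "pf ps I" "\<Sum>i\<in>I. \<Sum>j\<in>I - {i}. ?f i j"] by auto
    then show ?case using IH1 outer by blast
  qed
  show ?thesis
    using assms by (rule main) (auto simp: pairs_def keys_Var)
qed

section \<open>Leading monomials of products of the generators\<close>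

text \<open>A single column of a tableau, written as a monomial: its entries go into successive
  rows, starting with row \<open>2 * t\<close>.\<close>

definition diagonal :: "nat \<Rightarrow> nat list \<Rightarrow> (nat \<times> nat \<Rightarrow>\<^sub>0 nat)" where
  "diagonal t is = (\<Sum>p<length is. Poly_Mapping.single (row (2 * t + p), is ! p) 1)"

lemma diagonal_Nil [simp]: "diagonal t [] = 0"
  by (simp add: diagonal_def)

lemma diagonal_Cons_Cons:
  "diagonal t (i # j # is) =
    Poly_Mapping.single (t, i) 1 + Poly_Mapping.single (\<nu> + t, j) 1 + diagonal (Suc t) is"
proof -
  have "row (2 * t) = t" "row (Suc (2 * t)) = \<nu> + t" by (simp_all add: row_def)
  then show ?thesis
    by (simp add: diagonal_def sum.lessThan_Suc_shift add.assoc del: sum.lessThan_Suc)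
qed

lemma lookup_diagonal:
  assumes "length is \<le> 2 * \<nu>" "q < 2 * \<nu>"
  shows "Poly_Mapping.lookup (diagonal 0 is) (row q, l) = (if q < length is \<and> is ! q = l then 1 else 0)"
proof -
  have "Poly_Mapping.lookup (diagonal 0 is) (row q, l) =
      (\<Sum>p<length is. if p = q then if is ! q = l then 1 else 0 else 0)"
    unfolding diagonal_def lookup_sum
    by (intro sum.cong refl) (use assms row_inj in \<open>auto simp: lookup_single when_def\<close>)
  then show ?thesis by simp
qed

lemma deg_diagonal: "deg (diagonal t is) = int (length is)"
proof -
  have "deg (\<Sum>p\<in>A. Poly_Mapping.single (k p) 1) = int (card A)" if "finite A" for A :: "nat set" and k :: "nat \<Rightarrow> nat \<times> nat"
    using that by (induction A rule: finite_induct) (simp_all add: weight_add)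
  then show ?thesis by (simp add: diagonal_def)
qed

text \<open>The two smallest indices i < j go to the first pair: the variable of row
  \<open>t\<close> and index i is the highest one that any summand can contain, and the one of row
  \<open>\<nu> + t\<close> and index j is the best choice after it. The remaining Pfaffian is
  treated by induction. The bound on the length guarantees that enough pairs of rows are
  left.\<close>

lemma lead_pf:
  assumes "sorted_wrt (<) is" "set is \<subseteq> {..<m}" "even (length is)" "2 * t + length is \<le> 2 * \<nu>"
  shows "lead (pf (pairs t) (set is) :: (nat \<times> nat, 'a::comm_ring_1) mpol) (diagonal t is)"
  using assms
proof (induction "length is" arbitrary: t "is" rule: less_induct)
  case less
  show ?case
  proof (cases "is = []")
    case True
    then show ?thesis by (simp add: lead_1)
  next
    case False
    then obtain i js where "is = i # js" by (cases "is") auto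
    moreover from this obtain j ks where "js = j # ks"
      using less.prems(3) by (cases js) auto
    ultimately have is_eq: "is = i # j # ks" by simp
    have t: "t < \<nu>" using less.prems(4) by (simp add: is_eq)
    have ij: "i < m" "j < m" "i < j" "set ks \<subseteq> {..<m}" "\<forall>k \<in> set ks. i < k \<and> j < k"
      using less.prems(1,2) by (auto simp: is_eq)
    define I where "I = set is"
    have I: "finite I" "I \<subseteq> {..<m}" using less.prems(2) by (auto simp: I_def)
    have min: "a = i \<or> i < a" "a = i \<or> a = j \<or> j < a" if "a \<in> I" for a
      using that ij(3,5) by (auto simp: I_def is_eq)
    define F :: "nat \<times> nat \<Rightarrow> (nat \<times> nat, 'a) mpol" where
      "F = (\<lambda>(a, b). Var (t, a) * Var (\<nu> + t, b) * pf (pairs (Suc t)) (I - {a, b}))"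
    define S where "S = Sigma I (\<lambda>a. I - {a})"
    have "finite S" "(i, j) \<in> S" using I(1) ij(3) by (auto simp: S_def I_def is_eq)
    have low: "pf (pairs (Suc t)) J \<in> polys_in {v \<in> V. 2 * t + 2 < pos (fst v)}" if "J \<subseteq> I" for J
      using pf_pairs_low[of J "Suc t"] that I(2) by auto
    let ?M = "diagonal t is"
    have M_eq: "?M = Poly_Mapping.single (t, i) 1 + Poly_Mapping.single (\<nu> + t, j) 1 + diagonal (Suc t) ks"
      by (simp add: is_eq diagonal_Cons_Cons)
    have coords: "(t, a) \<in> V" "(\<nu> + t, a) \<in> V" if "a < m" for a
      using that t by (auto simp: V_def)
    have pos_t: "pos t = 2 * t + 1" "pos (\<nu> + t) = 2 * t + 2" using t by (auto simp: pos_def)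
    have I_minus: "I - {i, j} = set ks"
      using ij(3,5) by (auto simp: I_def is_eq)
    have lead_ks: "lead (pf (pairs (Suc t)) (set ks) :: (nat \<times> nat, 'a) mpol) (diagonal (Suc t) ks)"
      using less.prems ij(4) by (intro less.hyps) (auto simp: is_eq)
    have lead_ij: "lead (F (i, j)) ?M"
      using lead_mult[OF lead_mult[OF lead_Var[OF coords(1)[OF ij(1)], of 1] lead_Var[OF coords(2)[OF ij(2)], of 1]] lead_ks]
      by (simp add: F_def I_minus M_eq)
    have keys_M: "Poly_Mapping.keys ?M \<subseteq> V" by (rule lead_keys[OF lead_ij])
    have low_D: "Poly_Mapping.lookup (diagonal (Suc t) ks) v = 0" if "pos (fst v) \<le> 2 * t + 2" for v
    proof -
      have "diagonal (Suc t) ks \<in> Poly_Mapping.keys (pf (pairs (Suc t)) (set ks) :: (nat \<times> nat, 'a) mpol)"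
        using lead_ks by (simp add: lead_def in_keys_iff)
      moreover have "set ks \<subseteq> I" by (auto simp: I_def is_eq)
      ultimately have "Poly_Mapping.keys (diagonal (Suc t) ks) \<subseteq> {v \<in> V. 2 * t + 2 < pos (fst v)}"
        using low[of "set ks"] by (auto simp: polys_in_def)
      then show ?thesis using that by (auto simp: in_keys_iff)
    qed
    have F_V: "F p \<in> polys_in V" if "p \<in> S" for p
    proof -
      have "pf (pairs (Suc t)) (I - {fst p, snd p}) \<in> (polys_in V :: (nat \<times> nat, 'a) mpol set)"
        using low[of "I - {fst p, snd p}"] by (auto simp: polys_in_def)
      moreover have "fst p < m" "snd p < m" using that I(2) by (auto simp: S_def)
      ultimately show ?thesis
        unfolding F_def case_prod_unfold
        using coords by (intro subalgebra.mult[OF subalgebra_polys_in] Var_in_polys_in) auto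
    qed
    have pf_V: "pf (pairs (Suc t)) I \<in> (polys_in V :: (nat \<times> nat, 'a) mpol set)"
      using low[of I] by (auto simp: polys_in_def)
    have M_ti: "Poly_Mapping.lookup ?M (t, i) = 1"
      using low_D[of "(t, i)"] ij(3) t by (auto simp: M_eq lookup_add lookup_single when_def pos_t)
    have less_F: "key \<mu> < key ?M" if p: "p \<in> S - {(i, j)}" and \<mu>: "\<mu> \<in> Poly_Mapping.keys (F p)" for p \<mu>
    proof -
      obtain a b where ab: "p = (a, b)" "a \<in> I" "b \<in> I" "a \<noteq> b" "(a, b) \<noteq> (i, j)"
        using p by (auto simp: S_def)
      obtain \<beta> where \<beta>: "\<beta> \<in> Poly_Mapping.keys (pf (pairs (Suc t)) (I - {a, b}) :: (nat \<times> nat, 'a) mpol)"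
          "\<mu> = Poly_Mapping.single (t, a) 1 + Poly_Mapping.single (\<nu> + t, b) 1 + \<beta>"
        using \<mu> by (auto simp: F_def ab(1) keys_Var elim!: keys_mult_obtain)
      have low_\<beta>: "Poly_Mapping.lookup \<beta> v = 0" if "pos (fst v) \<le> 2 * t + 2" for v
        using \<beta>(1) low[of "I - {a, b}"] that by (fastforce simp: polys_in_def in_keys_iff)
      have keys_\<mu>: "Poly_Mapping.keys \<mu> \<subseteq> V"
        using F_V[of p] p \<mu> by (auto simp: polys_in_def)
      have lookup_\<mu>: "Poly_Mapping.lookup \<mu> (t, l) = (if l = a then 1 else 0)"
          "Poly_Mapping.lookup \<mu> (\<nu> + t, l) = (if l = b then 1 else 0)" for l
        using low_\<beta>[of "(t, l)"] low_\<beta>[of "(\<nu> + t, l)"] t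
        by (auto simp: \<beta>(2) lookup_add lookup_single when_def pos_t)
      have lookup_M: "Poly_Mapping.lookup ?M (t, l) = (if l = i then 1 else 0)"
          "Poly_Mapping.lookup ?M (\<nu> + t, l) = (if l = j then 1 else 0)" for l
        using low_D[of "(t, l)"] low_D[of "(\<nu> + t, l)"] t
        by (auto simp: M_eq lookup_add lookup_single when_def pos_t)
      have above: "Poly_Mapping.lookup \<mu> u = 0" "Poly_Mapping.lookup ?M u = 0" if "pos (fst u) < 2 * t + 1" for u
        using that low_\<beta>[of u] low_D[of u]
        by (auto simp: \<beta>(2) M_eq lookup_add lookup_single when_def pos_t)
      have eq_row: "fst u = t \<or> pos (fst u) < 2 * t + 1" if "u \<in> V" "pos (fst u) < 2 * t + 2" for u
        using that pos_inj[of "fst u" t] t pos_t(1) by (auto simp: V_def)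
      show ?thesis
      proof (cases "a = i")
        case True
        then have "j < b" using min(2)[OF ab(3)] ab by auto
        show ?thesis
        proof (rule key_less[OF keys_\<mu> keys_M coords(2)[OF ij(2)]])
          show "Poly_Mapping.lookup \<mu> (\<nu> + t, j) < Poly_Mapping.lookup ?M (\<nu> + t, j)"
            using \<open>j < b\<close> by (simp add: lookup_\<mu> lookup_M)
          fix u assume u: "u \<in> V" "higher u (\<nu> + t, j)"
          then consider "pos (fst u) < 2 * t + 1" | "fst u = t" | "fst u = \<nu> + t" "snd u < j"
            using eq_row[of u] by (auto simp: higher_def pos_t)
          then show "Poly_Mapping.lookup \<mu> u = Poly_Mapping.lookup ?M u"
          proof cases
            case 1
            then show ?thesis by (simp add: above)
          next
            case 2
            then show ?thesis using \<open>a = i\<close> by (cases u) (simp add: lookup_\<mu> lookup_M)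
          next
            case 3
            then show ?thesis using \<open>j < b\<close> by (cases u) (simp add: lookup_\<mu> lookup_M)
          qed
        qed
      next
        case False
        then have "i < a" using min(1)[OF ab(2)] by auto
        show ?thesis
        proof (rule key_less[OF keys_\<mu> keys_M coords(1)[OF ij(1)]])
          show "Poly_Mapping.lookup \<mu> (t, i) < Poly_Mapping.lookup ?M (t, i)"
            using \<open>i < a\<close> by (simp add: lookup_\<mu> lookup_M)
          fix u assume u: "u \<in> V" "higher u (t, i)"
          then consider "pos (fst u) < 2 * t + 1" | "fst u = t" "snd u < i"
            by (auto simp: higher_def pos_t)
          then show "Poly_Mapping.lookup \<mu> u = Poly_Mapping.lookup ?M u"
          proof cases
            case 1
            then show ?thesis by (simp add: above)
          next
            case 2
            then show ?thesis using \<open>i < a\<close> by (cases u) (simp add: lookup_\<mu> lookup_M)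
          qed
        qed
      qed
    qed
    \<comment> \<open>The summand that skips the pair \<open>t\<close> has no variable in these two
      rows, so it already loses at \<open>(t, i)\<close>.\<close>
    have less_pf: "key \<mu> < key ?M" if \<mu>: "\<mu> \<in> Poly_Mapping.keys (pf (pairs (Suc t)) I :: (nat \<times> nat, 'a) mpol)" for \<mu>
    proof (rule key_less[OF _ keys_M coords(1)[OF ij(1)]])
      have low_\<mu>: "Poly_Mapping.lookup \<mu> v = 0" if "pos (fst v) \<le> 2 * t + 2" for v
        using \<mu> low[of I] that by (fastforce simp: polys_in_def in_keys_iff)
      show "Poly_Mapping.keys \<mu> \<subseteq> V"
        using pf_V \<mu> by (auto simp: polys_in_def)
      show "Poly_Mapping.lookup \<mu> (t, i) < Poly_Mapping.lookup ?M (t, i)"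
        by (simp add: M_ti low_\<mu> pos_t)
      fix u assume "u \<in> V" "higher u (t, i)"
      then have u: "pos (fst u) < 2 * t + 1 \<or> fst u = t \<and> snd u < i"
        by (auto simp: higher_def pos_t)
      then have "Poly_Mapping.lookup ?M u = 0"
        using low_D[of u] t by (cases u) (auto simp: M_eq lookup_add lookup_single when_def pos_t)
      moreover have "Poly_Mapping.lookup \<mu> u = 0"
      proof (rule low_\<mu>)
        show "pos (fst u) \<le> 2 * t + 2"
          using u pos_t(1) by (elim disjE conjE) simp_all
      qed
      ultimately show "Poly_Mapping.lookup \<mu> u = Poly_Mapping.lookup ?M u" by simp
    qed
    define R where "R = pf (pairs (Suc t)) I + (\<Sum>p\<in>S - {(i, j)}. F p)"
    have "pf (pairs t) I = pf (pairs (Suc t)) I + (\<Sum>p\<in>S. F p)"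
      using I(1) by (simp add: pairs_Cons[OF t] S_def F_def sum.Sigma)
    also have "(\<Sum>p\<in>S. F p) = F (i, j) + (\<Sum>p\<in>S - {(i, j)}. F p)"
      using \<open>finite S\<close> \<open>(i, j) \<in> S\<close> by (rule sum.remove)
    finally have "pf (pairs t) I = F (i, j) + R"
      by (simp add: R_def algebra_simps)
    moreover have "lead (F (i, j) + R) ?M"
    proof (rule lead_add[OF lead_ij])
      show "R \<in> polys_in V"
        unfolding R_def by (intro subalgebra.add[OF subalgebra_polys_in] subalgebra.sum[OF subalgebra_polys_in] pf_V F_V) auto
      fix \<mu> assume "\<mu> \<in> Poly_Mapping.keys R"
      moreover have "Poly_Mapping.keys R \<subseteq>
          Poly_Mapping.keys (pf (pairs (Suc t)) I :: (nat \<times> nat, 'a) mpol) \<union> Poly_Mapping.keys (\<Sum>p\<in>S - {(i, j)}. F p)"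
        unfolding R_def by (rule Poly_Mapping.keys_add)
      moreover have "Poly_Mapping.keys (\<Sum>p\<in>S - {(i, j)}. F p) \<subseteq> (\<Union>p\<in>S - {(i, j)}. Poly_Mapping.keys (F p))"
        by (rule Poly_Mapping.keys_sum)
      ultimately consider "\<mu> \<in> Poly_Mapping.keys (pf (pairs (Suc t)) I :: (nat \<times> nat, 'a) mpol)"
        | p where "p \<in> S - {(i, j)}" "\<mu> \<in> Poly_Mapping.keys (F p)"
        by blast
      then show "key \<mu> < key ?M"
        by cases (fact less_pf, fact less_F)
    qed
    ultimately show ?thesis by (simp add: I_def)
  qed
qed

lemma ex_add_of_le:
  fixes M D :: "'x \<Rightarrow>\<^sub>0 nat"
  assumes "\<And>v. Poly_Mapping.lookup D v \<le> Poly_Mapping.lookup M v"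
  shows "\<exists>M'. M = D + M'"
proof
  show "M = D + (M - D)"
    by (rule poly_mapping_eqI) (simp add: lookup_add minus_poly_mapping.rep_eq assms)
qed

lemma lead_Qpol:
  assumes "l < m"
  shows "lead (Qpol \<nu> l :: (nat \<times> nat, 'a::comm_ring_1) mpol) (Poly_Mapping.single (2 * \<nu>, l) 2)"
    and "\<And>\<mu>. \<mu> \<in> Poly_Mapping.keys (Qpol \<nu> l :: (nat \<times> nat, 'a) mpol) \<Longrightarrow> deg \<mu> \<le> 2"
proof -
  let ?z = "(2 * \<nu>, l)"
  let ?s = "\<lambda>t. Var (t, l) * Var (\<nu> + t, l) :: (nat \<times> nat, 'a) mpol"
  have z: "?z \<in> V" using assms by (simp add: V_def)
  have xy: "(t, l) \<in> V" "(\<nu> + t, l) \<in> V" if "t < \<nu>" for t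
    using assms that by (auto simp: V_def)
  have keys_s: "\<exists>t<\<nu>. \<mu> = Poly_Mapping.single (t, l) 1 + Poly_Mapping.single (\<nu> + t, l) 1"
    if \<mu>: "\<mu> \<in> Poly_Mapping.keys (\<Sum>t<\<nu>. ?s t)" for \<mu>
  proof -
    obtain t where "t < \<nu>" "\<mu> \<in> Poly_Mapping.keys (?s t)"
      using \<mu> Poly_Mapping.keys_sum[of ?s "{..<\<nu>}"] by blast
    then show ?thesis by (auto simp: keys_Var elim!: keys_mult_obtain)
  qed
  have "lead ((Var ?z)\<^sup>2 + (\<Sum>t<\<nu>. ?s t)) (Poly_Mapping.single ?z 2)"
  proof (rule lead_add[OF lead_Var[OF z]])
    show "(\<Sum>t<\<nu>. ?s t) \<in> polys_in V"
      using xy by (intro subalgebra.sum[OF subalgebra_polys_in] subalgebra.mult[OF subalgebra_polys_in] Var_in_polys_in) auto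
    fix \<mu> assume "\<mu> \<in> Poly_Mapping.keys (\<Sum>t<\<nu>. ?s t)"
    then obtain t where t: "t < \<nu>" "\<mu> = Poly_Mapping.single (t, l) 1 + Poly_Mapping.single (\<nu> + t, l) 1"
      using keys_s by blast
    show "key \<mu> < key (Poly_Mapping.single ?z 2)"
    proof (rule key_less[OF _ _ z])
      show "Poly_Mapping.keys \<mu> \<subseteq> V" using xy[OF t(1)] by (simp add: t(2) keys_add_nat)
      show "Poly_Mapping.keys (Poly_Mapping.single ?z 2) \<subseteq> V" using z by simp
      show "Poly_Mapping.lookup \<mu> ?z < Poly_Mapping.lookup (Poly_Mapping.single ?z 2) ?z"
        using t by (simp add: lookup_add lookup_single)
      show "Poly_Mapping.lookup \<mu> u = Poly_Mapping.lookup (Poly_Mapping.single ?z 2) u"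
        if "u \<in> V" "higher u ?z" for u
        using that t by (cases u) (auto simp: higher_def pos_def lookup_add lookup_single when_def)
    qed
  qed
  then show "lead (Qpol \<nu> l :: (nat \<times> nat, 'a) mpol) (Poly_Mapping.single ?z 2)"
    by (simp add: Qpol_expand add.commute)
  show "deg \<mu> \<le> 2" if "\<mu> \<in> Poly_Mapping.keys (Qpol \<nu> l :: (nat \<times> nat, 'a) mpol)" for \<mu>
  proof -
    have "\<mu> \<in> Poly_Mapping.keys (\<Sum>t<\<nu>. ?s t) \<or> \<mu> \<in> Poly_Mapping.keys ((Var ?z)\<^sup>2 :: (nat \<times> nat, 'a) mpol)"
      using that Poly_Mapping.keys_add[of "\<Sum>t<\<nu>. ?s t" "(Var ?z)\<^sup>2"] by (auto simp: Qpol_expand)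
    then show ?thesis
    proof
      assume "\<mu> \<in> Poly_Mapping.keys (\<Sum>t<\<nu>. ?s t)"
      from keys_s[OF this] show ?thesis by (auto simp: weight_add)
    qed (simp add: Var_power)
  qed
qed

section \<open>Splitting off the first column of a tableau\<close>

lemma semistandard_row_zero:
  assumes "semistandard M" "p \<le> q" "q < 2 * \<nu>" "\<And>l. l < m \<Longrightarrow> Poly_Mapping.lookup M (row p, l) = 0" "l < m"
  shows "Poly_Mapping.lookup M (row q, l) = 0"
  using assms(2,3,5)
proof (induction q arbitrary: l rule: dec_induct)
  case base
  then show ?case using assms(4) by simp
next
  case (step q)
  have "(\<Sum>k\<le>l. Poly_Mapping.lookup M (row (Suc q), k)) \<le> (\<Sum>k<l. Poly_Mapping.lookup M (row q, k))"
    using assms(1) step.prems by (simp add: semistandard_def)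
  also have "\<dots> = 0" using step.IH step.prems by simp
  finally show ?case by simp
qed

text \<open>The column consists of the least entries of the nonempty rows. Its height is even
  because the rows of x_t and y_t are empty together, and removing it shortens both of them or
  neither.\<close>

lemma diagonal_split:
  fixes M :: "nat \<times> nat \<Rightarrow>\<^sub>0 nat"
  assumes keys: "Poly_Mapping.keys M \<subseteq> V" and semi: "semistandard M" and bal: "balanced M"
    and M: "v \<in> Poly_Mapping.keys M" "fst v \<noteq> 2 * \<nu>"
  obtains "is" M' where "sorted_wrt (<) is" "set is \<subseteq> {..<m}" "even (length is)" "length is \<le> 2 * \<nu>"
    "is \<noteq> []" "M = diagonal 0 is + M'" "semistandard M'" "balanced M'"
proof -
  have not_V: "Poly_Mapping.lookup M u = 0" if "u \<notin> V" for u
    using keys that by (auto simp: in_keys_iff)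
  have row_V: "l < m" if "Poly_Mapping.lookup M (a, l) \<noteq> 0" for a l
    using not_V[of "(a, l)"] that by (auto simp: V_def)
  define ne where "ne = (\<lambda>p. \<exists>l<m. Poly_Mapping.lookup M (row p, l) \<noteq> 0)"
  have ne_down: "ne p" if "ne q" "p \<le> q" "q < 2 * \<nu>" for p q
  proof (rule ccontr)
    assume "\<not> ne p"
    then have "Poly_Mapping.lookup M (row p, l) = 0" if "l < m" for l
      using that by (auto simp: ne_def)
    from semistandard_row_zero[OF semi that(2,3) this] that(1) show False
      by (auto simp: ne_def)
  qed
  have row_pair: "row (2 * t) = t" "row (2 * t + 1) = \<nu> + t" for t
    by (simp_all add: row_def)
  have ne_pair: "ne (2 * t) \<longleftrightarrow> ne (2 * t + 1)" if "t < \<nu>" for t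
  proof -
    have iff: "ne (2 * t) \<longleftrightarrow> (\<Sum>l<m. Poly_Mapping.lookup M (t, l)) \<noteq> 0"
      "ne (2 * t + 1) \<longleftrightarrow> (\<Sum>l<m. Poly_Mapping.lookup M (\<nu> + t, l)) \<noteq> 0"
      unfolding ne_def row_pair by auto
    have "(\<Sum>l<m. Poly_Mapping.lookup M (t, l)) = (\<Sum>l<m. Poly_Mapping.lookup M (\<nu> + t, l))"
      using bal that by (simp add: balanced_def)
    then show ?thesis unfolding iff by (simp only:)
  qed
  \<comment> \<open>Half the number of nonempty rows; the conjunct \<open>t < \<nu>\<close> makes
    \<nu> the value when no row is empty.\<close>
  define r where "r = (LEAST t. \<not> (t < \<nu> \<and> ne (2 * t)))"
  have "\<not> (r < \<nu> \<and> ne (2 * r))"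
    unfolding r_def by (rule LeastI[of _ \<nu>]) simp
  moreover have below: "t < \<nu> \<and> ne (2 * t)" if "t < r" for t
    using not_less_Least[of t "\<lambda>t. \<not> (t < \<nu> \<and> ne (2 * t))"] that unfolding r_def by blast
  have "r \<le> \<nu>" unfolding r_def by (rule Least_le) simp
  have ne_iff: "ne p \<longleftrightarrow> p < 2 * r" if p: "p < 2 * \<nu>" for p
  proof
    assume "p < 2 * r"
    then have "p div 2 < r" by auto
    with below have "p div 2 < \<nu>" "ne (2 * (p div 2))" by auto
    then show "ne p" using ne_pair[of "p div 2"] by (cases "even p") (auto elim: oddE)
  next
    assume "ne p"
    show "p < 2 * r"
    proof (rule ccontr)
      assume "\<not> p < 2 * r"
      then have "2 * r \<le> p" by simp
      with ne_down[OF \<open>ne p\<close> this p] p calculation show False by auto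
    qed
  qed
  define c where "c = (\<lambda>p. LEAST l. Poly_Mapping.lookup M (row p, l) \<noteq> 0)"
  define "is" where "is = map c [0..<2 * r]"
  have length_is: "length is = 2 * r" and nth_is: "\<And>p. p < 2 * r \<Longrightarrow> is ! p = c p"
    by (simp_all add: is_def)
  have c: "Poly_Mapping.lookup M (row p, c p) \<noteq> 0" if "p < 2 * r" for p
  proof -
    have "ne p" using ne_iff[of p] that \<open>r \<le> \<nu>\<close> by simp
    then show ?thesis unfolding c_def ne_def by (metis (mono_tags, lifting) LeastI)
  qed
  have before_c: "Poly_Mapping.lookup M (row p, l) = 0" if "l < c p" for p l
    using not_less_Least[of l "\<lambda>l. Poly_Mapping.lookup M (row p, l) \<noteq> 0"] that by (simp add: c_def)
  have c_less: "c p < m" if "p < 2 * r" for p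
    using row_V[OF c[OF that]] .
  \<comment> \<open>At i = \<open>c (Suc p)\<close> the left side of the tableau inequality is
    positive, so the row above has an entry smaller than i.\<close>
  have c_mono: "c p < c (Suc p)" if "Suc p < 2 * r" for p
  proof (rule ccontr)
    assume "\<not> c p < c (Suc p)"
    then have zero: "(\<Sum>l<c (Suc p). Poly_Mapping.lookup M (row p, l)) = 0"
      using before_c by simp
    have "(\<Sum>l\<le>c (Suc p). Poly_Mapping.lookup M (row (Suc p), l)) \<le> (\<Sum>l<c (Suc p). Poly_Mapping.lookup M (row p, l))"
      using semi c_less[OF that] that \<open>r \<le> \<nu>\<close> by (simp add: semistandard_def)
    with zero c[OF that] show False by simp
  qed
  have sorted: "sorted_wrt (<) is"
    unfolding sorted_wrt_iff_nth_Suc_transp[OF transp_on_less]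
    using c_mono by (simp add: length_is nth_is)
  have set_is: "set is \<subseteq> {..<m}"
    using c_less by (auto simp: is_def)
  let ?D = "diagonal 0 is"
  have D_row: "Poly_Mapping.lookup ?D (row q, l) = (if q < 2 * r \<and> c q = l then 1 else 0)" if "q < 2 * \<nu>" for q l
    using lookup_diagonal[of "is" q l] that \<open>r \<le> \<nu>\<close> by (auto simp: length_is nth_is)
  have "Poly_Mapping.lookup ?D u \<le> Poly_Mapping.lookup M u" for u
  proof -
    have "Poly_Mapping.lookup ?D u = 0 \<or> (\<exists>p<2 * \<nu>. fst u = row p)"
    proof (rule disjCI)
      assume no: "\<not> (\<exists>p<2 * \<nu>. fst u = row p)"
      show "Poly_Mapping.lookup ?D u = 0"
        unfolding diagonal_def lookup_sum
      proof (intro sum.neutral ballI)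
        fix p assume "p \<in> {..<length is}"
        then have "fst u \<noteq> row p" using no \<open>r \<le> \<nu>\<close> by (simp add: length_is)
        then show "Poly_Mapping.lookup (Poly_Mapping.single (row (2 * 0 + p), is ! p) 1) u = 0"
          by (auto simp: lookup_single when_def)
      qed
    qed
    then show ?thesis
    proof (elim disjE exE conjE)
      fix p assume "p < 2 * \<nu>" "fst u = row p"
      then show ?thesis using D_row[of p "snd u"] c[of p] by (cases u) auto
    qed simp
  qed
  then obtain M' where M': "M = ?D + M'" using ex_add_of_le by blast
  have lookup_M: "Poly_Mapping.lookup M (row q, l) = (if q < 2 * r \<and> c q = l then 1 else 0) + Poly_Mapping.lookup M' (row q, l)"
    if "q < 2 * \<nu>" for q l
    by (simp add: M' lookup_add D_row that)
  have sum_M: "(\<Sum>l\<in>L. Poly_Mapping.lookup M (row q, l)) =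
      (if q < 2 * r \<and> c q \<in> L then 1 else 0) + (\<Sum>l\<in>L. Poly_Mapping.lookup M' (row q, l))"
    if "q < 2 * \<nu>" "finite L" for q L
    using that by (auto simp: lookup_M sum.distrib)
  have "semistandard M'"
    unfolding semistandard_def
  proof (intro allI impI)
    fix p i assume p: "Suc p < 2 * \<nu>" and i: "i < m"
    let ?s = "\<Sum>l\<le>i. Poly_Mapping.lookup M' (row (Suc p), l)" and ?s' = "\<Sum>l<i. Poly_Mapping.lookup M' (row p, l)"
    have le: "(\<Sum>l\<le>i. Poly_Mapping.lookup M (row (Suc p), l)) \<le> (\<Sum>l<i. Poly_Mapping.lookup M (row p, l))"
      using semi p i by (simp add: semistandard_def)
    have eq: "(\<Sum>l\<le>i. Poly_Mapping.lookup M (row (Suc p), l)) = (if Suc p < 2 * r \<and> c (Suc p) \<le> i then 1 else 0) + ?s"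
      "(\<Sum>l<i. Poly_Mapping.lookup M (row p, l)) = (if p < 2 * r \<and> c p < i then 1 else 0) + ?s'"
      using p sum_M[of "Suc p" "{..i}"] sum_M[of p "{..<i}"] by simp_all
    \<comment> \<open>In the first two cases the lower row has no entry up to i; in the third the
      column entries are counted on both sides, so each side drops by 1.\<close>
    consider "2 * r \<le> Suc p" | "Suc p < 2 * r" "i < c (Suc p)" | "Suc p < 2 * r" "c (Suc p) \<le> i"
      by linarith
    then show "?s \<le> ?s'"
    proof cases
      case 1
      then have "(\<Sum>l\<le>i. Poly_Mapping.lookup M (row (Suc p), l)) = 0"
        using ne_iff[OF p] i by (auto simp: ne_def)
      then show ?thesis using eq(1) by simp
    next
      case 2
      then have "(\<Sum>l\<le>i. Poly_Mapping.lookup M (row (Suc p), l)) = 0"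
        using before_c by auto
      then show ?thesis using eq(1) by simp
    next
      case 3
      then have "c p < i" using c_mono[of p] by simp
      then show ?thesis using le eq 3 by simp
    qed
  qed
  moreover have "balanced M'"
    unfolding balanced_def
  proof (intro allI impI)
    fix t assume t: "t < \<nu>"
    have "(\<Sum>l<m. Poly_Mapping.lookup M (t, l)) = (if t < r then 1 else 0) + (\<Sum>l<m. Poly_Mapping.lookup M' (t, l))"
      using sum_M[of "2 * t" "{..<m}"] t c_less[of "2 * t"] by (auto simp: row_pair)
    moreover have "(\<Sum>l<m. Poly_Mapping.lookup M (\<nu> + t, l)) = (if t < r then 1 else 0) + (\<Sum>l<m. Poly_Mapping.lookup M' (\<nu> + t, l))"
      using sum_M[of "2 * t + 1" "{..<m}"] t c_less[of "2 * t + 1"] unfolding row_pair by auto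
    moreover have "(\<Sum>l<m. Poly_Mapping.lookup M (t, l)) = (\<Sum>l<m. Poly_Mapping.lookup M (\<nu> + t, l))"
      using bal t by (simp add: balanced_def)
    ultimately show "(\<Sum>l<m. Poly_Mapping.lookup M' (t, l)) = (\<Sum>l<m. Poly_Mapping.lookup M' (\<nu> + t, l))"
      by simp
  qed
  moreover have "is \<noteq> []"
  proof -
    have "v \<in> V" using keys M(1) by auto
    then have "fst v < 2 * \<nu>" "snd v < m" using M(2) by (auto simp: V_def)
    then obtain p where p: "p < 2 * \<nu>" "fst v = row p" using ex_row by blast
    have "ne p" unfolding ne_def using p \<open>snd v < m\<close> M(1) by (cases v) (auto simp: in_keys_iff)
    then show ?thesis using ne_iff[OF p(1)] length_is by auto
  qed
  ultimately show thesis
    using sorted set_is \<open>r \<le> \<nu>\<close> M' by (intro that[of "is" M']) (simp_all add: length_is)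
qed

text \<open>One factor is peeled off at a time, either z^2 as the leading monomial of some Q or a
  column as that of a Pfaffian. The degree of all monomials is recorded since the lexicographic
  order does not control it.\<close>

lemma ex_expressible_lead:
  assumes two: "\<And>x :: 'a::comm_ring_1. x + x = 0"
    and "Poly_Mapping.keys M \<subseteq> V" "semistandard M" "balanced M"
    and "\<And>i. i < m \<Longrightarrow> even (Poly_Mapping.lookup M (z_var \<nu> i))"
  shows "\<exists>G :: (nat \<times> nat, 'a) mpol. expressible_in_QB \<nu> m G \<and> lead G M \<and>
    (\<forall>\<mu> \<in> Poly_Mapping.keys G. deg \<mu> \<le> deg M)"
  using assms(2-)
proof (induction "nat (deg M)" arbitrary: M rule: less_induct)
  case less
  interpret E: subalgebra "{f :: (nat \<times> nat, 'a) mpol. expressible_in_QB \<nu> m f}"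
    by (rule subalgebra_expressible)
  have step: ?case
    if M: "M = D + M'" and H: "expressible_in_QB \<nu> m H" "lead H D" "\<And>\<mu>. \<mu> \<in> Poly_Mapping.keys H \<Longrightarrow> deg \<mu> \<le> deg D"
      and D: "0 < deg D" and M': "semistandard M'" "balanced M'"
      "\<And>i. i < m \<Longrightarrow> even (Poly_Mapping.lookup M' (z_var \<nu> i))"
    for D M' and H :: "(nat \<times> nat, 'a) mpol"
  proof -
    have "0 \<le> deg M'" by (simp add: weight_def sum_nonneg)
    then have "nat (deg M') < nat (deg M)" using D by (simp add: M weight_add)
    moreover have "Poly_Mapping.keys M' \<subseteq> V" using less.prems(1) by (simp add: M keys_add_nat)
    ultimately obtain G :: "(nat \<times> nat, 'a) mpol" where G: "expressible_in_QB \<nu> m G" "lead G M'"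
      "\<forall>\<mu> \<in> Poly_Mapping.keys G. deg \<mu> \<le> deg M'"
      using less.hyps[OF _ _ M'] by blast
    have "expressible_in_QB \<nu> m (H * G)" using E.mult H(1) G(1) by simp
    moreover have "lead (H * G) M" unfolding M by (rule lead_mult[OF H(2) G(2)])
    moreover have "deg \<mu> \<le> deg M" if "\<mu> \<in> Poly_Mapping.keys (H * G)" for \<mu>
      using deg_mult_le[OF H(3) _ that, of "deg M'"] G(3) by (simp add: M weight_add)
    ultimately show ?thesis by blast
  qed
  consider "M = 0" | l where "l < m" "Poly_Mapping.lookup M (2 * \<nu>, l) \<noteq> 0"
    | v where "v \<in> Poly_Mapping.keys M" "fst v \<noteq> 2 * \<nu>"
  proof (cases "M = 0")
    case False
    then obtain v where v: "v \<in> Poly_Mapping.keys M" by (metis keys_eq_empty all_not_in_conv)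
    then have "v \<in> V" using less.prems(1) by auto
    then show ?thesis using that v by (cases v; cases "fst v = 2 * \<nu>") (auto simp: V_def in_keys_iff)
  qed
  then show ?case
  proof cases
    case 1
    then show ?thesis using E.one lead_1 by (intro exI[of _ 1]) auto
  next
    case (2 l)
    let ?D = "Poly_Mapping.single (2 * \<nu>, l) 2 :: nat \<times> nat \<Rightarrow>\<^sub>0 nat"
    have even: "even (Poly_Mapping.lookup M (2 * \<nu>, l))" using less.prems(4) 2 by simp
    then have "Poly_Mapping.lookup ?D u \<le> Poly_Mapping.lookup M u" for u
      using 2 by (auto simp: lookup_single when_def elim!: evenE)
    then obtain M' where M: "M = ?D + M'" using ex_add_of_le by blast
    have same: "Poly_Mapping.lookup M' (a, i) = Poly_Mapping.lookup M (a, i)" if "a \<noteq> 2 * \<nu>" for a i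
      using that by (simp add: M lookup_add lookup_single)
    show ?thesis
    proof (rule step[OF M])
      show "expressible_in_QB \<nu> m (Qpol \<nu> l)"
        using expressible_generator[of "QG l"] 2 by (auto simp: QB_def QB_vars_def)
      show "lead (Qpol \<nu> l) ?D" using 2 by (intro lead_Qpol)
      show "deg \<mu> \<le> deg ?D" if "\<mu> \<in> Poly_Mapping.keys (Qpol \<nu> l :: (nat \<times> nat, 'a) mpol)" for \<mu>
        using lead_Qpol(2)[OF 2(1) that] by simp
      show "semistandard M'"
        unfolding semistandard_def
      proof (intro allI impI)
        fix p i assume "Suc p < 2 * \<nu>" "i < m"
        moreover from this have "row (Suc p) \<noteq> 2 * \<nu>" "row p \<noteq> 2 * \<nu>"
          using row_less[of p] row_less[of "Suc p"] by auto
        ultimately show "(\<Sum>l\<le>i. Poly_Mapping.lookup M' (row (Suc p), l)) \<le> (\<Sum>l<i. Poly_Mapping.lookup M' (row p, l))"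
          using less.prems(2) by (simp add: same semistandard_def)
      qed
      show "balanced M'"
        using less.prems(3) by (simp add: balanced_def same)
      show "even (Poly_Mapping.lookup M' (z_var \<nu> i))" if "i < m" for i
        using less.prems(4)[OF that] by (auto simp: M lookup_add lookup_single when_def split: if_splits)
    qed simp
  next
    case (3 v)
    obtain "is" M' where "is": "sorted_wrt (<) is" "set is \<subseteq> {..<m}" "even (length is)" "length is \<le> 2 * \<nu>"
      "is \<noteq> []" and M: "M = diagonal 0 is + M'" and M': "semistandard M'" "balanced M'"
      using diagonal_split[OF less.prems(1,2,3) 3] by blast
    have z: "Poly_Mapping.lookup (diagonal 0 is) (2 * \<nu>, i) = 0" for i
      unfolding diagonal_def lookup_sum
    proof (intro sum.neutral ballI)
      fix p assume "p \<in> {..<length is}"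
      then have "row p < 2 * \<nu>" using "is"(4) by (intro row_less) auto
      then show "Poly_Mapping.lookup (Poly_Mapping.single (row (2 * 0 + p), is ! p) 1) (2 * \<nu>, i) = 0"
        by (simp add: lookup_single)
    qed
    show ?thesis
    proof (rule step[OF M])
      show "expressible_in_QB \<nu> m (pf (pairs 0) (set is) :: (nat \<times> nat, 'a) mpol)"
        by (rule expressible_pf[OF two "is"(2)])
      show "lead (pf (pairs 0) (set is) :: (nat \<times> nat, 'a) mpol) (diagonal 0 is)"
        using "is" by (intro lead_pf) auto
      show "deg \<mu> \<le> deg (diagonal 0 is)" if "\<mu> \<in> Poly_Mapping.keys (pf (pairs 0) (set is) :: (nat \<times> nat, 'a) mpol)" for \<mu>
        using deg_pf_pairs[OF finite_set that] card_length[of "is"] by (simp add: deg_diagonal)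
      show "0 < deg (diagonal 0 is)" using "is"(5) by (simp add: deg_diagonal)
      show "even (Poly_Mapping.lookup M' (z_var \<nu> i))" if "i < m" for i
        using less.prems(4)[OF that] by (simp add: M lookup_add z)
    qed (fact M')+
  qed
qed

section \<open>Subduction\<close>

lemma finite_bounded_monomials:
  "finite {\<mu>. Poly_Mapping.keys \<mu> \<subseteq> V \<and> deg \<mu> \<le> int d}"
proof -
  let ?A = "{\<mu> :: nat \<times> nat \<Rightarrow>\<^sub>0 nat. Poly_Mapping.keys \<mu> \<subseteq> V \<and> deg \<mu> \<le> int d}"
  have "Poly_Mapping.lookup \<mu> v \<le> d" if "\<mu> \<in> ?A" "v \<in> V" for \<mu> v
  proof -
    have "int (Poly_Mapping.lookup \<mu> v) \<le> (\<Sum>v\<in>V. int (Poly_Mapping.lookup \<mu> v))"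
      using that by (intro member_le_sum) auto
    also have "\<dots> = deg \<mu>" using that by (simp add: weight_superset[of V])
    finally show ?thesis using that by simp
  qed
  then have "Poly_Mapping.lookup ` ?A \<subseteq> {g. \<forall>v. (v \<in> V \<longrightarrow> g v \<in> {..d}) \<and> (v \<notin> V \<longrightarrow> g v = 0)}"
    by (auto simp: in_keys_iff subset_iff)
  then have "finite (Poly_Mapping.lookup ` ?A)"
    by (rule finite_subset) (intro finite_set_of_finite_funs finite_V finite_atMost)
  moreover have "inj_on Poly_Mapping.lookup ?A"
    by (auto intro!: inj_onI poly_mapping_eqI)
  ultimately show ?thesis by (rule finite_imageD)
qed

text \<open>The induction counts the monomials of degree at most \<open>d\<close> that do not exceed
  the leading one; with \<open>d\<close> fixed there are finitely many. Invariance, even z-exponents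
  and the degree bound all survive the subtraction.\<close>

lemma even_invariant_expressible:
  fixes f :: "(nat \<times> nat, 'k::alg_closed_field) mpol"
  assumes inf: "infinite (UNIV :: 'k set)" and two: "\<And>x :: 'k. x + x = 0"
    and "f \<in> polys_in V" "\<And>g. g \<in> formal_orth \<Longrightarrow> act \<nu> g f = f"
    and "\<forall>\<mu> \<in> Poly_Mapping.keys f. \<forall>i<m. even (Poly_Mapping.lookup \<mu> (z_var \<nu> i))"
    and "\<forall>\<mu> \<in> Poly_Mapping.keys f. deg \<mu> \<le> int d"
  shows "expressible_in_QB \<nu> m f"
  using assms(3-)
proof (induction "card {\<mu>. Poly_Mapping.keys \<mu> \<subseteq> V \<and> deg \<mu> \<le> int d \<and> (\<exists>N \<in> Poly_Mapping.keys f. key \<mu> \<le> key N)}"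
    arbitrary: f rule: less_induct)
  case less
  interpret E: subalgebra "{f :: (nat \<times> nat, 'k) mpol. expressible_in_QB \<nu> m f}"
    by (rule subalgebra_expressible)
  let ?A = "\<lambda>f :: (nat \<times> nat, 'k) mpol. {\<mu>. Poly_Mapping.keys \<mu> \<subseteq> V \<and> deg \<mu> \<le> int d \<and>
    (\<exists>N \<in> Poly_Mapping.keys f. key \<mu> \<le> key N)}"
  show ?case
  proof (cases "f = 0")
    case True
    then show ?thesis using E.zero by simp
  next
    case False
    obtain M where M: "M \<in> Poly_Mapping.keys f" and max: "\<And>N. N \<in> Poly_Mapping.keys f \<Longrightarrow> key N \<le> key M"
    proof -
      have "Max (key ` Poly_Mapping.keys f) \<in> key ` Poly_Mapping.keys f"
        using False by (intro Max_in) auto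
      then obtain M where "M \<in> Poly_Mapping.keys f" "key M = Max (key ` Poly_Mapping.keys f)" by auto
      then show thesis by (intro that[of M]) auto
    qed
    have keys_V: "Poly_Mapping.keys N \<subseteq> V" if "N \<in> Poly_Mapping.keys f" for N
      using less.prems(1) that by (auto simp: polys_in_def)
    obtain G :: "(nat \<times> nat, 'k) mpol" where G: "expressible_in_QB \<nu> m G" "lead G M"
      "\<forall>\<mu> \<in> Poly_Mapping.keys G. deg \<mu> \<le> deg M"
      using ex_expressible_lead[OF two keys_V[OF M] invariant_semistandard[OF inf two less.prems(1,2) M max]
        invariant_balanced[OF inf less.prems(1,2) M]] less.prems(3) M by blast
    \<comment> \<open>As \<open>G\<close> is monic, \<open>Cst c * G\<close> has the same leading
      term as \<open>f\<close>.\<close>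
    define c where "c = Poly_Mapping.lookup f M"
    let ?f' = "f - Cst c * G"
    have cG: "expressible_in_QB \<nu> m (Cst c * G)"
      using E.mult[OF E.Cst] G(1) by simp
    have keys_f': "\<mu> \<in> Poly_Mapping.keys f \<or> \<mu> \<in> Poly_Mapping.keys G" if "\<mu> \<in> Poly_Mapping.keys ?f'" for \<mu>
      using that Poly_Mapping.keys_diff[of f "Cst c * G"] keys_Cst_mult[of c G] by auto
    have f'_V: "?f' \<in> polys_in V"
      using less.prems(1) expressible_coord[OF two cG] by (intro subalgebra.diff[OF subalgebra_polys_in])
    have less_M: "key \<mu> < key M" if "\<mu> \<in> Poly_Mapping.keys ?f'" for \<mu>
    proof -
      have "key \<mu> \<le> key M"
        using keys_f'[OF that] max G(2) by (auto simp: lead_def)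
      moreover have "\<mu> \<noteq> M"
        using that G(2) by (auto simp: in_keys_iff lookup_minus lookup_Cst_mult lead_def c_def)
      ultimately show ?thesis
        using key_inj[of \<mu> M] f'_V that keys_V[OF M] by (fastforce simp: polys_in_def less_le)
    qed
    have "expressible_in_QB \<nu> m ?f'"
    proof (rule less.hyps)
      have "?A ?f' \<subset> ?A f"
      proof
        show "?A ?f' \<subseteq> ?A f"
        proof
          fix \<mu> assume \<mu>: "\<mu> \<in> ?A ?f'"
          then obtain N where "N \<in> Poly_Mapping.keys ?f'" "key \<mu> \<le> key N" by blast
          with less_M[of N] have "key \<mu> \<le> key M" by simp
          with \<mu> M show "\<mu> \<in> ?A f" by blast
        qed
        have "M \<in> ?A f" using M less.prems(4) keys_V[OF M] by auto
        moreover have "M \<notin> ?A ?f'" using less_M by (auto simp: not_le)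
        ultimately show "?A ?f' \<noteq> ?A f" by blast
      qed
      moreover have "finite (?A f)"
        using finite_bounded_monomials[of d] by (rule rev_finite_subset) auto
      ultimately show "card (?A ?f') < card (?A f)"
        by (intro psubset_card_mono)
      show "act \<nu> g ?f' = ?f'" if "g \<in> formal_orth" for g
        using less.prems(2)[OF that] act_expressible[OF that cG] by (simp add: act_def subst_pol_diff)
      show "\<forall>\<mu> \<in> Poly_Mapping.keys ?f'. \<forall>i<m. even (Poly_Mapping.lookup \<mu> (z_var \<nu> i))"
        using keys_f' less.prems(3) expressible_even[OF two G(1)] by blast
      show "\<forall>\<mu> \<in> Poly_Mapping.keys ?f'. deg \<mu> \<le> int d"
        using keys_f' less.prems(4) G(3) M by force
    qed (fact f'_V)
    then show ?thesis using E.add[of ?f' "Cst c * G"] cG by simp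
  qed
qed

end

text \<open>Over a finite field the product of all X - a, increased by 1, takes the value 1
  everywhere and has no root.\<close>

lemma infinite_alg_closed: "infinite (UNIV :: 'k::alg_closed_field set)"
proof
  assume fin: "finite (UNIV :: 'k set)"
  define p :: "'k poly" where "p = (\<Prod>a\<in>UNIV. [:- a, 1:])"
  have deg: "Polynomial.degree p = card (UNIV :: 'k set)"
    unfolding p_def by (simp add: degree_prod_eq_sum_degree)
  have "card (UNIV :: 'k set) > 0" using fin by (simp add: card_gt_0_iff)
  then have "Polynomial.degree (p + 1) > 0"
    using deg by (subst degree_add_eq_left) auto
  then obtain x where "poly (p + 1) x = 0" using alg_closed_imp_poly_has_root by blast
  moreover have "poly p x = 0"
    using fin by (auto simp: p_def poly_prod)
  ultimately show False by simp
qed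

theorem theorem3p1:
  fixes \<nu> m :: nat
    and f :: "(nat \<times> nat, 'k::alg_closed_field) mpol"
  assumes "CHAR('k) = 2"
    and "f \<in> orth_invariants \<nu> m"
  shows "expressible_in_QB \<nu> m f \<longleftrightarrow>
    (\<forall>\<mu> \<in> Poly_Mapping.keys f. \<forall>i<m. even (Poly_Mapping.lookup \<mu> (z_var \<nu> i)))"
proof
  interpret vec_coords \<nu> m .
  note two = char_two_double[OF assms(1)]
  show "\<forall>\<mu> \<in> Poly_Mapping.keys f. \<forall>i<m. even (Poly_Mapping.lookup \<mu> (z_var \<nu> i))"
    if "expressible_in_QB \<nu> m f"
    using expressible_even[OF two that] by blast
  show "expressible_in_QB \<nu> m f"
    if even: "\<forall>\<mu> \<in> Poly_Mapping.keys f. \<forall>i<m. even (Poly_Mapping.lookup \<mu> (z_var \<nu> i))"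
  proof (rule even_invariant_expressible[OF infinite_alg_closed two _ _ even])
    show "f \<in> polys_in V"
      using assms(2) by (simp add: orth_invariants_def coord_ring_V)
    show "act \<nu> g f = f" if "g \<in> formal_orth" for g
      using assms(2) that by (simp add: orth_invariants_def formal_orth_def)
    \<comment> \<open>The sum of the degrees is a crude common bound that also makes sense for f =
      0.\<close>
    let ?d = "\<Sum>\<mu> \<in> Poly_Mapping.keys f. nat (deg \<mu>)"
    show "\<forall>\<mu> \<in> Poly_Mapping.keys f. deg \<mu> \<le> int ?d"
    proof
      fix \<mu> assume "\<mu> \<in> Poly_Mapping.keys f"
      then have "nat (deg \<mu>) \<le> ?d" by (intro member_le_sum) auto
      then show "deg \<mu> \<le> int ?d" by linarith
    qed
  qed
qed

end
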